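(* The right $\mathsf{Ham}$-module $\mathsf{CycHam}$ of directed Hamiltonian cycles, with its quadratic presentation (one generator $a$ in component $\mathsf{P}_1$, one relation $a\circ^{\mathsf{P}_2}_{\{1,2\}}\nu-a\circ^{\mathsf{P}_2}_{\{1,2\}}\nu^{(12)}$), is Koszul: the map from the Koszul complex $\mathsf{CycHam}^{\text{!`}}\circ\mathsf{Ham}\to\mathsf{CycHam}$ is a quasi-isomorphism.
   Context: Graphs are finite, simple, undirected; tubes (nonempty vertex sets inducing connected subgraphs), contractions $\Gamma/G$, $\Gamma/I$ for partitions $I\vdash\Gamma$ of $V_\Gamma$ into tubes, and $\mathsf{P}_n$ (path on $\{1,\dots,n\}$) as usual. Over a field $\mathsf{k}$, with dg vector spaces and Koszul signs. A graphical collection assigns a vector space to each nonempty connected graph, functorially in isomorphisms; contraction product $(\mathcal{P}\circ\mathcal{Q})(\Gamma)=\bigoplus_{I\vdash\Gamma}\mathcal{P}(\Gamma/I)\otimes\bigotimes_{G\in I}\mathcal{Q}(\Gamma|_G)$; infinitesimal product $(\mathcal{A}\circ'\mathcal{B})(\Gamma)=\bigoplus_{G\text{ tube}}\mathcal{A}(\Gamma/G)\otimes\mathcal{B}(\Gamma|_G)$. A contractad is a monoid for $\circ$ (unit $\mathrm{Id}\in\mathcal{P}(\mathsf{P}_1)$, infinitesimal compositions $\circ^\Gamma_G:\mathcal{P}(\Gamma/G)\otimes\mathcal{P}(\Gamma|_G)\to\mathcal{P}(\Gamma)$); a right $\mathcal{P}$-module is a collection $\mathcal{M}$ with an associative unital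 action $\mathcal{M}\circ\mathcal{P}\to\mathcal{M}$ (infinitesimally $\circ^\Gamma_G:\mathcal{M}(\Gamma/G)\otimes\mathcal{P}(\Gamma|_G)\to\mathcal{M}(\Gamma)$); comodules over cocontractads dually. $\mathsf{Ham}$: $\mathsf{Ham}(\Gamma)$ has basis the directed Hamiltonian paths $(v_1,\dots,v_n)$ of $\Gamma$; $\circ^\Gamma_G$ substitutes a path $(w_1,\dots,w_m)$ of $\Gamma|_G$ for the vertex $\{G\}$ in a path of $\Gamma/G$, giving the resulting sequence if its consecutive vertices are adjacent and $0$ otherwise. Quadratic presentation: $E=\mathsf{k}\{\nu,\nu^{(12)}\}\subseteq\mathsf{Ham}(\mathsf{P}_2)$, $\nu=(1,2)$, $\nu^{(12)}=(2,1)$; the free contractad $\mathbb{T}(E)$ has basis of planar binary $\Gamma$-admissible trees (leaves labelled by $V_\Gamma$, leaf set below each vertex a tube); relations $R$ are spanned, for connected 3-vertex graphs and orderings $(v_1,v_2,v_3)$, by $((v_1v_2)v_3)-(v_1(v_2v_3))$ if $v_1v_2,v_2v_3$ are edges, $((v_1v_2)v_3)$ if only $v_1v_2$ is an edge, $(v_1(v_2v_3))$ if only $v_2v_3$ is an edge, where $((v_1v_2)v_3)$ denotes the planar tree with a cherry $v_1,v_2$ on the left of the root and leaf $v_3$ on the right, and $(v_1(v_2v_3))$ the tree with leaf $v_1$ on the left and cherry $v_2,v_3$ on the right; $\mathsf{Ham}\cong\mathbb{T}(E)/\langle R\rangle$. $\mathsf{CycHam}$: for connected $\Gamma$ with $n\ge3$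 vertices, $\mathsf{CycHam}(\Gamma)$ has basis the directed Hamiltonian cycles $[v_1,\dots,v_n]$ (sequences up to rotation, consecutive vertices and $v_n,v_1$ adjacent); by convention $\mathsf{CycHam}(\mathsf{P}_1)$ is spanned by the loop $[1]$ and $\mathsf{CycHam}(\mathsf{P}_2)$ by $[1,2]=[2,1]$. The right $\mathsf{Ham}$-action $\circ^\Gamma_G$ substitutes a path $(w_1,\dots,w_m)$ of $\Gamma|_G$ for $\{G\}$ in a cycle $[\dots,v_{k-1},\{G\},v_{k+1},\dots]$ of $\Gamma/G$, giving $[\dots,v_{k-1},w_1,\dots,w_m,v_{k+1},\dots]$ if $v_{k-1}\sim w_1$ and $w_m\sim v_{k+1}$ (indices cyclic; when $\Gamma/G$ is a single vertex, $[\{G\}]\circ(w_1,\dots,w_m)$ is the cycle $[w_1,\dots,w_m]$ if $m\le2$ or $w_m\sim w_1$), and $0$ otherwise. Presentation: $V=\mathsf{k}a$ in component $\mathsf{P}_1$, degree $0$, $H=\mathsf{k}(a\circ^{\mathsf{P}_2}_{\{1,2\}}\nu-a\circ^{\mathsf{P}_2}_{\{1,2\}}\nu^{(12)})\subseteq V\circ'E$; $\mathsf{CycHam}\cong(V\circ\mathsf{Ham})/(\text{submodule generated by }H)$ via $a\mapsto[1]$. Koszul dual and Koszul complex: $\mathsf{Ham}^{\text{!`}}$ is the largest sub-cocontractad of the cofree conilpotent cocontractad $\mathbb{T}^c(sE)$ ($sE$ = $E$ in degree $1$) whose composite with the projection to $(sE\circ' sE)/s^2R$ vanishes. For a right module $\mathcal{M}=\langle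 V,H\rangle$, $\mathcal{M}^{\text{!`}}$ is the largest sub-right-$\mathsf{Ham}^{\text{!`}}$-comodule of the cofree comodule $V\circ\mathsf{Ham}^{\text{!`}}$ whose composite with the projection to $(V\circ' sE)/sH$ vanishes. The Koszul complex is the free right $\mathsf{Ham}$-module $\mathcal{M}^{\text{!`}}\circ\mathsf{Ham}$ with differential the right-module map induced by $\mathcal{M}^{\text{!`}}\to\mathcal{M}^{\text{!`}}\circ' sE\xrightarrow{s^{-1}}\mathcal{M}^{\text{!`}}\circ' E\hookrightarrow\mathcal{M}^{\text{!`}}\circ\mathsf{Ham}$ (first map: infinitesimal decomposition), and the map to $\mathcal{M}$ is induced by the projection $\mathcal{M}^{\text{!`}}\to V\to\mathcal{M}$. $\mathcal{M}$ is Koszul if this map is a quasi-isomorphism. *)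

theory Defs
  imports Complex_Main "HOL-Library.Poly_Mapping" "HOL-Library.Disjoint_Sets" "HOL-Library.FuncSet"
begin

section \<open>Free vector spaces\<close>

text \<open>The vector space with basis \<open>'b\<close> over the field \<open>'k\<close> is the type of finitely supported
  functions \<open>'b \<Rightarrow>\<^sub>0 'k\<close>; the basis vector of \<open>b\<close> is \<open>Poly_Mapping.single b 1\<close>, written \<open>basis_vec b\<close>.\<close>

abbreviation basis_vec :: "'b \<Rightarrow> 'b \<Rightarrow>\<^sub>0 'k::field"
  where "basis_vec b \<equiv> Poly_Mapping.single b 1"

definition smul :: "'k::field \<Rightarrow> ('b \<Rightarrow>\<^sub>0 'k) \<Rightarrow> ('b \<Rightarrow>\<^sub>0 'k)"
  where "smul c x = Poly_Mapping.map ((*) c) x"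

lemma lookup_smul [simp]: "Poly_Mapping.lookup (smul c x) b = c * Poly_Mapping.lookup x b"
  unfolding smul_def by (simp add: Poly_Mapping.map.rep_eq when_def)

interpretation free: vector_space smul
  by unfold_locales (auto intro!: poly_mapping_eqI simp: lookup_add algebra_simps)

definition lin_ext :: "('b \<Rightarrow> 'c \<Rightarrow>\<^sub>0 'k::field) \<Rightarrow> ('b \<Rightarrow>\<^sub>0 'k) \<Rightarrow> ('c \<Rightarrow>\<^sub>0 'k)"
  where "lin_ext f x = (\<Sum>b\<in>Poly_Mapping.keys x. smul (Poly_Mapping.lookup x b) (f b))"

definition tensor :: "('b \<Rightarrow>\<^sub>0 'k::field) \<Rightarrow> ('c \<Rightarrow>\<^sub>0 'k) \<Rightarrow> ('b \<times> 'c \<Rightarrow>\<^sub>0 'k)"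
  where "tensor x y = lin_ext (\<lambda>b. lin_ext (\<lambda>c. basis_vec (b, c)) y) x"

definition tensor_space ::
    "('b \<Rightarrow>\<^sub>0 'k::field) set \<Rightarrow> ('c \<Rightarrow>\<^sub>0 'k) set \<Rightarrow> ('b \<times> 'c \<Rightarrow>\<^sub>0 'k) set"
  where "tensor_space X Y = free.span {tensor x y | x y. x \<in> X \<and> y \<in> Y}"

lemma linear_lin_ext: "Vector_Spaces.linear smul smul (lin_ext f)"
proof -
  have ext: "lin_ext f x = (\<Sum>b\<in>S. smul (Poly_Mapping.lookup x b) (f b))"
    if "finite S" "Poly_Mapping.keys x \<subseteq> S" for S x
    unfolding lin_ext_def using that
    by (intro sum.mono_neutral_left) (auto simp: in_keys_iff)
  have add: "lin_ext f (x + y) = lin_ext f x + lin_ext f y" for x y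
    using ext[of "Poly_Mapping.keys x \<union> Poly_Mapping.keys y" x]
      ext[of "Poly_Mapping.keys x \<union> Poly_Mapping.keys y" y]
      ext[of "Poly_Mapping.keys x \<union> Poly_Mapping.keys y" "x+y"] Poly_Mapping.keys_add[of x y]
    by (simp add: lookup_add free.scale_left_distrib sum.distrib)
  have sc: "lin_ext f (smul c x) = smul c (lin_ext f x)" for c x
  proof -
    have "Poly_Mapping.keys (smul c x) \<subseteq> Poly_Mapping.keys x" by (auto simp: in_keys_iff)
    then show ?thesis using ext[of "Poly_Mapping.keys x" "smul c x"]
      by (simp add: lin_ext_def free.scale_sum_right)
  qed
  show ?thesis by unfold_locales (auto simp: add sc)
qed

lemma tensor_space_mono: "X \<subseteq> X' \<Longrightarrow> Y \<subseteq> Y' \<Longrightarrow> tensor_space X Y \<subseteq> tensor_space X' Y'"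
  unfolding tensor_space_def by (intro free.span_mono) blast

lemma span_image_lin_ext: "lin_ext f ` free.span S = free.span (lin_ext f ` S)"
  using linear_lin_ext[of f] module_hom.span_image[of smul smul "lin_ext f" S]
  by (simp add: Vector_Spaces.linear_iff_module_hom)


section \<open>Chain complexes and quasi-isomorphisms\<close>

definition chain_complex ::
    "(nat \<Rightarrow> ('b \<Rightarrow>\<^sub>0 'k::field) set) \<Rightarrow> (('b \<Rightarrow>\<^sub>0 'k) \<Rightarrow> ('b \<Rightarrow>\<^sub>0 'k)) \<Rightarrow> bool"
  where "chain_complex K d \<longleftrightarrow>
    (\<forall>n. free.subspace (K n)) \<and> Vector_Spaces.linear smul smul d \<and>
    d ` K 0 \<subseteq> {0} \<and> (\<forall>n. d ` K (Suc n) \<subseteq> K n) \<and> (\<forall>n. \<forall>x\<in>K n. d (d x) = 0)"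

definition chain_map ::
    "(nat \<Rightarrow> ('b \<Rightarrow>\<^sub>0 'k::field) set) \<Rightarrow> (('b \<Rightarrow>\<^sub>0 'k) \<Rightarrow> ('b \<Rightarrow>\<^sub>0 'k)) \<Rightarrow>
     (nat \<Rightarrow> ('c \<Rightarrow>\<^sub>0 'k) set) \<Rightarrow> (('c \<Rightarrow>\<^sub>0 'k) \<Rightarrow> ('c \<Rightarrow>\<^sub>0 'k)) \<Rightarrow>
     (('b \<Rightarrow>\<^sub>0 'k) \<Rightarrow> ('c \<Rightarrow>\<^sub>0 'k)) \<Rightarrow> bool"
  where "chain_map K d L e f \<longleftrightarrow>
    Vector_Spaces.linear smul smul f \<and>
    (\<forall>n. f ` K n \<subseteq> L n) \<and> (\<forall>n. \<forall>x\<in>K n. f (d x) = e (f x))"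

definition cycle_space ::
    "(nat \<Rightarrow> ('b \<Rightarrow>\<^sub>0 'k::field) set) \<Rightarrow> (('b \<Rightarrow>\<^sub>0 'k) \<Rightarrow> ('b \<Rightarrow>\<^sub>0 'k)) \<Rightarrow> nat \<Rightarrow> ('b \<Rightarrow>\<^sub>0 'k) set"
  where "cycle_space K d n = {x \<in> K n. d x = 0}"

definition homologous ::
    "(nat \<Rightarrow> ('b \<Rightarrow>\<^sub>0 'k::field) set) \<Rightarrow> (('b \<Rightarrow>\<^sub>0 'k) \<Rightarrow> ('b \<Rightarrow>\<^sub>0 'k)) \<Rightarrow> nat \<Rightarrow>
     (('b \<Rightarrow>\<^sub>0 'k) \<times> ('b \<Rightarrow>\<^sub>0 'k)) set"
  where "homologous K d n =
    {(x, y). x \<in> cycle_space K d n \<and> y \<in> cycle_space K d n \<and> x - y \<in> d ` K (Suc n)}"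

definition homology ::
    "(nat \<Rightarrow> ('b \<Rightarrow>\<^sub>0 'k::field) set) \<Rightarrow> (('b \<Rightarrow>\<^sub>0 'k) \<Rightarrow> ('b \<Rightarrow>\<^sub>0 'k)) \<Rightarrow> nat \<Rightarrow> ('b \<Rightarrow>\<^sub>0 'k) set set"
  where "homology K d n = cycle_space K d n // homologous K d n"

text \<open>The map induced on homology sends the class \<open>c\<close> to the class containing \<open>f ` c\<close>.\<close>

definition quasi_iso ::
    "(nat \<Rightarrow> ('b \<Rightarrow>\<^sub>0 'k::field) set) \<Rightarrow> (('b \<Rightarrow>\<^sub>0 'k) \<Rightarrow> ('b \<Rightarrow>\<^sub>0 'k)) \<Rightarrow>
     (nat \<Rightarrow> ('c \<Rightarrow>\<^sub>0 'k) set) \<Rightarrow> (('c \<Rightarrow>\<^sub>0 'k) \<Rightarrow> ('c \<Rightarrow>\<^sub>0 'k)) \<Rightarrow>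
     (('b \<Rightarrow>\<^sub>0 'k) \<Rightarrow> ('c \<Rightarrow>\<^sub>0 'k)) \<Rightarrow> bool"
  where "quasi_iso K d L e f \<longleftrightarrow>
    chain_complex K d \<and> chain_complex L e \<and> chain_map K d L e f \<and>
    (\<forall>n. bij_betw (\<lambda>c. homologous L e n `` (f ` c)) (homology K d n) (homology L e n))"


section \<open>Graphs, tubes and contractions\<close>

text \<open>Finite graphs are taken on sets of natural numbers, which represents every isomorphism
  class. This lets the vertex \<open>{G}\<close> of a contraction be named \<open>Min G\<close>, so that contractions are
  again graphs on natural numbers and contracting in stages agrees on the nose with contracting
  at once. All subcollections below are required to be invariant under relabelling,
  so the choice of names is immaterial.\<close>

datatype graph = Graph (verts: "nat set") (edges: "(nat \<times> nat) set")

definition simple_graph :: "graph \<Rightarrow> bool"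
  where "simple_graph \<Gamma> \<longleftrightarrow> finite (verts \<Gamma>) \<and> edges \<Gamma> \<subseteq> verts \<Gamma> \<times> verts \<Gamma> \<and>
    sym (edges \<Gamma>) \<and> irrefl (edges \<Gamma>)"

definition tube :: "graph \<Rightarrow> nat set \<Rightarrow> bool"
  where "tube \<Gamma> G \<longleftrightarrow> G \<noteq> {} \<and> G \<subseteq> verts \<Gamma> \<and>
    (\<forall>u\<in>G. \<forall>v\<in>G. (u, v) \<in> (edges \<Gamma> \<inter> G \<times> G)\<^sup>*)"

definition connected_graph :: "graph \<Rightarrow> bool"
  where "connected_graph \<Gamma> \<longleftrightarrow> simple_graph \<Gamma> \<and> tube \<Gamma> (verts \<Gamma>)"

definition relabel :: "(nat \<Rightarrow> nat) \<Rightarrow> graph \<Rightarrow> graph"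
  where "relabel \<sigma> \<Gamma> = Graph (\<sigma> ` verts \<Gamma>) (map_prod \<sigma> \<sigma> ` edges \<Gamma>)"

definition restr :: "graph \<Rightarrow> nat set \<Rightarrow> graph"
  where "restr \<Gamma> G = Graph G (edges \<Gamma> \<inter> G \<times> G)"

definition tube_partition :: "graph \<Rightarrow> nat set set \<Rightarrow> bool"
  where "tube_partition \<Gamma> I \<longleftrightarrow> partition_on (verts \<Gamma>) I \<and> (\<forall>G\<in>I. tube \<Gamma> G)"

definition contract :: "graph \<Rightarrow> nat set set \<Rightarrow> graph"
  where "contract \<Gamma> I = Graph (Min ` I)
    {(Min A, Min B) | A B. A \<in> I \<and> B \<in> I \<and> A \<noteq> B \<and> (\<exists>u\<in>A. \<exists>v\<in>B. (u, v) \<in> edges \<Gamma>)}"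

definition contract_tube :: "graph \<Rightarrow> nat set \<Rightarrow> graph"
  where "contract_tube \<Gamma> G = contract \<Gamma> (insert G ((\<lambda>v. {v}) ` (verts \<Gamma> - G)))"


section \<open>Hamiltonian paths and cycles\<close>

definition ham_paths :: "graph \<Rightarrow> nat list set"
  where "ham_paths \<Gamma> =
    {w. distinct w \<and> set w = verts \<Gamma> \<and> successively (\<lambda>u v. (u, v) \<in> edges \<Gamma>) w}"

definition block_of :: "nat set set \<Rightarrow> nat \<Rightarrow> nat set"
  where "block_of I v = (THE A. A \<in> I \<and> Min A = v)"

definition substitute :: "nat set set \<Rightarrow> (nat set \<Rightarrow> nat list) \<Rightarrow> nat list \<Rightarrow> nat list"
  where "substitute I p q = concat (map (\<lambda>v. p (block_of I v)) q)"

text \<open>The composition of \<open>Ham\<close> on basis elements \<open>q \<in> Ham(\<Gamma>/I)\<close>, \<open>p G \<in> Ham(\<Gamma>|G)\<close> for \<open>G \<in> I\<close>. It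
  is the iterate of the infinitesimal compositions: if the final sequence has adjacent consecutive
  vertices in \<open>\<Gamma>\<close>, then so do all the intermediate ones in the intermediate contractions.\<close>

definition ham_comp :: "graph \<Rightarrow> nat set set \<Rightarrow> nat list \<Rightarrow> (nat set \<Rightarrow> nat list) \<Rightarrow> nat list \<Rightarrow>\<^sub>0 'k::field"
  where "ham_comp \<Gamma> I q p =
    (let w = substitute I p q in if w \<in> ham_paths \<Gamma> then basis_vec w else 0)"

text \<open>A directed Hamiltonian cycle is the set of all rotations of one of its sequences.
  The bound \<open>length w \<le> 2\<close> encodes the conventions \<open>[1]\<close> and \<open>[1,2] = [2,1]\<close>.\<close>

definition rotations :: "nat list \<Rightarrow> nat list set"
  where "rotations w = {rotate i w | i. True}"

definition closed_ham_paths :: "graph \<Rightarrow> nat list set"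
  where "closed_ham_paths \<Gamma> =
    {w \<in> ham_paths \<Gamma>. length w \<le> 2 \<or> (last w, hd w) \<in> edges \<Gamma>}"

definition ham_cycles :: "graph \<Rightarrow> nat list set set"
  where "ham_cycles \<Gamma> = rotations ` closed_ham_paths \<Gamma>"

definition cycham :: "graph \<Rightarrow> (nat list set \<Rightarrow>\<^sub>0 'k::field) set"
  where "cycham \<Gamma> = free.span (basis_vec ` ham_cycles \<Gamma>)"

text \<open>The right action of \<open>Ham\<close> on \<open>CycHam\<close>, on basis elements \<open>c \<in> CycHam(\<Gamma>/I)\<close> and
  \<open>p G \<in> Ham(\<Gamma>|G)\<close>; the result does not depend on the representative of \<open>c\<close>.\<close>

definition cycham_act ::
    "graph \<Rightarrow> nat set set \<Rightarrow> nat list set \<Rightarrow> (nat set \<Rightarrow> nat list) \<Rightarrow> nat list set \<Rightarrow>\<^sub>0 'k::field"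
  where "cycham_act \<Gamma> I c p =
    (let w = substitute I p (SOME q. q \<in> c)
     in if w \<in> closed_ham_paths \<Gamma> then basis_vec (rotations w) else 0)"


section \<open>The cofree cocontractad on the generators\<close>

datatype 'v ptree = Lf 'v | Br "'v ptree" "'v ptree"

fun leaf_list :: "'v ptree \<Rightarrow> 'v list"
  where
    "leaf_list (Lf v) = [v]"
  | "leaf_list (Br l r) = leaf_list l @ leaf_list r"

fun inner :: "'v ptree \<Rightarrow> nat"
  where
    "inner (Lf v) = 0"
  | "inner (Br l r) = Suc (inner l + inner r)"

fun subtrees :: "'v ptree \<Rightarrow> 'v ptree set"
  where
    "subtrees (Lf v) = {Lf v}"
  | "subtrees (Br l r) = insert (Br l r) (subtrees l \<union> subtrees r)"

definition admissible_trees :: "graph \<Rightarrow> nat ptree set"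
  where "admissible_trees \<Gamma> = {t. distinct (leaf_list t) \<and> set_ptree t = verts \<Gamma> \<and>
    (\<forall>s\<in>subtrees t. tube \<Gamma> (set_ptree s))}"

text \<open>A tree \<open>t\<close> with \<open>m\<close> inner vertices stands for the tensor of its \<open>m\<close> vertex decorations
  in \<open>sE\<close>, multiplied in depth-first preorder (root, left subtree, right subtree); it has degree
  \<open>m\<close>, which on \<open>\<Gamma>\<close> is \<open>card (verts \<Gamma>) - 1\<close>.\<close>

definition cofree :: "graph \<Rightarrow> (nat ptree \<Rightarrow>\<^sub>0 'k::field) set"
  where "cofree \<Gamma> = free.span (basis_vec ` admissible_trees \<Gamma>)"

definition subtree_on :: "nat set \<Rightarrow> nat ptree \<Rightarrow> nat ptree"
  where "subtree_on G t = (THE s. s \<in> subtrees t \<and> set_ptree s = G)"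

fun collapse :: "nat set \<Rightarrow> nat ptree \<Rightarrow> nat ptree"
  where
    "collapse G (Lf v) = (if G = {v} then Lf (Min G) else Lf v)"
  | "collapse G (Br l r) =
      (if G = set_ptree (Br l r) then Lf (Min G) else Br (collapse G l) (collapse G r))"

text \<open>The number of inner vertices that come after those of the subtree on \<open>G\<close> in preorder.\<close>

fun inner_after :: "nat set \<Rightarrow> nat ptree \<Rightarrow> nat"
  where
    "inner_after G (Lf v) = 0"
  | "inner_after G (Br l r) =
      (if G = set_ptree (Br l r) then 0
       else if G \<subseteq> set_ptree l then inner_after G l + inner r
       else inner_after G r)"

text \<open>The infinitesimal decomposition along the tube \<open>G\<close> cuts \<open>t\<close> at the subtree with leaf set \<open>G\<close>,
  and is zero if there is none. The Koszul sign comes from moving the (odd) vertices of that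
  subtree to the right of all the other ones.\<close>

definition decomp :: "nat set \<Rightarrow> nat ptree \<Rightarrow> nat ptree \<times> nat ptree \<Rightarrow>\<^sub>0 'k::field"
  where "decomp G t =
    (if G \<in> set_ptree ` subtrees t
     then Poly_Mapping.single (collapse G t, subtree_on G t)
            ((-1) ^ (inner (subtree_on G t) * inner_after G t))
     else 0)"


section \<open>Koszul duals\<close>

definition relabel_vec :: "(nat \<Rightarrow> nat) \<Rightarrow> (nat ptree \<Rightarrow>\<^sub>0 'k::field) \<Rightarrow> (nat ptree \<Rightarrow>\<^sub>0 'k)"
  where "relabel_vec \<sigma> = lin_ext (\<lambda>t. basis_vec (map_ptree \<sigma> t))"

definition subcollection :: "(graph \<Rightarrow> (nat ptree \<Rightarrow>\<^sub>0 'k::field) set) \<Rightarrow> bool"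
  where "subcollection C \<longleftrightarrow> (\<forall>\<Gamma>. connected_graph \<Gamma> \<longrightarrow>
    free.subspace (C \<Gamma>) \<and> C \<Gamma> \<subseteq> cofree \<Gamma> \<and>
    (\<forall>\<sigma>. inj_on \<sigma> (verts \<Gamma>) \<longrightarrow> C (relabel \<sigma> \<Gamma>) = relabel_vec \<sigma> ` C \<Gamma>))"

text \<open>Closure under the infinitesimal decompositions for all tubes is the same as closure under the
  full ones, since those are iterated infinitesimal decompositions. Each component of the cofree
  cocontractad is concentrated in a single degree, so its subspaces are graded.\<close>

definition sub_cocontractad :: "(graph \<Rightarrow> (nat ptree \<Rightarrow>\<^sub>0 'k::field) set) \<Rightarrow> bool"
  where "sub_cocontractad C \<longleftrightarrow> subcollection C \<and>
    (\<forall>\<Gamma> G. connected_graph \<Gamma> \<longrightarrow> tube \<Gamma> G \<longrightarrow>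
      lin_ext (decomp G) ` C \<Gamma> \<subseteq> tensor_space (C (contract_tube \<Gamma> G)) (C (restr \<Gamma> G)))"

text \<open>\<open>sE \<circ>' sE\<close> lives on three-vertex graphs, where it is all of the cofree cocontractad. So
  the composite of \<open>C\<close> with the projection to \<open>(sE \<circ>' sE)/s\<^sup>2R\<close> vanishes iff \<open>C \<Gamma> \<subseteq> R \<Gamma>\<close> for
  three-vertex \<open>\<Gamma>\<close>. Likewise, for \<open>V = k a\<close> in the one-vertex component, \<open>V \<circ>' sE\<close> lives on
  two-vertex graphs, and the condition for comodules is \<open>N \<Gamma> \<subseteq> H \<Gamma>\<close> for those. The shifts
  \<open>s\<close>, \<open>s\<^sup>2\<close> produce no signs, as \<open>a\<close> and \<open>E\<close> have degree 0 and trees are read in preorder.\<close>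

definition satisfies_relations ::
    "(graph \<Rightarrow> (nat ptree \<Rightarrow>\<^sub>0 'k::field) set) \<Rightarrow> nat \<Rightarrow> (graph \<Rightarrow> (nat ptree \<Rightarrow>\<^sub>0 'k) set) \<Rightarrow> bool"
  where "satisfies_relations R m C \<longleftrightarrow>
    (\<forall>\<Gamma>. connected_graph \<Gamma> \<longrightarrow> card (verts \<Gamma>) = m \<longrightarrow> C \<Gamma> \<subseteq> R \<Gamma>)"

definition koszul_dual ::
    "(graph \<Rightarrow> (nat ptree \<Rightarrow>\<^sub>0 'k::field) set) \<Rightarrow> graph \<Rightarrow> (nat ptree \<Rightarrow>\<^sub>0 'k) set"
  where "koszul_dual R \<Gamma> = free.span (\<Union>{C \<Gamma> | C. sub_cocontractad C \<and> satisfies_relations R 3 C})"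

text \<open>For \<open>V = k a\<close> concentrated in the one-vertex component, \<open>V \<circ> P\<close> for a cocontractad \<open>P\<close> only has
  the summand of the partition into a single tube; \<open>a \<otimes> x\<close> is identified with \<open>x \<in> P(\<Gamma>)\<close>. As \<open>a\<close>
  has degree 0, the coaction is the decomposition of \<open>P\<close>.\<close>

definition sub_comodule ::
    "(graph \<Rightarrow> (nat ptree \<Rightarrow>\<^sub>0 'k::field) set) \<Rightarrow> (graph \<Rightarrow> (nat ptree \<Rightarrow>\<^sub>0 'k) set) \<Rightarrow> bool"
  where "sub_comodule P N \<longleftrightarrow> subcollection N \<and>
    (\<forall>\<Gamma>. connected_graph \<Gamma> \<longrightarrow> N \<Gamma> \<subseteq> P \<Gamma>) \<and>
    (\<forall>\<Gamma> G. connected_graph \<Gamma> \<longrightarrow> tube \<Gamma> G \<longrightarrow>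
      lin_ext (decomp G) ` N \<Gamma> \<subseteq> tensor_space (N (contract_tube \<Gamma> G)) (P (restr \<Gamma> G)))"

definition koszul_dual_comodule ::
    "(graph \<Rightarrow> (nat ptree \<Rightarrow>\<^sub>0 'k::field) set) \<Rightarrow> (graph \<Rightarrow> (nat ptree \<Rightarrow>\<^sub>0 'k) set) \<Rightarrow>
     graph \<Rightarrow> (nat ptree \<Rightarrow>\<^sub>0 'k) set"
  where "koszul_dual_comodule P H \<Gamma> =
    free.span (\<Union>{N \<Gamma> | N. sub_comodule P N \<and> satisfies_relations H 2 N})"

text \<open>The two duals are the largest objects of their kind.\<close>

lemma subcollection_span_Union:
  fixes F :: "(graph \<Rightarrow> (nat ptree \<Rightarrow>\<^sub>0 'k::field) set) set"
  assumes F: "\<And>C. C \<in> F \<Longrightarrow> subcollection C"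
  shows "subcollection (\<lambda>\<Gamma>. free.span (\<Union>{C \<Gamma> | C. C \<in> F}))"
  unfolding subcollection_def
proof (intro conjI allI impI)
  fix \<Gamma> assume g: "connected_graph \<Gamma>"
  show "free.subspace (free.span (\<Union>{C \<Gamma> | C. C \<in> F}))" by simp
  show "free.span (\<Union>{C \<Gamma> | C. C \<in> F}) \<subseteq> cofree \<Gamma>"
  proof (rule free.span_minimal)
    show "\<Union>{C \<Gamma> | C. C \<in> F} \<subseteq> cofree \<Gamma>"
      using F g unfolding subcollection_def by blast
  qed (simp add: cofree_def)
  fix \<sigma> :: "nat \<Rightarrow> nat" assume "inj_on \<sigma> (verts \<Gamma>)"
  then have *: "C (relabel \<sigma> \<Gamma>) = relabel_vec \<sigma> ` C \<Gamma>" if "C \<in> F" for C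
    using F[OF that] g by (simp add: subcollection_def)
  have "\<Union>{C (relabel \<sigma> \<Gamma>) | C. C \<in> F} = relabel_vec \<sigma> ` \<Union>{C \<Gamma> | C. C \<in> F}"
    using * by blast
  then show "free.span (\<Union>{C (relabel \<sigma> \<Gamma>) | C. C \<in> F}) =
      relabel_vec \<sigma> ` free.span (\<Union>{C \<Gamma> | C. C \<in> F})"
    by (simp only: relabel_vec_def span_image_lin_ext)
qed

lemma decomp_span_Union:
  assumes "\<And>C. C \<in> F \<Longrightarrow> lin_ext (decomp G) ` C \<Gamma> \<subseteq> tensor_space (C \<Gamma>') (P C)"
    and "\<And>C. C \<in> F \<Longrightarrow> P C \<subseteq> Q"
  shows "lin_ext (decomp G) ` free.span (\<Union>{C \<Gamma> | C. C \<in> F}) \<subseteq>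
    tensor_space (free.span (\<Union>{C \<Gamma>' | C. C \<in> F})) Q"
proof -
  have "lin_ext (decomp G) ` C \<Gamma> \<subseteq> tensor_space (free.span (\<Union>{C \<Gamma>' | C. C \<in> F})) Q"
    if "C \<in> F" for C
  proof -
    have "C \<Gamma>' \<subseteq> free.span (\<Union>{C \<Gamma>' | C. C \<in> F})"
      by (rule order_trans[OF _ free.span_superset]) (use that in blast)
    then show ?thesis
      using tensor_space_mono[OF _ assms(2)[OF that]] assms(1)[OF that] by (rule_tac order_trans)
  qed
  then have "lin_ext (decomp G) ` \<Union>{C \<Gamma> | C. C \<in> F} \<subseteq>
      tensor_space (free.span (\<Union>{C \<Gamma>' | C. C \<in> F})) Q"
    by blast
  then have "free.span (lin_ext (decomp G) ` \<Union>{C \<Gamma> | C. C \<in> F}) \<subseteq>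
      tensor_space (free.span (\<Union>{C \<Gamma>' | C. C \<in> F})) Q"
    by (rule free.span_minimal) (simp add: tensor_space_def)
  then show ?thesis by (simp add: span_image_lin_ext)
qed

lemma satisfies_relations_span_Union:
  assumes "\<And>C. C \<in> F \<Longrightarrow> satisfies_relations R m C" "\<And>\<Gamma>. free.subspace (R \<Gamma>)"
  shows "satisfies_relations R m (\<lambda>\<Gamma>. free.span (\<Union>{C \<Gamma> | C. C \<in> F}))"
  unfolding satisfies_relations_def
proof (intro allI impI)
  fix \<Gamma> assume "connected_graph \<Gamma>" "card (verts \<Gamma>) = m"
  with assms show "free.span (\<Union>{C \<Gamma> | C. C \<in> F}) \<subseteq> R \<Gamma>"
    unfolding satisfies_relations_def by (intro free.span_minimal) blast+
qed

lemma koszul_dual_is_largest: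
  fixes R :: "graph \<Rightarrow> (nat ptree \<Rightarrow>\<^sub>0 'k::field) set"
  assumes "\<And>\<Gamma>. free.subspace (R \<Gamma>)"
  shows "sub_cocontractad (koszul_dual R)" "satisfies_relations R 3 (koszul_dual R)"
    "sub_cocontractad C \<Longrightarrow> satisfies_relations R 3 C \<Longrightarrow> C \<Gamma> \<subseteq> koszul_dual R \<Gamma>"
proof -
  let ?F = "{C. sub_cocontractad C \<and> satisfies_relations R 3 C}"
  have eq: "koszul_dual R = (\<lambda>\<Gamma>. free.span (\<Union>{C \<Gamma> | C. C \<in> ?F}))"
    unfolding koszul_dual_def[abs_def] by simp
  show sub: "C \<Gamma> \<subseteq> koszul_dual R \<Gamma>" if "sub_cocontractad C" "satisfies_relations R 3 C" for C \<Gamma>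
    unfolding eq by (rule order_trans[OF _ free.span_superset]) (use that in blast)
  show "satisfies_relations R 3 (koszul_dual R)"
    unfolding eq by (rule satisfies_relations_span_Union) (use assms in simp_all)
  have "subcollection (koszul_dual R)"
    unfolding eq by (rule subcollection_span_Union) (simp add: sub_cocontractad_def)
  moreover have "lin_ext (decomp G) ` koszul_dual R \<Gamma> \<subseteq>
      tensor_space (koszul_dual R (contract_tube \<Gamma> G)) (koszul_dual R (restr \<Gamma> G))"
    if "connected_graph \<Gamma>" "tube \<Gamma> G" for \<Gamma> G
    unfolding eq
  proof (rule decomp_span_Union[where P = "\<lambda>C. C (restr \<Gamma> G)"])
    fix C assume C: "C \<in> ?F"
    then show "lin_ext (decomp G) ` C \<Gamma> \<subseteq> tensor_space (C (contract_tube \<Gamma> G)) (C (restr \<Gamma> G))"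
      using that by (simp add: sub_cocontractad_def)
    show "C (restr \<Gamma> G) \<subseteq> free.span (\<Union>{C (restr \<Gamma> G) | C. C \<in> ?F})"
      by (rule order_trans[OF _ free.span_superset]) (use C in blast)
  qed
  ultimately show "sub_cocontractad (koszul_dual R)"
    by (simp add: sub_cocontractad_def)
qed

lemma koszul_dual_comodule_is_largest:
  fixes H P :: "graph \<Rightarrow> (nat ptree \<Rightarrow>\<^sub>0 'k::field) set"
  assumes "\<And>\<Gamma>. free.subspace (H \<Gamma>)" and "sub_cocontractad P"
  shows "sub_comodule P (koszul_dual_comodule P H)"
    "satisfies_relations H 2 (koszul_dual_comodule P H)"
    "sub_comodule P N \<Longrightarrow> satisfies_relations H 2 N \<Longrightarrow> N \<Gamma> \<subseteq> koszul_dual_comodule P H \<Gamma>"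
proof -
  let ?F = "{N. sub_comodule P N \<and> satisfies_relations H 2 N}"
  have eq: "koszul_dual_comodule P H = (\<lambda>\<Gamma>. free.span (\<Union>{N \<Gamma> | N. N \<in> ?F}))"
    unfolding koszul_dual_comodule_def[abs_def] by simp
  show sub: "N \<Gamma> \<subseteq> koszul_dual_comodule P H \<Gamma>"
    if "sub_comodule P N" "satisfies_relations H 2 N" for N \<Gamma>
    unfolding eq by (rule order_trans[OF _ free.span_superset]) (use that in blast)
  show "satisfies_relations H 2 (koszul_dual_comodule P H)"
    unfolding eq by (rule satisfies_relations_span_Union) (use assms in simp_all)
  have "subcollection (koszul_dual_comodule P H)"
    unfolding eq by (rule subcollection_span_Union) (simp add: sub_comodule_def)
  moreover have "koszul_dual_comodule P H \<Gamma> \<subseteq> P \<Gamma>" if "connected_graph \<Gamma>" for \<Gamma>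
    unfolding eq
  proof (rule free.span_minimal)
    show "\<Union>{N \<Gamma> | N. N \<in> ?F} \<subseteq> P \<Gamma>"
      using that unfolding sub_comodule_def by blast
    show "free.subspace (P \<Gamma>)"
      using that assms(2) by (simp add: sub_cocontractad_def subcollection_def)
  qed
  moreover have "lin_ext (decomp G) ` koszul_dual_comodule P H \<Gamma> \<subseteq>
      tensor_space (koszul_dual_comodule P H (contract_tube \<Gamma> G)) (P (restr \<Gamma> G))"
    if "connected_graph \<Gamma>" "tube \<Gamma> G" for \<Gamma> G
    unfolding eq
    by (rule decomp_span_Union[where P = "\<lambda>_. P (restr \<Gamma> G)"])
      (use that in \<open>simp_all add: sub_comodule_def\<close>)
  ultimately show "sub_comodule P (koszul_dual_comodule P H)"
    by (simp add: sub_comodule_def)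
qed

definition ham_relator :: "graph \<Rightarrow> nat \<Rightarrow> nat \<Rightarrow> nat \<Rightarrow> nat ptree \<Rightarrow>\<^sub>0 'k::field"
  where "ham_relator \<Gamma> u v w =
    (let left = basis_vec (Br (Br (Lf u) (Lf v)) (Lf w));
         right = basis_vec (Br (Lf u) (Br (Lf v) (Lf w)))
     in if (u, v) \<in> edges \<Gamma> \<and> (v, w) \<in> edges \<Gamma> then left - right
        else if (u, v) \<in> edges \<Gamma> then left
        else if (v, w) \<in> edges \<Gamma> then right
        else 0)"

definition ham_relations :: "graph \<Rightarrow> (nat ptree \<Rightarrow>\<^sub>0 'k::field) set"
  where "ham_relations \<Gamma> =
    free.span {ham_relator \<Gamma> u v w | u v w. distinct [u, v, w] \<and> verts \<Gamma> = {u, v, w}}"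

definition cycham_relations :: "graph \<Rightarrow> (nat ptree \<Rightarrow>\<^sub>0 'k::field) set"
  where "cycham_relations \<Gamma> =
    free.span {basis_vec (Br (Lf u) (Lf v)) - basis_vec (Br (Lf v) (Lf u)) | u v.
      u \<noteq> v \<and> verts \<Gamma> = {u, v}}"

definition ham_dual :: "graph \<Rightarrow> (nat ptree \<Rightarrow>\<^sub>0 'k::field) set"
  where "ham_dual = koszul_dual ham_relations"

definition cycham_dual :: "graph \<Rightarrow> (nat ptree \<Rightarrow>\<^sub>0 'k::field) set"
  where "cycham_dual = koszul_dual_comodule ham_dual cycham_relations"


section \<open>The Koszul complex\<close>

text \<open>A basis element \<open>(I, t, p)\<close> stands for \<open>t \<otimes> (\<Otimes>G\<in>I. p G)\<close> with \<open>t\<close> a tree on \<open>\<Gamma>/I\<close> and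
  \<open>p G\<close> a Hamiltonian path of \<open>\<Gamma>|G\<close>. As \<open>Ham\<close> sits in degree 0, the degree is that of \<open>t\<close>.\<close>

type_synonym koszul_basis = "nat set set \<times> nat ptree \<times> (nat set \<Rightarrow> nat list)"

definition koszul_complex ::
    "(graph \<Rightarrow> (nat ptree \<Rightarrow>\<^sub>0 'k::field) set) \<Rightarrow> graph \<Rightarrow> nat \<Rightarrow> (koszul_basis \<Rightarrow>\<^sub>0 'k) set"
  where "koszul_complex M \<Gamma> n = free.span {lin_ext (\<lambda>t. basis_vec (I, t, p)) x | I x p.
    tube_partition \<Gamma> I \<and> card I = Suc n \<and> x \<in> M (contract \<Gamma> I) \<and>
    p \<in> (\<Pi>\<^sub>E G\<in>I. ham_paths (restr \<Gamma> G))}"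

definition blocks_in :: "nat set set \<Rightarrow> nat set \<Rightarrow> nat set set"
  where "blocks_in I G = {A \<in> I. Min A \<in> G}"

definition merge_blocks :: "nat set set \<Rightarrow> nat set \<Rightarrow> nat set set"
  where "merge_blocks I G = insert (\<Union>(blocks_in I G)) (I - blocks_in I G)"

text \<open>The summand of the differential for a two-vertex tube \<open>G\<close> of \<open>\<Gamma>/I\<close>: decompose \<open>t\<close>
  into \<open>t' \<otimes> s\<close> with \<open>s \<in> sE\<close>, apply \<open>id \<otimes> s\<^sup>-\<^sup>1\<close> (Koszul sign \<open>(-1)^(degree of t')\<close>), and
  compose the resulting path \<open>leaf_list s\<close> of \<open>(\<Gamma>/I)|G\<close> with the paths on the two blocks.\<close>

definition koszul_diff_basis :: "graph \<Rightarrow> koszul_basis \<Rightarrow> koszul_basis \<Rightarrow>\<^sub>0 'k::field"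
  where "koszul_diff_basis \<Gamma> = (\<lambda>(I, t, p).
    \<Sum>G | tube (contract \<Gamma> I) G \<and> card G = 2.
      let B = blocks_in I G; U = \<Union>B; J = merge_blocks I G
      in lin_ext (\<lambda>(t', s). smul ((-1) ^ inner t')
           (lin_ext (\<lambda>w. basis_vec (J, t', restrict (p(U := w)) J))
             (ham_comp (restr \<Gamma> U) B (leaf_list s) p)))
         (decomp G t))"

definition koszul_diff :: "graph \<Rightarrow> (koszul_basis \<Rightarrow>\<^sub>0 'k::field) \<Rightarrow> (koszul_basis \<Rightarrow>\<^sub>0 'k)"
  where "koszul_diff \<Gamma> = lin_ext (koszul_diff_basis \<Gamma>)"

text \<open>The map to \<open>CycHam\<close> induced by the projection onto \<open>V\<close> (which kills all trees but the
  one-leaf tree \<open>a\<close>) and \<open>a \<mapsto> [1]\<close>.\<close>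

definition koszul_aug :: "graph \<Rightarrow> (koszul_basis \<Rightarrow>\<^sub>0 'k::field) \<Rightarrow> (nat list set \<Rightarrow>\<^sub>0 'k)"
  where "koszul_aug \<Gamma> = lin_ext (\<lambda>(I, t, p).
    case t of Lf v \<Rightarrow> cycham_act \<Gamma> I (rotations [v]) p | Br l r \<Rightarrow> 0)"

definition cycham_complex :: "graph \<Rightarrow> nat \<Rightarrow> (nat list set \<Rightarrow>\<^sub>0 'k::field) set"
  where "cycham_complex \<Gamma> n = (if n = 0 then cycham \<Gamma> else {0})"

end

theory Submission
  imports Defs
begin

text \<open>
  The component of the dual comodule on \<open>\<Gamma>\<close> has a basis indexed by the cyclic orders of the vertices
  that carry at least one admissible tree: any two trees with the same cyclic order are linked by
  flips of \<open>((u v) w)\<close> and \<open>(u (v w))\<close> and by exchanging the two branches of the root, and the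
  relations determine the ratio of their coefficients, which is a sign. Hence the Koszul complex is spanned by
  cyclic sequences of paths, i.e. by cyclic orders of the vertices of \<open>\<Gamma>\<close> with a set of cuts that
  contains all the gaps between non-adjacent neighbours, and the differential removes cuts with
  alternating signs. For each cyclic order choose a gap between adjacent neighbours. Adding or removing
  the cut at this gap pairs off all the cells except those with this cut only; these survive
  exactly when the whole cyclic order is a Hamiltonian cycle, and then they map to the basis of
  \<open>CycHam\<close>.
\<close>

section \<open>Linear algebra\<close>

text \<open>The Koszul sign of a cut depends on the shape of the tree. Once coefficients are
  normalised by \<open>tree_sign\<close> and \<open>rotation_sign\<close>, every formula sees only
  words, and the complex becomes a cyclic version of the bar complex. The obstacle is admissibility:
  it is not clear that two trees with the same cyclic order can be linked through admissible trees
  only. \<open>cherry_move\<close> settles this by induction on the number of vertices, contracting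
  a cherry. The same lemma shows that merging two neighbouring words across an edge neither creates
  nor destroys the existence of a tree; otherwise the pairing would leave unmatched cells. Of the
  dual of \<open>Ham\<close> two facts carry the argument: it contains the signed sums of trees over
  a linear order, and on three vertices it consists of relations. The first makes the cyclic sums a
  comodule over it, the second bounds the dual comodule from above.\<close>

lemma smul_single [simp]: "smul c (Poly_Mapping.single b d) = Poly_Mapping.single b (c * d)"
  by (rule poly_mapping_eqI) (simp add: lookup_single when_def)

lemma lin_ext_superset:
  "finite S \<Longrightarrow> Poly_Mapping.keys x \<subseteq> S \<Longrightarrow>
    lin_ext f x = (\<Sum>b\<in>S. smul (Poly_Mapping.lookup x b) (f b))"
  unfolding lin_ext_def by (intro sum.mono_neutral_left) (auto simp: in_keys_iff)

lemma lin_ext_single [simp]: "lin_ext f (Poly_Mapping.single b c) = smul c (f b)"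
  by (subst lin_ext_superset[of "{b}"]) auto

interpretation lin_ext: Vector_Spaces.linear smul smul "lin_ext f"
  by (rule linear_lin_ext)

lemma lookup_sum_poly: "Poly_Mapping.lookup (\<Sum>i\<in>S. f i) b = (\<Sum>i\<in>S. Poly_Mapping.lookup (f i) b)"
  by (induction S rule: infinite_finite_induct) (simp_all add: lookup_add)

lemma lookup_lin_ext:
  "Poly_Mapping.lookup (lin_ext f x) c =
    (\<Sum>b\<in>Poly_Mapping.keys x. Poly_Mapping.lookup x b * Poly_Mapping.lookup (f b) c)"
  by (simp add: lin_ext_def lookup_sum_poly)

lemma sum_lookup_delta [simp]:
  fixes x :: "'b \<Rightarrow>\<^sub>0 'k::field"
  shows "(\<Sum>b\<in>Poly_Mapping.keys x. Poly_Mapping.lookup x b * (if b = a then c else 0)) =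
      Poly_Mapping.lookup x a * c"
    "(\<Sum>b\<in>Poly_Mapping.keys x. Poly_Mapping.lookup x b * (if a = b then c else 0)) =
      Poly_Mapping.lookup x a * c"
  by (simp_all add: if_distrib[where f = "(*) _"] in_keys_iff cong: if_cong)

lemma lin_ext_cong: "(\<And>b. b \<in> Poly_Mapping.keys x \<Longrightarrow> f b = g b) \<Longrightarrow> lin_ext f x = lin_ext g x"
  unfolding lin_ext_def by (rule sum.cong) auto

lemma lin_ext_compose:
  assumes "Vector_Spaces.linear smul smul h"
  shows "h (lin_ext f x) = lin_ext (\<lambda>b. h (f b)) x"
proof -
  interpret h: Vector_Spaces.linear smul smul h by fact
  show ?thesis by (simp add: lin_ext_def h.sum h.scale)
qed

lemma lin_ext_lin_ext: "lin_ext g (lin_ext f x) = lin_ext (\<lambda>b. lin_ext g (f b)) x"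
  by (rule lin_ext_compose) (rule linear_lin_ext)

lemma lin_ext_sum_fun: "lin_ext (\<lambda>b. \<Sum>i\<in>S. f i b) x = (\<Sum>i\<in>S. lin_ext (f i) x)"
  unfolding lin_ext_def by (subst sum.swap) (simp add: free.scale_sum_right)

lemma lin_ext_smul_fun: "lin_ext (\<lambda>b. smul c (f b)) x = smul c (lin_ext f x)"
  unfolding lin_ext_def by (simp add: free.scale_sum_right mult.commute)

lemma lin_ext_zero_fun [simp]: "lin_ext (\<lambda>b. 0) x = 0"
  by (simp add: lin_ext_def)

lemma lin_ext_basis_vec [simp]: "lin_ext basis_vec x = x"
  by (rule poly_mapping_eqI)
    (simp add: lookup_lin_ext lookup_single when_def in_keys_iff)

lemma lookup_lin_ext_basis_vec:
  assumes "inj f"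
  shows "Poly_Mapping.lookup (lin_ext (\<lambda>b. basis_vec (f b)) x) (f c) = Poly_Mapping.lookup x c"
  using assms by (simp add: lookup_lin_ext lookup_single when_def inj_eq in_keys_iff)

lemma span_basis_vec:
  "x \<in> free.span (basis_vec ` A) \<longleftrightarrow> Poly_Mapping.keys x \<subseteq> A"
proof
  show "Poly_Mapping.keys x \<subseteq> A" if "x \<in> free.span (basis_vec ` A)"
  proof -
    have sub: "free.subspace {x :: 'a \<Rightarrow>\<^sub>0 'b. Poly_Mapping.keys x \<subseteq> A}"
      unfolding free.subspace_def
      by (auto simp: in_keys_iff lookup_add subset_iff) (metis add_0)
    have "free.span (basis_vec ` A) \<subseteq> {x :: 'a \<Rightarrow>\<^sub>0 'b. Poly_Mapping.keys x \<subseteq> A}"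
      by (rule free.span_minimal[OF _ sub]) auto
    then show ?thesis using that by auto
  qed
next
  assume "Poly_Mapping.keys x \<subseteq> A"
  then have "lin_ext basis_vec x \<in> free.span (basis_vec ` A)"
    unfolding lin_ext_def
    by (intro free.span_sum free.span_scale free.span_base) auto
  then show "x \<in> free.span (basis_vec ` A)" by simp
qed

lemma span_image_eq_lin_ext:
  "free.span (f ` A) = {lin_ext f x | x. Poly_Mapping.keys x \<subseteq> A}"
proof -
  have "free.span (f ` A) = free.span (lin_ext f ` basis_vec ` A)"
    by (simp add: image_image)
  also have "\<dots> = lin_ext f ` free.span (basis_vec ` A)"
    by (simp add: span_image_lin_ext)
  also have "\<dots> = {lin_ext f x | x. Poly_Mapping.keys x \<subseteq> A}"
    by (auto simp: span_basis_vec simp del: image_eqI)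
  finally show ?thesis .
qed

section \<open>Tensor products and their slices\<close>

lemma lookup_tensor [simp]:
  "Poly_Mapping.lookup (tensor x y) (a, b) = Poly_Mapping.lookup x a * Poly_Mapping.lookup y b"
proof -
  have "Poly_Mapping.lookup (lin_ext (\<lambda>c. basis_vec (a', c)) y) (a, b) =
      (if a' = a then Poly_Mapping.lookup y b else 0)" for a'
    by (simp add: lookup_lin_ext lookup_single when_def in_keys_iff)
  then show ?thesis
    by (simp add: tensor_def lookup_lin_ext[where x = x] in_keys_iff)
qed

lemma poly_pair_eqI:
  "(\<And>a b. Poly_Mapping.lookup x (a, b) = Poly_Mapping.lookup y (a, b)) \<Longrightarrow> x = y"
  by (rule poly_mapping_eqI) auto

lemma tensor_in_tensor_space: "x \<in> X \<Longrightarrow> y \<in> Y \<Longrightarrow> tensor x y \<in> tensor_space X Y"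
  unfolding tensor_space_def by (rule free.span_base) blast

lemma subspace_tensor_space: "free.subspace (tensor_space X Y)"
  by (simp add: tensor_space_def)

text \<open>Fixing one component of a cut turns membership in a tensor space into membership in the
  other factor (\<open>slice_fst_tensor_space\<close>). This is how closure of the dual comodule
  under \<open>decomp\<close> becomes a statement about coefficients.\<close>

definition slice_fst :: "'c \<Rightarrow> ('b \<times> 'c \<Rightarrow>\<^sub>0 'k::field) \<Rightarrow> ('b \<Rightarrow>\<^sub>0 'k)"
  where "slice_fst c = lin_ext (\<lambda>(a, c'). if c' = c then basis_vec a else 0)"

definition slice_snd :: "'b \<Rightarrow> ('b \<times> 'c \<Rightarrow>\<^sub>0 'k::field) \<Rightarrow> ('c \<Rightarrow>\<^sub>0 'k)"
  where "slice_snd a = lin_ext (\<lambda>(a', c). if a' = a then basis_vec c else 0)"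

lemma lookup_slice_fst [simp]:
  "Poly_Mapping.lookup (slice_fst c u) a = Poly_Mapping.lookup u (a, c)"
proof -
  have "Poly_Mapping.lookup (slice_fst c u) a =
      (\<Sum>b\<in>Poly_Mapping.keys u. if b = (a, c) then Poly_Mapping.lookup u b else 0)"
    unfolding slice_fst_def lookup_lin_ext
    by (rule sum.cong) (auto simp: lookup_single when_def split: if_splits)
  then show ?thesis by (simp add: in_keys_iff)
qed

lemma lookup_slice_snd [simp]:
  "Poly_Mapping.lookup (slice_snd a u) c = Poly_Mapping.lookup u (a, c)"
proof -
  have "Poly_Mapping.lookup (slice_snd a u) c =
      (\<Sum>b\<in>Poly_Mapping.keys u. if b = (a, c) then Poly_Mapping.lookup u b else 0)"
    unfolding slice_snd_def lookup_lin_ext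
    by (rule sum.cong) (auto simp: lookup_single when_def split: if_splits)
  then show ?thesis by (simp add: in_keys_iff)
qed

lemma slice_fst_tensor_space:
  assumes "free.subspace X" "u \<in> tensor_space X Y"
  shows "slice_fst c u \<in> X"
proof -
  have "slice_fst c (tensor x y) \<in> X" if "x \<in> X" for x y
  proof -
    have "slice_fst c (tensor x y) = smul (Poly_Mapping.lookup y c) x"
      by (rule poly_mapping_eqI) (simp add: mult.commute)
    then show ?thesis using assms(1) that by (simp add: free.subspace_scale)
  qed
  then have "slice_fst c ` {tensor x y | x y. x \<in> X \<and> y \<in> Y} \<subseteq> X" by blast
  then have "slice_fst c ` free.span {tensor x y | x y. x \<in> X \<and> y \<in> Y} \<subseteq> X"
    unfolding slice_fst_def span_image_lin_ext using assms(1) by (rule free.span_minimal)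
  then show ?thesis using assms(2) unfolding tensor_space_def by blast
qed

lemma slice_snd_tensor_space:
  assumes "free.subspace Y" "u \<in> tensor_space X Y"
  shows "slice_snd a u \<in> Y"
proof -
  have "slice_snd a (tensor x y) \<in> Y" if "y \<in> Y" for x y
  proof -
    have "slice_snd a (tensor x y) = smul (Poly_Mapping.lookup x a) y"
      by (rule poly_mapping_eqI) simp
    then show ?thesis using assms(1) that by (simp add: free.subspace_scale)
  qed
  then have "slice_snd a ` {tensor x y | x y. x \<in> X \<and> y \<in> Y} \<subseteq> Y" by blast
  then have "slice_snd a ` free.span {tensor x y | x y. x \<in> X \<and> y \<in> Y} \<subseteq> Y"
    unfolding slice_snd_def span_image_lin_ext using assms(1) by (rule free.span_minimal)
  then show ?thesis using assms(2) unfolding tensor_space_def by blast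
qed

section \<open>Tubes and contractions\<close>

text \<open>The set reachable from u inside G has no edge leaving it within G, so it violates the
  cut condition unless it is all of G. Cuts, unlike paths, are easily moved along relabellings and
  contractions.\<close>

lemma tube_iff_cut:
  assumes "sym (edges \<Gamma>)"
  shows "tube \<Gamma> G \<longleftrightarrow> G \<noteq> {} \<and> G \<subseteq> verts \<Gamma> \<and>
    (\<forall>Y. Y \<noteq> {} \<longrightarrow> Y \<subset> G \<longrightarrow> (\<exists>u\<in>Y. \<exists>v\<in>G - Y. (u, v) \<in> edges \<Gamma>))"
    (is "_ \<longleftrightarrow> _ \<and> _ \<and> ?cut")
proof -
  let ?E = "edges \<Gamma> \<inter> G \<times> G"
  have "(\<forall>u\<in>G. \<forall>v\<in>G. (u, v) \<in> ?E\<^sup>*) \<longleftrightarrow> ?cut"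
  proof (intro iffI allI impI ballI)
    fix Y assume conn: "\<forall>u\<in>G. \<forall>v\<in>G. (u, v) \<in> ?E\<^sup>*" and Y: "Y \<noteq> {}" "Y \<subset> G"
    then obtain u v where uv: "u \<in> Y" "v \<in> G" "v \<notin> Y" by blast
    have "(u, v) \<in> ?E\<^sup>*" using conn uv Y by blast
    then have "v \<in> Y \<or> (\<exists>u\<in>Y. \<exists>v\<in>G - Y. (u, v) \<in> edges \<Gamma>)"
    proof (induction rule: rtrancl_induct)
      case base then show ?case using uv by simp
    next
      case (step y z) then show ?case by blast
    qed
    then show "\<exists>u\<in>Y. \<exists>v\<in>G - Y. (u, v) \<in> edges \<Gamma>" using uv by blast
  next
    fix u v assume cut: ?cut and uv: "u \<in> G" "v \<in> G"
    define Y where "Y = {x \<in> G. (u, x) \<in> ?E\<^sup>*}"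
    show "(u, v) \<in> ?E\<^sup>*"
    proof (rule ccontr)
      assume "(u, v) \<notin> ?E\<^sup>*"
      then have "Y \<noteq> {}" "Y \<subset> G" using uv by (auto simp: Y_def)
      then obtain x y where "x \<in> Y" "y \<in> G - Y" "(x, y) \<in> edges \<Gamma>" using cut by blast
      then have "(u, y) \<in> ?E\<^sup>*" by (auto simp: Y_def intro: rtrancl.rtrancl_into_rtrancl)
      then show False using \<open>y \<in> G - Y\<close> by (auto simp: Y_def)
    qed
  qed
  then show ?thesis unfolding tube_def by blast
qed

lemma tubeI_cut:
  assumes "sym (edges \<Gamma>)" "G \<noteq> {}" "G \<subseteq> verts \<Gamma>"
    and "\<And>Y. Y \<noteq> {} \<Longrightarrow> Y \<subset> G \<Longrightarrow> \<exists>u\<in>Y. \<exists>v\<in>G - Y. (u, v) \<in> edges \<Gamma>"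
  shows "tube \<Gamma> G"
  using assms by (simp add: tube_iff_cut)

lemma tube_cutD:
  assumes "sym (edges \<Gamma>)" "tube \<Gamma> G" "Y \<noteq> {}" "Y \<subset> G"
  obtains u v where "u \<in> Y" "v \<in> G - Y" "(u, v) \<in> edges \<Gamma>"
  using assms unfolding tube_iff_cut[OF assms(1)] by metis

lemma tube_subset: "tube \<Gamma> G \<Longrightarrow> G \<subseteq> verts \<Gamma>"
  and tube_nonempty: "tube \<Gamma> G \<Longrightarrow> G \<noteq> {}"
  by (auto simp: tube_def)

lemma tube_singleton: "v \<in> verts \<Gamma> \<Longrightarrow> tube \<Gamma> {v}"
  by (auto simp: tube_def)

lemma tube_pair_iff:
  assumes "simple_graph \<Gamma>" "u \<noteq> v"
  shows "tube \<Gamma> {u, v} \<longleftrightarrow> (u, v) \<in> edges \<Gamma>"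
proof
  have sym: "sym (edges \<Gamma>)" using assms by (simp add: simple_graph_def)
  show "(u, v) \<in> edges \<Gamma>" if "tube \<Gamma> {u, v}"
    by (rule tube_cutD[OF sym that, of "{u}"]) (use assms in auto)
  assume e: "(u, v) \<in> edges \<Gamma>"
  then have "(v, u) \<in> edges \<Gamma>" using sym by (auto dest: symD)
  have Y: "Y = {u} \<or> Y = {v}" if "Y \<noteq> {}" "Y \<subset> {u, v}" for Y
    using that by auto
  show "tube \<Gamma> {u, v}"
  proof (rule tubeI_cut[OF sym])
    show "{u, v} \<subseteq> verts \<Gamma>" using e assms(1) by (auto simp: simple_graph_def)
    fix Y assume "Y \<noteq> {}" "Y \<subset> {u, v}"
    then show "\<exists>x\<in>Y. \<exists>y\<in>{u, v} - Y. (x, y) \<in> edges \<Gamma>"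
      using Y[of Y] e \<open>(v, u) \<in> edges \<Gamma>\<close> assms(2) by auto
  qed simp
qed

lemma simple_graph_restr:
  assumes "simple_graph \<Gamma>" "G \<subseteq> verts \<Gamma>"
  shows "simple_graph (restr \<Gamma> G)"
  using assms unfolding simple_graph_def restr_def
  by (auto simp: finite_subset sym_def irrefl_def)

lemma tube_restr_iff:
  assumes "simple_graph \<Gamma>" "G \<subseteq> verts \<Gamma>"
  shows "tube (restr \<Gamma> G) X \<longleftrightarrow> X \<subseteq> G \<and> tube \<Gamma> X"
proof -
  have "edges \<Gamma> \<inter> G \<times> G \<inter> X \<times> X = edges \<Gamma> \<inter> X \<times> X" if "X \<subseteq> G" using that by auto
  then show ?thesis using assms by (auto simp: tube_def restr_def)
qed

lemma verts_restr [simp]: "verts (restr \<Gamma> G) = G"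
  by (simp add: restr_def)

lemma connected_graph_restr:
  assumes "simple_graph \<Gamma>" "tube \<Gamma> G"
  shows "connected_graph (restr \<Gamma> G)"
  using assms by (simp add: connected_graph_def simple_graph_restr tube_subset tube_restr_iff)

lemma restr_verts [simp]: "simple_graph \<Gamma> \<Longrightarrow> restr \<Gamma> (verts \<Gamma>) = \<Gamma>"
  by (cases \<Gamma>) (auto simp: simple_graph_def restr_def)

section \<open>Relabelling of graphs\<close>

lemma relabel_simps [simp]: "verts (relabel \<sigma> \<Gamma>) = \<sigma> ` verts \<Gamma>"
  "edges (relabel \<sigma> \<Gamma>) = map_prod \<sigma> \<sigma> ` edges \<Gamma>"
  by (simp_all add: relabel_def)

lemma simple_graph_relabel:
  assumes "simple_graph \<Gamma>" "inj_on \<sigma> (verts \<Gamma>)"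
  shows "simple_graph (relabel \<sigma> \<Gamma>)"
  using assms unfolding simple_graph_def
  by (fastforce simp: sym_def irrefl_def inj_on_def)

lemma edges_relabel_iff:
  assumes "simple_graph \<Gamma>" "inj_on \<sigma> (verts \<Gamma>)" "u \<in> verts \<Gamma>" "v \<in> verts \<Gamma>"
  shows "(\<sigma> u, \<sigma> v) \<in> edges (relabel \<sigma> \<Gamma>) \<longleftrightarrow> (u, v) \<in> edges \<Gamma>"
proof
  assume "(\<sigma> u, \<sigma> v) \<in> edges (relabel \<sigma> \<Gamma>)"
  then obtain a b where "(a, b) \<in> edges \<Gamma>" "\<sigma> a = \<sigma> u" "\<sigma> b = \<sigma> v" by auto
  moreover from this have "a \<in> verts \<Gamma>" "b \<in> verts \<Gamma>" using assms by (auto simp: simple_graph_def)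
  ultimately show "(u, v) \<in> edges \<Gamma>" using assms by (auto dest: inj_onD)
qed auto

lemma tube_relabel_iff:
  assumes "simple_graph \<Gamma>" "inj_on \<sigma> (verts \<Gamma>)" "X \<subseteq> verts \<Gamma>"
  shows "tube (relabel \<sigma> \<Gamma>) (\<sigma> ` X) \<longleftrightarrow> tube \<Gamma> X"
proof -
  have sym: "sym (edges \<Gamma>)" "sym (edges (relabel \<sigma> \<Gamma>))"
    using assms simple_graph_relabel by (auto simp: simple_graph_def)
  have inj: "inj_on \<sigma> X" using assms by (meson inj_on_subset)
  have "(\<forall>Z. Z \<noteq> {} \<longrightarrow> Z \<subset> \<sigma> ` X \<longrightarrow>
        (\<exists>u\<in>Z. \<exists>v\<in>\<sigma> ` X - Z. (u, v) \<in> edges (relabel \<sigma> \<Gamma>))) \<longleftrightarrow>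
      (\<forall>Y. Y \<noteq> {} \<longrightarrow> Y \<subset> X \<longrightarrow> (\<exists>u\<in>Y. \<exists>v\<in>X - Y. (u, v) \<in> edges \<Gamma>))" (is "?A \<longleftrightarrow> ?B")
  proof (intro iffI allI impI)
    fix Y assume A: ?A and Y: "Y \<noteq> {}" "Y \<subset> X"
    have "\<sigma> ` Y \<subset> \<sigma> ` X" using Y inj by (metis image_strict_mono)
    then obtain u v where uv: "u \<in> \<sigma> ` Y" "v \<in> \<sigma> ` X - \<sigma> ` Y" "(u, v) \<in> edges (relabel \<sigma> \<Gamma>)"
      using A Y by (metis image_is_empty)
    then obtain a b where ab: "a \<in> Y" "b \<in> X - Y" "u = \<sigma> a" "v = \<sigma> b" by auto
    then have "(a, b) \<in> edges \<Gamma>"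
      using edges_relabel_iff[OF assms(1,2), of a b] uv(3) assms(3) Y by blast
    then show "\<exists>u\<in>Y. \<exists>v\<in>X - Y. (u, v) \<in> edges \<Gamma>" using ab by blast
  next
    fix Z assume B: ?B and Z: "Z \<noteq> {}" "Z \<subset> \<sigma> ` X"
    define Y where "Y = {x\<in>X. \<sigma> x \<in> Z}"
    have ZY: "Z = \<sigma> ` Y" using Z by (auto simp: Y_def)
    have "Y \<noteq> {}" using Z(1) ZY by blast
    moreover have "Y \<subset> X"
    proof -
      have "Y \<subseteq> X" by (auto simp: Y_def)
      moreover have "Y \<noteq> X" using Z(2) ZY by blast
      ultimately show ?thesis by blast
    qed
    ultimately obtain u v where uv: "u \<in> Y" "v \<in> X - Y" "(u, v) \<in> edges \<Gamma>"
      using B by blast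
    then have "\<sigma> u \<in> Z" "\<sigma> v \<in> \<sigma> ` X - Z" "(\<sigma> u, \<sigma> v) \<in> edges (relabel \<sigma> \<Gamma>)"
      by (auto simp: Y_def)
    then show "\<exists>u\<in>Z. \<exists>v\<in>\<sigma> ` X - Z. (u, v) \<in> edges (relabel \<sigma> \<Gamma>)" by blast
  qed
  then show ?thesis unfolding tube_iff_cut[OF sym(1)] tube_iff_cut[OF sym(2)]
    using assms by auto
qed

section \<open>Contraction along a partition into tubes\<close>

locale graph_partition =
  fixes \<Gamma> :: graph and I :: "nat set set"
  assumes simple: "simple_graph \<Gamma>" and tube_part: "tube_partition \<Gamma> I"
begin

lemma partition: "partition_on (verts \<Gamma>) I"
  using tube_part by (simp add: tube_partition_def)

lemma block_tube: "A \<in> I \<Longrightarrow> tube \<Gamma> A"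
  using tube_part by (simp add: tube_partition_def)

lemma block_subset: "A \<in> I \<Longrightarrow> A \<subseteq> verts \<Gamma>"
  by (rule tube_subset[OF block_tube])

lemma block_nonempty: "A \<in> I \<Longrightarrow> A \<noteq> {}"
  by (rule tube_nonempty[OF block_tube])

lemma finite_verts: "finite (verts \<Gamma>)"
  using simple by (simp add: simple_graph_def)

lemma block_finite: "A \<in> I \<Longrightarrow> finite A"
  using block_subset finite_verts finite_subset by blast

lemma Min_in_block: "A \<in> I \<Longrightarrow> Min A \<in> A"
  by (simp add: block_finite block_nonempty)

lemma blocks_eq: "A \<in> I \<Longrightarrow> B \<in> I \<Longrightarrow> x \<in> A \<Longrightarrow> x \<in> B \<Longrightarrow> A = B"
  using partition unfolding partition_on_def disjoint_def by blast

lemma Min_inj: "A \<in> I \<Longrightarrow> B \<in> I \<Longrightarrow> Min A = Min B \<Longrightarrow> A = B"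
  using Min_in_block blocks_eq by metis

lemma finite_blocks: "finite I"
  using partition finite_verts by (meson finite_elements)

lemma Union_blocks: "\<Union>I = verts \<Gamma>"
  using partition by (simp add: partition_on_def)

lemma block_of_Min [simp]: "A \<in> I \<Longrightarrow> block_of I (Min A) = A"
  unfolding block_of_def by (rule the_equality) (metis Min_inj)+

lemma verts_contract [simp]: "verts (contract \<Gamma> I) = Min ` I"
  by (simp add: contract_def)

lemma edges_contract_iff:
  assumes "A \<in> I" "B \<in> I"
  shows "(Min A, Min B) \<in> edges (contract \<Gamma> I) \<longleftrightarrow>
    A \<noteq> B \<and> (\<exists>u\<in>A. \<exists>v\<in>B. (u, v) \<in> edges \<Gamma>)"
proof
  assume "(Min A, Min B) \<in> edges (contract \<Gamma> I)"
  then obtain A' B' where "A' \<in> I" "B' \<in> I" "Min A = Min A'" "Min B = Min B'" "A' \<noteq> B'"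
    "\<exists>u\<in>A'. \<exists>v\<in>B'. (u, v) \<in> edges \<Gamma>"
    by (auto simp: contract_def)
  then show "A \<noteq> B \<and> (\<exists>u\<in>A. \<exists>v\<in>B. (u, v) \<in> edges \<Gamma>)"
    using Min_inj[of A A'] Min_inj[of B B'] assms by blast
next
  assume "A \<noteq> B \<and> (\<exists>u\<in>A. \<exists>v\<in>B. (u, v) \<in> edges \<Gamma>)"
  then show "(Min A, Min B) \<in> edges (contract \<Gamma> I)"
    using assms by (auto simp: contract_def)
qed

lemma simple_contract: "simple_graph (contract \<Gamma> I)"
proof -
  have "sym (edges \<Gamma>)" using simple by (simp add: simple_graph_def)
  then have "sym (edges (contract \<Gamma> I))" unfolding sym_def contract_def by (simp; blast)
  moreover have "irrefl (edges (contract \<Gamma> I))"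
    unfolding irrefl_def contract_def using Min_inj by auto
  moreover have "edges (contract \<Gamma> I) \<subseteq> Min ` I \<times> Min ` I"
    by (auto simp: contract_def)
  ultimately show ?thesis by (simp add: simple_graph_def finite_blocks)
qed

text \<open>A proper part Y of the union either splits some block, and then connectedness of this
  block gives an edge out of Y, or it is a union of blocks, and then it is a cut of the contracted
  graph. Conversely a cut of X is blown up to the union of its blocks.\<close>

lemma tube_contract_iff:
  assumes X: "X \<subseteq> Min ` I"
  shows "tube (contract \<Gamma> I) X \<longleftrightarrow> tube \<Gamma> (\<Union>(blocks_in I X))"
proof -
  have sym: "sym (edges \<Gamma>)" "sym (edges (contract \<Gamma> I))"
    using simple simple_contract by (auto simp: simple_graph_def)
  let ?U = "\<lambda>X. \<Union>(blocks_in I X)"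
  have ne: "?U X = {} \<longleftrightarrow> X = {}" if "X \<subseteq> Min ` I" for X
    using that block_nonempty by (fastforce simp: blocks_in_def)
  have sub: "?U X \<subseteq> verts \<Gamma>" using block_subset by (auto simp: blocks_in_def)
  show ?thesis
  proof
    assume t: "tube (contract \<Gamma> I) X"
    show "tube \<Gamma> (?U X)"
    proof (rule tubeI_cut[OF sym(1) _ sub])
      show "?U X \<noteq> {}" using ne[OF X] tube_nonempty[OF t] by simp
      fix Y assume Y: "Y \<noteq> {}" "Y \<subset> ?U X"
      show "\<exists>u\<in>Y. \<exists>v\<in>?U X - Y. (u, v) \<in> edges \<Gamma>"
      proof (cases "\<exists>A\<in>blocks_in I X. A \<inter> Y \<noteq> {} \<and> \<not> A \<subseteq> Y")
        case True
        then obtain A where A: "A \<in> blocks_in I X" "A \<inter> Y \<noteq> {}" "\<not> A \<subseteq> Y" by blast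
        then have "tube \<Gamma> A" using block_tube by (auto simp: blocks_in_def)
        then obtain u v where "u \<in> A \<inter> Y" "v \<in> A - (A \<inter> Y)" "(u, v) \<in> edges \<Gamma>"
          by (rule tube_cutD[OF sym(1), of A "A \<inter> Y"]) (use A in auto)
        then show ?thesis using A(1) by blast
      next
        case False
        define Z where "Z = Min ` {A \<in> blocks_in I X. A \<subseteq> Y}"
        have "Z \<noteq> {}" using Y False by (fastforce simp: Z_def)
        moreover have "Z \<subset> X"
        proof -
          have "Z \<subseteq> X" by (auto simp: Z_def blocks_in_def)
          moreover obtain a A where "a \<in> A" "A \<in> blocks_in I X" "a \<notin> Y" using Y by auto
          then have "Min A \<in> X" "Min A \<notin> Z"
            using Min_inj by (auto simp: Z_def blocks_in_def)
          ultimately show ?thesis by blast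
        qed
        ultimately obtain p q where pq: "p \<in> Z" "q \<in> X - Z" "(p, q) \<in> edges (contract \<Gamma> I)"
          using tube_cutD[OF sym(2) t] by metis
        obtain A where A: "A \<in> I" "Min A \<in> X" "A \<subseteq> Y" "p = Min A"
          using pq by (auto simp: Z_def blocks_in_def)
        obtain B where B: "B \<in> I" "q = Min B" using pq X by auto
        then have "B \<in> blocks_in I X" using pq by (auto simp: blocks_in_def)
        moreover have "\<not> B \<subseteq> Y" using pq B \<open>B \<in> blocks_in I X\<close> by (auto simp: Z_def)
        ultimately have "B \<inter> Y = {}" using False by blast
        obtain u v where "u \<in> A" "v \<in> B" "(u, v) \<in> edges \<Gamma>"
          using pq A B edges_contract_iff by blast
        then show ?thesis using \<open>B \<inter> Y = {}\<close> A \<open>B \<in> blocks_in I X\<close> by blast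
      qed
    qed
  next
    assume t: "tube \<Gamma> (?U X)"
    show "tube (contract \<Gamma> I) X"
    proof (rule tubeI_cut[OF sym(2)])
      show "X \<noteq> {}" using ne[OF X] tube_nonempty[OF t] by simp
      show "X \<subseteq> verts (contract \<Gamma> I)" using X by simp
      fix Z assume Z: "Z \<noteq> {}" "Z \<subset> X"
      have "?U Z \<noteq> {}" using ne[of Z] Z X by auto
      moreover have "?U Z \<subset> ?U X"
      proof -
        have "?U Z \<subseteq> ?U X" using Z by (auto simp: blocks_in_def)
        moreover obtain A where "A \<in> I" "Min A \<in> X - Z" using Z X by blast
        then have "Min A \<in> ?U X" "Min A \<notin> ?U Z"
          using Min_in_block[of A] blocks_eq[of A] by (auto simp: blocks_in_def)
        ultimately show ?thesis by blast
      qed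
      ultimately obtain u v where uv: "u \<in> ?U Z" "v \<in> ?U X - ?U Z" "(u, v) \<in> edges \<Gamma>"
        using tube_cutD[OF sym(1) t] by metis
      then obtain A B where AB: "A \<in> I" "Min A \<in> Z" "u \<in> A" "B \<in> I" "Min B \<in> X - Z" "v \<in> B"
        by (auto simp: blocks_in_def)
      then have "(Min A, Min B) \<in> edges (contract \<Gamma> I)"
        using edges_contract_iff[of A B] uv by blast
      then show "\<exists>u\<in>Z. \<exists>v\<in>X - Z. (u, v) \<in> edges (contract \<Gamma> I)" using AB by blast
    qed
  qed
qed

lemma connected_contract:
  assumes "connected_graph \<Gamma>"
  shows "connected_graph (contract \<Gamma> I)"
proof -
  have "blocks_in I (Min ` I) = I" by (auto simp: blocks_in_def)
  then show ?thesis
    using assms simple_contract tube_contract_iff[of "Min ` I"]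
    by (simp add: connected_graph_def Union_blocks)
qed

end

section \<open>Contraction of a single tube\<close>

definition tube_blocks :: "graph \<Rightarrow> nat set \<Rightarrow> nat set set"
  where "tube_blocks \<Gamma> G = insert G ((\<lambda>v. {v}) ` (verts \<Gamma> - G))"

lemma contract_tube_eq: "contract_tube \<Gamma> G = contract \<Gamma> (tube_blocks \<Gamma> G)"
  by (simp add: contract_tube_def tube_blocks_def)

lemma graph_partition_tube_blocks:
  assumes "simple_graph \<Gamma>" "tube \<Gamma> G"
  shows "graph_partition \<Gamma> (tube_blocks \<Gamma> G)"
proof
  show "tube_partition \<Gamma> (tube_blocks \<Gamma> G)"
    using assms tube_singleton tube_subset[OF assms(2)] tube_nonempty[OF assms(2)]
    by (auto simp: tube_partition_def partition_on_def tube_blocks_def disjoint_def)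
qed fact

lemma verts_contract_tube:
  "verts (contract_tube \<Gamma> G) = insert (Min G) (verts \<Gamma> - G)"
  by (auto simp: contract_tube_eq contract_def tube_blocks_def image_image)

lemma tube_contract_tube_iff:
  assumes "simple_graph \<Gamma>" "tube \<Gamma> G" "X \<subseteq> insert (Min G) (verts \<Gamma> - G)"
  shows "tube (contract_tube \<Gamma> G) X \<longleftrightarrow> tube \<Gamma> (if Min G \<in> X then X \<union> G else X)"
proof -
  interpret graph_partition \<Gamma> "tube_blocks \<Gamma> G"
    by (rule graph_partition_tube_blocks) fact+
  have X: "X \<subseteq> Min ` tube_blocks \<Gamma> G" using assms(3) by (auto simp: tube_blocks_def image_image)
  have "Min G \<in> G" by (rule Min_in_block) (simp add: tube_blocks_def)
  have "blocks_in (tube_blocks \<Gamma> G) X =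
      (if Min G \<in> X then {G} else {}) \<union> (\<lambda>v. {v}) ` (X - {Min G})"
    using assms(3) \<open>Min G \<in> G\<close> by (auto simp: blocks_in_def tube_blocks_def)
  then have "\<Union>(blocks_in (tube_blocks \<Gamma> G) X) = (if Min G \<in> X then X \<union> G else X)"
    using \<open>Min G \<in> G\<close> by (cases "Min G \<in> X") auto
  then show ?thesis unfolding contract_tube_eq tube_contract_iff[OF X] by simp
qed

lemma connected_contract_tube:
  assumes "connected_graph \<Gamma>" "tube \<Gamma> G"
  shows "connected_graph (contract_tube \<Gamma> G)"
proof -
  interpret graph_partition \<Gamma> "tube_blocks \<Gamma> G"
    using assms by (intro graph_partition_tube_blocks) (simp_all add: connected_graph_def)
  show ?thesis unfolding contract_tube_eq using assms by (intro connected_contract)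
qed

lemma simple_contract_tube:
  assumes "simple_graph \<Gamma>" "tube \<Gamma> G"
  shows "simple_graph (contract_tube \<Gamma> G)"
proof -
  interpret graph_partition \<Gamma> "tube_blocks \<Gamma> G"
    using assms by (intro graph_partition_tube_blocks)
  show ?thesis unfolding contract_tube_eq by (rule simple_contract)
qed

lemma finite_tube: "simple_graph \<Gamma> \<Longrightarrow> tube \<Gamma> G \<Longrightarrow> finite G"
  by (meson finite_subset simple_graph_def tube_subset)

section \<open>Trees, grafting and decomposition\<close>

lemma set_leaf_list [simp]: "set (leaf_list t) = set_ptree t"
  by (induction t) auto

lemma leaf_list_nonempty [simp]: "leaf_list t \<noteq> []"
  by (induction t) auto

lemma set_ptree_nonempty [simp]: "set_ptree t \<noteq> {}"
  by (induction t) auto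

lemma finite_set_ptree [simp]: "finite (set_ptree t)"
  by (induction t) auto

lemma length_leaf_list: "length (leaf_list t) = Suc (inner t)"
  by (induction t) auto

lemma subtrees_self [simp]: "t \<in> subtrees t"
  by (cases t) auto

lemma subtrees_subset: "s \<in> subtrees t \<Longrightarrow> set_ptree s \<subseteq> set_ptree t"
  by (induction t) auto

lemma subtrees_trans: "s \<in> subtrees t \<Longrightarrow> u \<in> subtrees s \<Longrightarrow> u \<in> subtrees t"
  by (induction t) auto

lemma distinct_subtree: "s \<in> subtrees t \<Longrightarrow> distinct (leaf_list t) \<Longrightarrow> distinct (leaf_list s)"
  by (induction t) auto

text \<open>The root splits the leaf word at one of finitely many places into two shorter words.
  Finiteness matters because \<open>linear_sum\<close> is a sum over a set of trees, which would be
  0 by default on an infinite set.\<close>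

lemma finite_trees_leaf_list: "finite {t. leaf_list t = w}"
proof (induction "length w" arbitrary: w rule: less_induct)
  case less
  have "{t. leaf_list t = w} \<subseteq> Lf ` set w \<union>
      (\<Union>i\<in>{0<..<length w}. (\<lambda>(l, r). Br l r) `
        ({t. leaf_list t = take i w} \<times> {t. leaf_list t = drop i w}))" (is "_ \<subseteq> ?A \<union> (\<Union>i\<in>_. ?B i)")
  proof
    fix t assume "t \<in> {t. leaf_list t = w}"
    then have t: "leaf_list t = w" by simp
    show "t \<in> ?A \<union> (\<Union>i\<in>{0<..<length w}. ?B i)"
    proof (cases t)
      case (Lf v)
      then show ?thesis using t by auto
    next
      case (Br l r)
      let ?i = "length (leaf_list l)"
      have "?i \<in> {0<..<length w}" using t Br by auto
      moreover have "t \<in> ?B ?i" using t Br by auto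
      ultimately show ?thesis by blast
    qed
  qed
  moreover have "finite (?B i)" if "i \<in> {0<..<length w}" for i
    using that by (intro finite_imageI finite_cartesian_product less) auto
  ultimately show ?case by (meson finite_UN_I finite_Un finite_greaterThanLessThan finite_imageI
        finite_set finite_subset)
qed

text \<open>This sign changes under every flip of \<open>((u v) w)\<close> and \<open>(u (v w))\<close>, and it absorbs the part of the
  Koszul sign of \<open>decomp\<close> that depends on the shape of the tree: see \<open>tree_sign_graft\<close>.\<close>

fun tree_sign :: "'v ptree \<Rightarrow> 'k::field"
  where
    "tree_sign (Lf v) = 1"
  | "tree_sign (Br l r) = (-1) ^ inner l * tree_sign l * tree_sign r"

lemma tree_sign_square [simp]: "tree_sign t * tree_sign t = (1::'k::field)"
proof (induction t)
  case (Br l r)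
  have "tree_sign (Br l r) * tree_sign (Br l r) =
      ((-1) ^ inner l * (-1) ^ inner l) * (tree_sign l * tree_sign l) *
      (tree_sign r * tree_sign r :: 'k)"
    by (simp add: ac_simps)
  then show ?case using Br by (simp flip: power_add)
qed simp

lemma tree_sign_nonzero [simp]: "tree_sign t \<noteq> (0::'k::field)"
  using tree_sign_square[of t] by (metis mult_zero_left zero_neq_one)

text \<open>Inverse to cutting: among the trees with distinct leaves, \<open>decomp\<close> along G
  is nonzero exactly on the trees \<open>graft (Min G) s t\<close> with \<open>graftable s t\<close>
  and G the leaf set of s.\<close>

fun graft :: "'v \<Rightarrow> 'v ptree \<Rightarrow> 'v ptree \<Rightarrow> 'v ptree"
  where
    "graft m s (Lf u) = (if u = m then s else Lf u)"
  | "graft m s (Br l r) = Br (graft m s l) (graft m s r)"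

lemma graft_notin [simp]: "m \<notin> set_ptree t \<Longrightarrow> graft m s t = t"
  by (induction t) auto

lemma set_graft: "set_ptree (graft m s t) =
    (if m \<in> set_ptree t then set_ptree t - {m} \<union> set_ptree s else set_ptree t)"
  by (induction t) auto

lemma leaf_list_graft_concat:
  "leaf_list (graft m s t) = concat (map (\<lambda>x. if x = m then leaf_list s else [x]) (leaf_list t))"
  by (induction t) auto

lemma concat_map_other [simp]:
  "m \<notin> set p \<Longrightarrow> concat (map (\<lambda>x. if x = m then y else [x]) p) = p"
  by (induction p) auto

lemma leaf_list_graft:
  "leaf_list t = p @ m # q \<Longrightarrow> m \<notin> set p \<Longrightarrow> m \<notin> set q \<Longrightarrow>
    leaf_list (graft m s t) = p @ leaf_list s @ q"
  by (simp add: leaf_list_graft_concat)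

lemma subtrees_graft: "subtrees (graft m s t) =
    graft m s ` subtrees t \<union> (if m \<in> set_ptree t then subtrees s else {})"
  by (induction t) auto

lemma inner_graft:
  "distinct (leaf_list t) \<Longrightarrow> m \<in> set_ptree t \<Longrightarrow> inner (graft m s t) = inner t + inner s"
proof (induction t)
  case (Br l r)
  then have "m \<in> set_ptree l \<longleftrightarrow> m \<notin> set_ptree r" by auto
  then show ?case using Br by (cases "m \<in> set_ptree l") auto
qed simp

text \<open>The leaf of t that is replaced carries the name that \<open>contract_tube\<close> gives
  to the collapsed leaf set of s. As it is the only shared label, the grafted tree has distinct
  leaves.\<close>

definition graftable :: "nat ptree \<Rightarrow> nat ptree \<Rightarrow> bool"
  where "graftable s t \<longleftrightarrow> distinct (leaf_list s) \<and> distinct (leaf_list t) \<and>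
    set_ptree t \<inter> set_ptree s = {Min (set_ptree s)}"

lemma graftableD:
  assumes "graftable s t"
  shows "distinct (leaf_list s)" "distinct (leaf_list t)" "Min (set_ptree s) \<in> set_ptree t"
    "set_ptree t \<inter> set_ptree s = {Min (set_ptree s)}"
  using assms by (auto simp: graftable_def)

lemma graftable_leaf_list:
  assumes "graftable s t"
  obtains p q where "leaf_list t = p @ Min (set_ptree s) # q"
    "leaf_list (graft (Min (set_ptree s)) s t) = p @ leaf_list s @ q"
    "distinct (p @ leaf_list s @ q)"
proof -
  let ?m = "Min (set_ptree s)"
  obtain p q where pq: "leaf_list t = p @ ?m # q"
    using graftableD(3)[OF assms] by (metis set_leaf_list split_list)
  have d: "distinct (p @ ?m # q)" using graftableD(2)[OF assms] pq by simp
  have "set p \<union> set q \<subseteq> set_ptree t"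
    using arg_cong[OF pq, of set] by (simp del: append_assoc) blast
  then have "set (p @ q) \<inter> set_ptree s \<subseteq> set (p @ q) \<inter> {?m}"
    using graftableD(4)[OF assms] by auto
  then have "set (p @ q) \<inter> set_ptree s = {}"
    using d by auto
  then have "distinct (p @ leaf_list s @ q)"
    using d graftableD(1)[OF assms] by auto
  then show ?thesis using pq leaf_list_graft[OF pq, of s] d by (intro that) auto
qed

lemma collapse_disjoint: "G \<inter> set_ptree t = {} \<Longrightarrow> G \<noteq> {} \<Longrightarrow> collapse G t = t"
  by (induction t) auto

lemma collapse_self: "collapse (set_ptree t) t = Lf (Min (set_ptree t))"
  by (cases t) auto

lemma disjoint_split: "(L \<union> R) \<inter> G = {m} \<Longrightarrow> m \<notin> L \<Longrightarrow> m \<in> R \<and> L \<inter> G = {} \<and> R \<inter> G = {m}"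
  by auto

lemma sign_eqI: "(even a \<longleftrightarrow> even b) \<Longrightarrow> (-1) ^ a = (-1 :: 'k::field) ^ b"
  by (simp add: minus_one_power_iff)

lemma collapse_graft: "graftable s t \<Longrightarrow> collapse (set_ptree s) (graft (Min (set_ptree s)) s t) = t"
proof (induction t)
  case (Lf x)
  then show ?case by (auto simp: graftable_def collapse_self)
next
  case (Br l r)
  let ?m = "Min (set_ptree s)" and ?G = "set_ptree s"
  have m: "?m \<in> ?G" by (simp add: Min_in)
  from Br.prems have d: "distinct (leaf_list s)" "distinct (leaf_list l)" "distinct (leaf_list r)"
    "set_ptree l \<inter> set_ptree r = {}" "(set_ptree l \<union> set_ptree r) \<inter> ?G = {?m}"
    by (auto simp: graftable_def)
  show ?case
  proof (cases "?m \<in> set_ptree l")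
    case True
    then have "?m \<notin> set_ptree r" "set_ptree r \<inter> ?G = {}" "set_ptree l \<inter> ?G = {?m}"
      using d by auto
    moreover from this have "graftable s l" using d by (simp add: graftable_def)
    moreover have "?G \<noteq> set_ptree (graft ?m s l) \<union> set_ptree r"
      using \<open>set_ptree r \<inter> ?G = {}\<close> by (metis Un_Int_eq(2) inf_commute set_ptree_nonempty)
    ultimately show ?thesis using Br.IH(1) by (simp add: collapse_disjoint Int_commute)
  next
    case False
    then have "?m \<in> set_ptree r" "set_ptree l \<inter> ?G = {}" "set_ptree r \<inter> ?G = {?m}"
      using disjoint_split[OF d(5) False] by auto
    moreover from this have "graftable s r" using d by (simp add: graftable_def)
    moreover have "?G \<noteq> set_ptree l \<union> set_ptree (graft ?m s r)"
      using \<open>set_ptree l \<inter> ?G = {}\<close> by (metis Un_Int_eq(1) inf_commute set_ptree_nonempty)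
    ultimately show ?thesis using Br.IH(2) False by (simp add: collapse_disjoint Int_commute)
  qed
qed

text \<open>Induction along the path from the root to the grafting leaf. A step to the right changes
  nothing. A step to the left adds \<open>inner s\<close> to the exponent through
  \<open>inner l\<close> and \<open>inner s * inner r\<close> through \<open>inner_after\<close>,
  together \<open>inner s\<close> times the number of leaves of r, by which q grows. What remains of
  the Koszul sign depends on words only.\<close>

lemma tree_sign_graft:
  "graftable s t \<Longrightarrow> leaf_list t = p @ Min (set_ptree s) # q \<Longrightarrow>
    tree_sign (graft (Min (set_ptree s)) s t) *
      (-1) ^ (inner s * inner_after (set_ptree s) (graft (Min (set_ptree s)) s t)) =
    tree_sign t * tree_sign s * (-1 :: 'k::field) ^ (inner s * length q)"
proof (induction t arbitrary: p q)
  case (Lf x)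
  then have x: "x = Min (set_ptree s)" "q = []" by (auto simp: append_eq_Cons_conv Cons_eq_append_conv)
  have "inner_after (set_ptree s) s = 0" by (cases s) auto
  then show ?case by (simp add: x)
next
  case (Br l r)
  let ?m = "Min (set_ptree s)" and ?G = "set_ptree s"
  have m: "?m \<in> ?G" by (simp add: Min_in)
  from Br.prems have d: "distinct (leaf_list s)" "distinct (leaf_list l)" "distinct (leaf_list r)"
    "set_ptree l \<inter> set_ptree r = {}" "(set_ptree l \<union> set_ptree r) \<inter> ?G = {?m}"
    by (auto simp: graftable_def)
  have eq: "leaf_list l @ leaf_list r = p @ ?m # q" using Br.prems by simp
  have dd: "distinct (p @ ?m # q)" using d unfolding eq[symmetric] by simp
  show ?case
  proof (cases "?m \<in> set_ptree l")
    case True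
    then obtain p1 q1 where l: "leaf_list l = p1 @ ?m # q1"
      by (metis set_leaf_list split_list)
    have "p1 = p \<and> q = q1 @ leaf_list r"
    proof -
      have "p1 @ ?m # (q1 @ leaf_list r) = p @ ?m # q" using eq l by simp
      moreover have "?m \<notin> set p" "?m \<notin> set q" using dd by auto
      ultimately show ?thesis by (metis append_Cons_eq_iff)
    qed
    then have q: "length q = length q1 + Suc (inner r)" by (simp add: length_leaf_list)
    have mr: "?m \<notin> set_ptree r" "set_ptree r \<inter> ?G = {}" "set_ptree l \<inter> ?G = {?m}"
      using d True by auto
    then have g: "graftable s l" using d by (simp add: graftable_def)
    have ne: "?G \<noteq> set_ptree (graft ?m s l) \<union> set_ptree r"
      using mr by (metis Un_Int_eq(2) inf_commute set_ptree_nonempty)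
    have sub: "?G \<subseteq> set_ptree (graft ?m s l)" using True by (auto simp: set_graft)
    let ?a = "inner_after ?G (graft ?m s l)"
    have "tree_sign (graft ?m s (Br l r)) * (-1) ^ (inner s * inner_after ?G (graft ?m s (Br l r))) =
        (-1) ^ (inner l + inner s + inner s * inner r) * tree_sign r *
        (tree_sign (graft ?m s l) * (-1 :: 'k) ^ (inner s * ?a))"
      using mr ne sub True d by (simp add: inner_graft power_add algebra_simps)
    also have "\<dots> = (-1) ^ (inner l + inner s + inner s * inner r) * tree_sign r *
        (tree_sign l * tree_sign s * (-1 :: 'k) ^ (inner s * length q1))"
      using Br.IH(1)[OF g l] by simp
    also have "\<dots> = tree_sign (Br l r) * tree_sign s * (-1 :: 'k) ^ (inner s * length q)"
      by (simp add: q power_add algebra_simps)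
    finally show ?thesis .
  next
    case False
    then have mr: "?m \<in> set_ptree r" "set_ptree l \<inter> ?G = {}" "set_ptree r \<inter> ?G = {?m}"
      using disjoint_split[OF d(5) False] by auto
    then obtain p1 q1 where r: "leaf_list r = p1 @ ?m # q1"
      by (metis set_leaf_list split_list)
    have "q = q1"
    proof -
      have "(leaf_list l @ p1) @ ?m # q1 = p @ ?m # q" using eq r by simp
      moreover have "?m \<notin> set p" "?m \<notin> set q" using dd by auto
      ultimately show ?thesis by (metis append_Cons_eq_iff)
    qed
    have g: "graftable s r" using d mr by (simp add: graftable_def)
    have ne: "?G \<noteq> set_ptree l \<union> set_ptree (graft ?m s r)"
      using mr by (metis Un_Int_eq(1) inf_commute set_ptree_nonempty)
    have sub: "\<not> ?G \<subseteq> set_ptree l" using m False by blast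
    show ?thesis
      using Br.IH(2)[OF g r] mr ne sub False \<open>q = q1\<close> by (simp add: algebra_simps)
  qed
qed

lemma collapse_subtree:
  assumes "distinct (leaf_list t)" "s \<in> subtrees t"
  shows "graft (Min (set_ptree s)) s (collapse (set_ptree s) t) = t \<and>
    graftable s (collapse (set_ptree s) t)"
  using assms
proof (induction t)
  case (Lf v)
  then show ?case by (auto simp: graftable_def)
next
  case (Br l r)
  let ?m = "Min (set_ptree s)" and ?G = "set_ptree s"
  have m: "?m \<in> ?G" by (simp add: Min_in)
  have ds: "distinct (leaf_list s)" using Br.prems distinct_subtree by blast
  from Br.prems consider "s = Br l r" | "s \<in> subtrees l" | "s \<in> subtrees r" by auto
  then show ?case
  proof cases
    case 1
    then have "collapse ?G (Br l r) = Lf ?m" by simp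
    then show ?thesis using 1 ds m by (auto simp: graftable_def)
  next
    case 2
    then have sub: "?G \<subseteq> set_ptree l" by (rule subtrees_subset)
    then have r: "?G \<inter> set_ptree r = {}" using Br.prems by auto
    then have ne: "?G \<noteq> set_ptree l \<union> set_ptree r"
      by (metis Un_Int_eq(2) set_ptree_nonempty)
    have IH: "graft ?m s (collapse ?G l) = l" "graftable s (collapse ?G l)"
      using Br 2 by auto
    have "set_ptree (collapse ?G l) \<subseteq> set_ptree l"
    proof -
      have "set_ptree l = set_ptree (collapse ?G l) - {?m} \<union> ?G"
        using IH set_graft[of ?m s "collapse ?G l"] graftableD(3)[OF IH(2)] by simp
      then show ?thesis using m by blast
    qed
    then have "graftable s (Br (collapse ?G l) r)"
      using IH(2) Br.prems r by (auto simp: graftable_def)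
    moreover have "?m \<notin> set_ptree r" using r m by blast
    ultimately show ?thesis using IH ne by (simp add: collapse_disjoint[OF r])
  next
    case 3
    then have sub: "?G \<subseteq> set_ptree r" by (rule subtrees_subset)
    then have r: "?G \<inter> set_ptree l = {}" using Br.prems by auto
    then have ne: "?G \<noteq> set_ptree l \<union> set_ptree r"
      by (metis Un_Int_eq(1) set_ptree_nonempty)
    have IH: "graft ?m s (collapse ?G r) = r" "graftable s (collapse ?G r)"
      using Br 3 by auto
    have "set_ptree (collapse ?G r) \<subseteq> set_ptree r"
    proof -
      have "set_ptree r = set_ptree (collapse ?G r) - {?m} \<union> ?G"
        using IH set_graft[of ?m s "collapse ?G r"] graftableD(3)[OF IH(2)] by simp
      then show ?thesis using m by blast
    qed
    then have "graftable s (Br l (collapse ?G r))"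
      using IH(2) Br.prems r by (auto simp: graftable_def)
    moreover have "?m \<notin> set_ptree l" using r m by blast
    ultimately show ?thesis using IH ne by (simp add: collapse_disjoint[OF r])
  qed
qed

text \<open>The branches of a vertex have disjoint leaf sets, so a leaf set locates its subtree.
  This justifies the definite description in \<open>subtree_on\<close>.\<close>

lemma subtree_unique:
  assumes "distinct (leaf_list t)" "s \<in> subtrees t" "s' \<in> subtrees t" "set_ptree s = set_ptree s'"
  shows "s = s'"
  using assms
proof (induction t)
  case (Br l r)
  have disj: "set_ptree l \<inter> set_ptree r = {}" using Br.prems by auto
  have sub: "set_ptree u \<subseteq> set_ptree l" if "u \<in> subtrees l" for u
    using that by (rule subtrees_subset)
  have sub': "set_ptree u \<subseteq> set_ptree r" if "u \<in> subtrees r" for u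
    using that by (rule subtrees_subset)
  have ne: "u \<in> subtrees l \<Longrightarrow> set_ptree u \<noteq> set_ptree l \<union> set_ptree r"
    "u \<in> subtrees r \<Longrightarrow> set_ptree u \<noteq> set_ptree l \<union> set_ptree r"
    "u \<in> subtrees l \<Longrightarrow> u' \<in> subtrees r \<Longrightarrow> set_ptree u \<noteq> set_ptree u'" for u u'
    using sub[of u] sub'[of u] sub'[of u'] disj set_ptree_nonempty[of l] set_ptree_nonempty[of r]
      set_ptree_nonempty[of u] by blast+
  show ?case using Br ne by (auto; metis)
qed simp

lemma subtree_on_eq:
  assumes "distinct (leaf_list t)" "s \<in> subtrees t"
  shows "subtree_on (set_ptree s) t = s"
  unfolding subtree_on_def using assms by (intro the_equality) (auto intro: subtree_unique)

lemma graft_distinct: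
  assumes "graftable s t"
  shows "distinct (leaf_list (graft (Min (set_ptree s)) s t))"
  using graftable_leaf_list[OF assms] by metis

lemma decomp_graft:
  assumes "graftable s t"
  shows "decomp (set_ptree s) (graft (Min (set_ptree s)) s t) = Poly_Mapping.single (t, s)
    ((-1) ^ (inner s * inner_after (set_ptree s) (graft (Min (set_ptree s)) s t)))"
proof -
  have s: "s \<in> subtrees (graft (Min (set_ptree s)) s t)"
    using graftableD(3)[OF assms] by (simp add: subtrees_graft)
  then show ?thesis
    using subtree_on_eq[OF graft_distinct[OF assms] s] collapse_graft[OF assms]
    by (auto simp: decomp_def)
qed

lemma decomp_nonzero:
  assumes "distinct (leaf_list t)" "Poly_Mapping.lookup (decomp G t) (t', s) \<noteq> (0::'k::field)"
  shows "set_ptree s = G \<and> graftable s t' \<and> t = graft (Min G) s t'"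
proof -
  have "G \<in> set_ptree ` subtrees t" using assms(2) by (auto simp: decomp_def split: if_splits)
  then obtain s0 where s0: "s0 \<in> subtrees t" "G = set_ptree s0" by auto
  then have "subtree_on G t = s0" using assms(1) subtree_on_eq by blast
  then have "t' = collapse G t" "s = s0"
    using assms(2) s0 by (auto simp: decomp_def lookup_single when_def split: if_splits)
  then show ?thesis using collapse_subtree[OF assms(1) s0(1)] s0 by simp
qed

text \<open>Cutting along G is injective, with grafting as its inverse, so at most one tree
  contributes to each pair and the sum over the support of x collapses.\<close>

lemma lookup_decomp:
  assumes "\<forall>t\<in>Poly_Mapping.keys x. distinct (leaf_list t)"
  shows "Poly_Mapping.lookup (lin_ext (decomp G) x) (t', s) =
    (if set_ptree s = G \<and> graftable s t' then
      (-1) ^ (inner s * inner_after G (graft (Min G) s t')) *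
        Poly_Mapping.lookup x (graft (Min G) s t') else (0::'k::field))"
proof -
  let ?t = "graft (Min G) s t'" and ?P = "set_ptree s = G \<and> graftable s t'"
  have "Poly_Mapping.lookup (lin_ext (decomp G) x) (t', s) =
      (\<Sum>t\<in>Poly_Mapping.keys x. Poly_Mapping.lookup x t * (if t = ?t then
        (if ?P then (-1) ^ (inner s * inner_after G ?t) else 0) else 0))"
    unfolding lookup_lin_ext
  proof (rule sum.cong[OF refl])
    fix t assume "t \<in> Poly_Mapping.keys x"
    then have d: "distinct (leaf_list t)" using assms by blast
    have "Poly_Mapping.lookup (decomp G t) (t', s) = (if t = ?t then
        (if ?P then (-1 :: 'k) ^ (inner s * inner_after G ?t) else 0) else 0)"
    proof (cases "?P \<and> t = ?t")
      case True
      then have G: "G = set_ptree s" and g: "graftable s t'" and t: "t = ?t" by auto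
      have "decomp G t = Poly_Mapping.single (t', s) ((-1 :: 'k) ^ (inner s * inner_after G ?t))"
        unfolding t unfolding G by (rule decomp_graft[OF g])
      then show ?thesis using True by simp
    next
      case False
      then have "Poly_Mapping.lookup (decomp G t) (t', s) = (0 :: 'k)"
        using decomp_nonzero[OF d] by blast
      then show ?thesis using False by auto
    qed
    then show "Poly_Mapping.lookup x t * Poly_Mapping.lookup (decomp G t) (t', s) =
      Poly_Mapping.lookup x t * (if t = ?t then
        (if ?P then (-1) ^ (inner s * inner_after G ?t) else 0) else 0)" by simp
  qed
  then show ?thesis by simp
qed

section \<open>Admissibility of grafted trees\<close>

lemma admissibleD:
  assumes "t \<in> admissible_trees \<Gamma>"
  shows "distinct (leaf_list t)" "set_ptree t = verts \<Gamma>"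
    "s \<in> subtrees t \<Longrightarrow> tube \<Gamma> (set_ptree s)"
  using assms by (auto simp: admissible_trees_def)

text \<open>The subtrees of the grafted tree are those of s and the grafted subtrees of t. A subtree
  of t that contains the leaf \<open>Min G\<close> gains all of G, which is exactly how the tubes of
  the contraction correspond to tubes of \<Gamma>.\<close>

lemma graft_admissible_iff:
  assumes \<Gamma>: "simple_graph \<Gamma>" and tube: "tube \<Gamma> (set_ptree s)" and g: "graftable s t"
  shows "graft (Min (set_ptree s)) s t \<in> admissible_trees \<Gamma> \<longleftrightarrow>
    t \<in> admissible_trees (contract_tube \<Gamma> (set_ptree s)) \<and>
    s \<in> admissible_trees (restr \<Gamma> (set_ptree s))"
proof -
  let ?G = "set_ptree s" let ?m = "Min ?G"
  have m: "?m \<in> ?G" "?m \<in> set_ptree t" using graftableD(3)[OF g] by (simp_all add: Min_in)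
  have int: "set_ptree t \<inter> ?G = {?m}" using g by (rule graftableD)
  have GV: "?G \<subseteq> verts \<Gamma>" using tube by (rule tube_subset)
  have verts: "set_ptree (graft ?m s t) = verts \<Gamma> \<longleftrightarrow>
      set_ptree t = insert ?m (verts \<Gamma> - ?G)"
    using m int GV by (auto simp: set_graft)
  have "(\<forall>u\<in>subtrees (graft ?m s t). tube \<Gamma> (set_ptree u)) \<longleftrightarrow>
      (\<forall>u\<in>subtrees t. tube (contract_tube \<Gamma> ?G) (set_ptree u)) \<and>
      (\<forall>u\<in>subtrees s. tube (restr \<Gamma> ?G) (set_ptree u))"
    if t: "set_ptree t = insert ?m (verts \<Gamma> - ?G)"
  proof -
    have "tube (contract_tube \<Gamma> ?G) (set_ptree u) \<longleftrightarrow> tube \<Gamma> (set_ptree (graft ?m s u))"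
      if "u \<in> subtrees t" for u
    proof -
      have "set_ptree u \<subseteq> insert ?m (verts \<Gamma> - ?G)"
        using subtrees_subset[OF that] t by simp
      note tube_contract_tube_iff[OF \<Gamma> tube this]
      moreover have "set_ptree u \<union> ?G = set_ptree u - {?m} \<union> ?G" using m by blast
      ultimately show ?thesis by (simp add: set_graft)
    qed
    moreover have "tube (restr \<Gamma> ?G) (set_ptree u) \<longleftrightarrow> tube \<Gamma> (set_ptree u)"
      if "u \<in> subtrees s" for u
      using that subtrees_subset[OF that] by (simp add: tube_restr_iff[OF \<Gamma> GV])
    ultimately show ?thesis using m by (simp add: subtrees_graft ball_Un)
  qed
  then show ?thesis
    using verts graftableD(1,2)[OF g] graft_distinct[OF g]
    by (auto simp: admissible_trees_def verts_contract_tube)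
qed

lemma graftableI_admissible:
  assumes "t \<in> admissible_trees (contract_tube \<Gamma> G)" "s \<in> admissible_trees (restr \<Gamma> G)"
  shows "graftable s t" "set_ptree s = G"
proof -
  show s: "set_ptree s = G" using admissibleD(2)[OF assms(2)] by simp
  have "Min G \<in> G" using s by (metis Min_in finite_set_ptree set_ptree_nonempty)
  then show "graftable s t"
    using s admissibleD(1)[OF assms(1)] admissibleD(1)[OF assms(2)]
      admissibleD(2)[OF assms(1)] by (auto simp: graftable_def verts_contract_tube)
qed

section \<open>Tree sums over a linear and over a cyclic order\<close>

text \<open>On three vertices this is the relator of the ordering up to sign
  (\<open>linear_sum_triple\<close>): the restriction to admissible trees reproduces the case
  distinction of \<open>ham_relator\<close>.\<close>

definition linear_sum :: "graph \<Rightarrow> nat list \<Rightarrow> nat ptree \<Rightarrow>\<^sub>0 'k::field"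
  where "linear_sum \<Gamma> w =
    (\<Sum>t | t \<in> admissible_trees \<Gamma> \<and> leaf_list t = w. Poly_Mapping.single t (tree_sign t))"

lemma finite_admissible_leaf_list: "finite {t. t \<in> admissible_trees \<Gamma> \<and> leaf_list t = w}"
  by (rule finite_subset[OF _ finite_trees_leaf_list[of w]]) auto

lemma lookup_linear_sum: "Poly_Mapping.lookup (linear_sum \<Gamma> w) t =
    (if t \<in> admissible_trees \<Gamma> \<and> leaf_list t = w then tree_sign t else 0)"
proof -
  have "Poly_Mapping.lookup (linear_sum \<Gamma> w) t =
      (\<Sum>t' | t' \<in> admissible_trees \<Gamma> \<and> leaf_list t' = w. if t' = t then tree_sign t' else 0)"
    by (simp add: linear_sum_def lookup_sum_poly lookup_single when_def)
  then show ?thesis by (simp add: finite_admissible_leaf_list)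
qed

lemma keys_linear_sum:
  "t \<in> Poly_Mapping.keys (linear_sum \<Gamma> w :: _ \<Rightarrow>\<^sub>0 'k::field) \<Longrightarrow>
    t \<in> admissible_trees \<Gamma> \<and> leaf_list t = w"
  by (auto simp: in_keys_iff lookup_linear_sum split: if_splits)

lemma split_distinct_unique:
  assumes "distinct (p @ g @ q)" "p @ g @ q = p' @ g' @ q'" "set g = set g'" "g \<noteq> []"
  shows "p = p' \<and> g = g' \<and> q = q'"
proof -
  have g': "g' \<noteq> []" using assms by auto
  have d': "distinct (p' @ g' @ q')" using assms by metis
  \<comment> \<open>The prefix p is recovered as the part before the first letter of the
    block.\<close>
  have tw: "takeWhile (\<lambda>x. x \<notin> set g) (p @ g @ q) = p"
    if "distinct (p @ g @ q)" "g \<noteq> []" for p g q :: "'a list"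
  proof -
    have "takeWhile (\<lambda>x. x \<notin> set g) (p @ g @ q) = p @ takeWhile (\<lambda>x. x \<notin> set g) (g @ q)"
      using that(1) by (intro takeWhile_append2) auto
    also have "takeWhile (\<lambda>x. x \<notin> set g) (g @ q) = []"
      using that(2) by (cases g) auto
    finally show ?thesis by simp
  qed
  have "p = p'" using tw[OF assms(1,4)] tw[OF d' g'] assms(2,3) by simp
  then have eq: "g @ q = g' @ q'" using assms by simp
  moreover have "length g = length g'"
    using assms d' by (metis distinct_append distinct_card)
  ultimately show ?thesis using \<open>p = p'\<close> by simp
qed

text \<open>In every tree that contributes, the leaves of the subtree cut off form the interval g,
  and by \<open>tree_sign_graft\<close> the sign of the cut depends only on the lengths of g and q.
  Hence the sum over pairs of trees factors.\<close>

lemma decomp_linear_sum: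
  assumes \<Gamma>: "simple_graph \<Gamma>" and tube: "tube \<Gamma> G" and d: "distinct (p @ g @ q)" and g: "set g = G"
  shows "lin_ext (decomp G) (linear_sum \<Gamma> (p @ g @ q)) =
    smul ((-1) ^ ((length g - 1) * length q))
      (tensor (linear_sum (contract_tube \<Gamma> G) (p @ Min G # q)) (linear_sum (restr \<Gamma> G) g) :: _ \<Rightarrow>\<^sub>0 'k::field)"
    (is "?L = ?R")
proof (rule poly_pair_eqI)
  fix t s :: "nat ptree"
  have g0: "g \<noteq> []" using tube_nonempty[OF tube] g by auto
  have dist: "\<forall>t\<in>Poly_Mapping.keys (linear_sum \<Gamma> (p @ g @ q) :: _ \<Rightarrow>\<^sub>0 'k). distinct (leaf_list t)"
    using keys_linear_sum admissibleD(1) by blast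
  show "Poly_Mapping.lookup ?L (t, s) = Poly_Mapping.lookup ?R (t, s)"
  proof (cases "set_ptree s = G \<and> graftable s t")
    case True
    then have s: "set_ptree s = G" and gr: "graftable s t" by auto
    obtain p' q' where pq: "leaf_list t = p' @ Min G # q'"
      "leaf_list (graft (Min G) s t) = p' @ leaf_list s @ q'" "distinct (p' @ leaf_list s @ q')"
      using graftable_leaf_list[OF gr] s by metis
    have "Min G \<in> G" using s by (metis Min_in finite_set_ptree set_ptree_nonempty)
    then have "Min G \<notin> set p'" "Min G \<notin> set q'" "Min G \<notin> set p" "Min G \<notin> set q"
      using pq(3) s d g by auto
    have "leaf_list (graft (Min G) s t) = p @ g @ q \<longleftrightarrow> p = p' \<and> g = leaf_list s \<and> q = q'"
    proof
      assume "leaf_list (graft (Min G) s t) = p @ g @ q"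
      then have "p @ g @ q = p' @ leaf_list s @ q'" using pq(2) by simp
      then show "p = p' \<and> g = leaf_list s \<and> q = q'"
        using split_distinct_unique[OF d _ _ g0] s g by simp
    qed (use pq(2) in simp)
    also have "\<dots> \<longleftrightarrow> leaf_list t = p @ Min G # q \<and> leaf_list s = g"
    proof -
      have "p' @ Min G # q' = p @ Min G # q \<longleftrightarrow> p' = p \<and> q' = q"
        using \<open>Min G \<notin> set p'\<close> \<open>Min G \<notin> set q'\<close> by (rule append_Cons_eq_iff)
      then show ?thesis using pq(1) by auto
    qed
    finally have ll: "leaf_list (graft (Min G) s t) = p @ g @ q \<longleftrightarrow>
      leaf_list t = p @ Min G # q \<and> leaf_list s = g" .
    have sgn: "(-1) ^ (inner s * inner_after G (graft (Min G) s t)) * tree_sign (graft (Min G) s t) =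
        tree_sign t * tree_sign s * (-1 :: 'k) ^ ((length g - 1) * length q)"
      if "leaf_list t = p @ Min G # q" "leaf_list s = g"
    proof -
      have "length g - 1 = inner s" using that length_leaf_list[of s] by simp
      then show ?thesis using tree_sign_graft[OF gr, of p q] that s
        by (simp add: mult.commute)
    qed
    show ?thesis
      unfolding lookup_decomp[OF dist]
      using True graft_admissible_iff[OF \<Gamma> _ gr] tube s ll sgn
      by (auto simp: lookup_linear_sum mult.commute mult.left_commute)
  next
    case False
    then have "\<not> (t \<in> admissible_trees (contract_tube \<Gamma> G) \<and> s \<in> admissible_trees (restr \<Gamma> G))"
      using graftableI_admissible by blast
    then show ?thesis unfolding lookup_decomp[OF dist] using False
      by (auto simp: lookup_linear_sum)
  qed
qed

lemma decomp_linear_sum_zero: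
  assumes d: "distinct w" and "\<nexists>p g q. w = p @ g @ q \<and> set g = G"
  shows "lin_ext (decomp G) (linear_sum \<Gamma> w) = (0 :: _ \<Rightarrow>\<^sub>0 'k::field)"
proof (rule poly_pair_eqI)
  fix t s :: "nat ptree"
  have dist: "\<forall>t\<in>Poly_Mapping.keys (linear_sum \<Gamma> w :: _ \<Rightarrow>\<^sub>0 'k). distinct (leaf_list t)"
    using keys_linear_sum admissibleD(1) by blast
  have "set_ptree s = G \<and> graftable s t \<longrightarrow> leaf_list (graft (Min G) s t) \<noteq> w"
    using graftable_leaf_list[of s t] assms(2) by (metis set_leaf_list)
  then show "Poly_Mapping.lookup (lin_ext (decomp G) (linear_sum \<Gamma> w)) (t, s) =
      Poly_Mapping.lookup (0 :: _ \<Rightarrow>\<^sub>0 'k) (t, s)"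
    unfolding lookup_decomp[OF dist] by (auto simp: lookup_linear_sum)
qed

text \<open>\<open>(-1) ^ (k * (n - 1))\<close> is the sign of the \<open>k\<close>-fold rotation of \<open>n\<close> letters as a permutation; for \<open>n = 2\<close>
  it makes the cyclic sum antisymmetric, as \<open>cycham_relations\<close> requires.\<close>

definition rotation_sign :: "nat list \<Rightarrow> nat list \<Rightarrow> 'k::field"
  where "rotation_sign w w' =
    (\<Sum>k<length w. if rotate k w = w' then (-1) ^ (k * (length w - 1)) else 0)"

section \<open>Rotations of a word and their signs\<close>

lemma mem_rotations_iff: "w' \<in> rotations w \<longleftrightarrow> (\<exists>p q. w = p @ q \<and> w' = q @ p)"
proof
  show "w' \<in> rotations w \<Longrightarrow> \<exists>p q. w = p @ q \<and> w' = q @ p"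
    unfolding rotations_def by (auto simp: rotate_drop_take) (metis append_take_drop_id)
  show "\<exists>p q. w = p @ q \<and> w' = q @ p \<Longrightarrow> w' \<in> rotations w"
  proof (elim exE conjE)
    fix p q assume "w = p @ q" "w' = q @ p"
    then have "w' = rotate (length p) w" by (simp add: rotate_append)
    then show "w' \<in> rotations w" unfolding rotations_def by blast
  qed
qed

lemma rotations_self [simp]: "w \<in> rotations w"
  unfolding mem_rotations_iff by (metis append_Nil append_Nil2)

lemma rotations_sym: "w' \<in> rotations w \<Longrightarrow> w \<in> rotations w'"
  unfolding mem_rotations_iff by blast

lemma rotations_trans: "w' \<in> rotations w \<Longrightarrow> w'' \<in> rotations w' \<Longrightarrow> w'' \<in> rotations w"
  unfolding rotations_def by (auto simp: rotate_rotate)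

lemma rotations_eq: "w' \<in> rotations w \<Longrightarrow> rotations w' = rotations w"
  using rotations_sym rotations_trans by blast

lemma rotations_append: "q @ p \<in> rotations (p @ q)"
  unfolding mem_rotations_iff by blast

lemma rotate_in_rotations: "rotate k w \<in> rotations w"
  unfolding rotations_def by blast

lemma rotations_set: "w' \<in> rotations w \<Longrightarrow> set w' = set w"
  and rotations_length: "w' \<in> rotations w \<Longrightarrow> length w' = length w"
  and rotations_distinct: "w' \<in> rotations w \<Longrightarrow> distinct w' = distinct w"
  by (auto simp: rotations_def)

lemma rotate_inj:
  assumes "distinct w" "i < length w" "j < length w" "rotate i w = rotate j w"
  shows "i = j"
proof -
  have "w \<noteq> []" using assms by auto
  then have "w ! (i mod length w) = w ! (j mod length w)"
    using assms(4) by (metis hd_rotate_conv_nth)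
  then show ?thesis using assms by (simp add: nth_eq_iff_index_eq)
qed

lemma rotation_sign_rotate:
  assumes d: "distinct w" and w: "w \<noteq> []"
  shows "rotation_sign w (rotate k w) = (-1 :: 'k::field) ^ (k * (length w - 1))"
proof -
  let ?n = "length w" let ?j = "k mod ?n"
  have j: "?j < ?n" using w by simp
  have "rotation_sign w (rotate k w) =
      (\<Sum>i<?n. if i = ?j then (-1 :: 'k) ^ (i * (?n - 1)) else 0)"
    unfolding rotation_sign_def
  proof (rule sum.cong[OF refl])
    fix i assume "i \<in> {..<?n}"
    then have "rotate i w = rotate k w \<longleftrightarrow> i = ?j"
      using rotate_inj[OF d, of i ?j] j by (metis lessThan_iff rotate_conv_mod)
    then show "(if rotate i w = rotate k w then (-1 :: 'k) ^ (i * (?n - 1)) else 0) =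
        (if i = ?j then (-1) ^ (i * (?n - 1)) else 0)" by simp
  qed
  also have "\<dots> = (-1) ^ (?j * (?n - 1))" using j by simp
  also have "\<dots> = (-1) ^ (k * (?n - 1))"
  proof -
    \<comment> \<open>A full turn of n letters has exponent n(n - 1), which is even, so k may be
      replaced by its residue.\<close>
    have "even (?n * (?n - 1))" by (cases ?n) auto
    then have "even (k div ?n * (?n * (?n - 1)))" by simp
    then have "(-1 :: 'k) ^ (?j * (?n - 1)) =
        (-1) ^ (?j * (?n - 1) + k div ?n * (?n * (?n - 1)))"
      by (simp add: power_add)
    also have "?j * (?n - 1) + k div ?n * (?n * (?n - 1)) = (k div ?n * ?n + ?j) * (?n - 1)"
      by (simp only: add_mult_distrib mult.assoc add.commute)
    also have "k div ?n * ?n + ?j = k" by simp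
    finally show ?thesis .
  qed
  finally show ?thesis .
qed

lemma rotation_sign_append:
  assumes "distinct (p @ q)" "p @ q \<noteq> []"
  shows "rotation_sign (p @ q) (q @ p) = (-1 :: 'k::field) ^ (length p * (length (p @ q) - 1))"
  using rotation_sign_rotate[OF assms, of "length p"] by (simp add: rotate_append)

lemma rotation_sign_zero: "w' \<notin> rotations w \<Longrightarrow> rotation_sign w w' = 0"
  unfolding rotation_sign_def by (rule sum.neutral) (auto intro: rotate_in_rotations)

lemma rotation_sign_self:
  assumes "distinct w" "w \<noteq> []"
  shows "rotation_sign w w = (1 :: 'k::field)"
  using rotation_sign_rotate[OF assms, of 0] by simp

text \<open>The exponents of successive rotations add. As a consequence, the cyclic sums of two
  representatives of one cyclic order differ by a sign only.\<close>

lemma rotation_sign_trans: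
  assumes "distinct w" "w \<noteq> []" "w' \<in> rotations w"
  shows "rotation_sign w w'' = rotation_sign w w' * (rotation_sign w' w'' :: 'k::field)"
proof (cases "w'' \<in> rotations w'")
  case True
  obtain i j where "w' = rotate i w" "w'' = rotate j w'"
    using assms(3) True by (auto simp: rotations_def)
  moreover have "rotation_sign (rotate i w) (rotate j (rotate i w)) =
      (-1 :: 'k) ^ (j * (length w - 1))"
    using rotation_sign_rotate[of "rotate i w" j] assms by simp
  moreover have "rotation_sign w (rotate j (rotate i w)) = (-1 :: 'k) ^ ((j + i) * (length w - 1))"
    using rotation_sign_rotate[OF assms(1,2), of "j + i"] by (simp add: rotate_rotate)
  moreover have "rotation_sign w (rotate i w) = (-1 :: 'k) ^ (i * (length w - 1))"
    using rotation_sign_rotate[OF assms(1,2), of i] .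
  ultimately show ?thesis
    by (simp add: power_add add_mult_distrib mult.commute)
next
  case False
  then have "w'' \<notin> rotations w" using assms(3) rotations_eq by blast
  then show ?thesis using False by (simp add: rotation_sign_zero)
qed

section \<open>The signed sum over a cyclic order and its decomposition\<close>

definition cyclic_sum :: "graph \<Rightarrow> nat list \<Rightarrow> nat ptree \<Rightarrow>\<^sub>0 'k::field"
  where "cyclic_sum \<Gamma> w =
    (\<Sum>k<length w. smul ((-1) ^ (k * (length w - 1))) (linear_sum \<Gamma> (rotate k w)))"

lemma lookup_cyclic_sum: "Poly_Mapping.lookup (cyclic_sum \<Gamma> w) t =
    (if t \<in> admissible_trees \<Gamma> then rotation_sign w (leaf_list t) * tree_sign t else (0::'k::field))"
  unfolding cyclic_sum_def lookup_sum_poly rotation_sign_def sum_distrib_right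
  by (auto simp: lookup_linear_sum intro!: sum.cong)

lemma cyclic_sum_rotation:
  assumes "distinct w" "w \<noteq> []" "w' \<in> rotations w"
  shows "cyclic_sum \<Gamma> w = smul (rotation_sign w w') (cyclic_sum \<Gamma> w' :: _ \<Rightarrow>\<^sub>0 'k::field)"
proof (rule poly_mapping_eqI)
  fix t
  have e: "rotation_sign w (leaf_list t) =
      rotation_sign w w' * (rotation_sign w' (leaf_list t) :: 'k)"
    by (rule rotation_sign_trans[OF assms])
  show "Poly_Mapping.lookup (cyclic_sum \<Gamma> w) t =
      Poly_Mapping.lookup (smul (rotation_sign w w') (cyclic_sum \<Gamma> w' :: _ \<Rightarrow>\<^sub>0 'k)) t"
    by (simp add: lookup_cyclic_sum e mult.assoc)
qed

lemma keys_cyclic_sum: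
  "t \<in> Poly_Mapping.keys (cyclic_sum \<Gamma> w :: _ \<Rightarrow>\<^sub>0 'k::field) \<Longrightarrow>
    t \<in> admissible_trees \<Gamma> \<and> leaf_list t \<in> rotations w"
  using rotation_sign_zero by (fastforce simp: in_keys_iff lookup_cyclic_sum split: if_splits)

text \<open>A proper rotation with the cut inside g would end with a letter of g, although r' ends
  it with a letter of r; one with the cut inside r would begin with a letter of r, although h begins
  it. With r empty every proper rotation of g would be a counterexample.\<close>

lemma rotation_block:
  assumes d: "distinct (g @ r)" and r: "r \<noteq> []" and h: "set h = set g" "g \<noteq> []"
    and rot: "h @ r' \<in> rotations (g @ r)"
  shows "h = g \<and> r' = r"
proof -
  obtain a b where ab: "g @ r = a @ b" "h @ r' = b @ a" using rot by (auto simp: mem_rotations_iff)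
  have d': "distinct (h @ r')" using d rotations_distinct[OF rot] by simp
  have "set r' = set r"
  proof -
    have "set h \<union> set r' = set g \<union> set r" using rotations_set[OF rot] by simp
    then show ?thesis using d d' h by auto
  qed
  then have r': "r' \<noteq> []" using r by auto
  have h0: "h \<noteq> []" using h by auto
  have "a = [] \<or> b = []"
  proof (rule ccontr)
    assume "\<not> (a = [] \<or> b = [])"
    then have ne: "a \<noteq> []" "b \<noteq> []" by auto
    from ab(1) consider us where "g = a @ us" "us @ r = b" | us where "g @ us = a" "r = us @ b"
      by (auto simp: append_eq_append_conv2)
    then show False
    proof cases
      case 1
      have "last a \<in> set g" using 1 ne by simp
      moreover have "last a \<in> set r"
      proof -
        have "last a = last r'" using ab(2) ne r' by (metis last_appendR)
        then show ?thesis using r' \<open>set r' = set r\<close> by (metis last_in_set)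
      qed
      ultimately show False using d by auto
    next
      case 2
      have "hd b \<in> set r" using 2 ne by simp
      moreover have "hd b \<in> set g"
      proof -
        have "hd b = hd h" using ab(2) ne h0 by (metis hd_append2)
        then show ?thesis using h0 h by (metis hd_in_set)
      qed
      ultimately show False using d by auto
    qed
  qed
  then have "[] @ g @ r = [] @ h @ r'" using ab by auto
  moreover have "distinct ([] @ g @ r)" using d by simp
  ultimately show ?thesis using split_distinct_unique h by metis
qed

text \<open>Compares the rotation of a word with the rotation of the word in which the block g is
  shrunk to the letter m. The correction depends only on the lengths of g and \<open>g @ r\<close>,
  not on the rotation, so it comes out of the sum over all trees.\<close>

lemma rotation_sign_block:
  assumes d: "distinct (g @ r)" and r: "r \<noteq> []" and h: "set h = set g" "g \<noteq> []"
    and m: "m \<in> set g" and dm: "distinct (p @ h @ q)"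
  shows "rotation_sign (g @ r) (p @ h @ q) * (-1) ^ ((length h - 1) * length q) =
    (if h = g then (-1) ^ (length (g @ r) * (length g + 1)) * rotation_sign (m # r) (p @ m # q)
     else (0 :: 'k::field))"
proof (cases "h = g \<and> q @ p = r")
  case True
  then have hg: "h = g" and rr: "r = q @ p" by auto
  let ?a = "length g" and ?Q = "length q" and ?P = "length p"
  have a: "?a \<ge> 1" using h(2) by (cases g) auto
  have "rotation_sign (g @ r) (p @ h @ q) = (-1 :: 'k) ^ ((?a + ?Q) * (?a + ?Q + ?P - 1))"
    using rotation_sign_append[of "g @ q" p] d h(2) by (simp add: hg rr add.assoc)
  moreover have "rotation_sign (m # r) (p @ m # q) = (-1 :: 'k) ^ ((?Q + 1) * (?Q + ?P))"
    using rotation_sign_append[of "m # q" p] d m by (auto simp: rr)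
  \<comment> \<open>With a, P, Q the lengths of g, p, q, both total exponents are congruent to aP +
    aQ + PQ + Q modulo 2.\<close>
  moreover have "(-1 :: 'k) ^ ((?a + ?Q) * (?a + ?Q + ?P - 1)) * (-1) ^ ((?a - 1) * ?Q) =
      (-1) ^ ((?a + ?Q + ?P) * (?a + 1)) * (-1) ^ ((?Q + 1) * (?Q + ?P))"
    unfolding power_add[symmetric] using a by (intro sign_eqI) (auto simp: even_mult_iff)
  ultimately show ?thesis using hg rr by (simp add: add.assoc)
next
  case False
  have "p @ h @ q \<notin> rotations (g @ r)"
  proof
    assume "p @ h @ q \<in> rotations (g @ r)"
    then have "h @ q @ p \<in> rotations (g @ r)"
      using rotations_append[of "h @ q" p] rotations_trans by fastforce
    then show False using rotation_block[OF d r h] False by blast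
  qed
  moreover have "p @ m # q \<notin> rotations (m # r)" if "h = g"
  proof
    assume "p @ m # q \<in> rotations (m # r)"
    then have "[m] @ q @ p \<in> rotations ([m] @ r)"
      using rotations_append[of "[m] @ q" p] rotations_trans by fastforce
    then show False using rotation_block[of "[m]" r "[m]" "q @ p"] d m r False that by auto
  qed
  ultimately show ?thesis by (simp add: rotation_sign_zero)
qed

text \<open>As r is not empty, the arc g is proper and inherits a unique linear order from the
  cyclic one (\<open>rotation_block\<close>). So the second factor is a single linear sum, while the
  contracted order stays cyclic. For the set of all vertices each rotation contributes its own
  linear sum instead.\<close>

lemma decomp_cyclic_sum:
  assumes \<Gamma>: "simple_graph \<Gamma>" and tube: "tube \<Gamma> G" and d: "distinct (g @ r)" and r: "r \<noteq> []"
    and g: "set g = G"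
  shows "lin_ext (decomp G) (cyclic_sum \<Gamma> (g @ r)) =
    smul ((-1) ^ (length (g @ r) * (length g + 1)))
      (tensor (cyclic_sum (contract_tube \<Gamma> G) (Min G # r)) (linear_sum (restr \<Gamma> G) g) :: _ \<Rightarrow>\<^sub>0 'k::field)"
    (is "?L = ?R")
proof (rule poly_pair_eqI)
  fix t s :: "nat ptree"
  have g0: "g \<noteq> []" using tube_nonempty[OF tube] g by auto
  have dist: "\<forall>t\<in>Poly_Mapping.keys (cyclic_sum \<Gamma> (g @ r) :: _ \<Rightarrow>\<^sub>0 'k). distinct (leaf_list t)"
    using keys_cyclic_sum admissibleD(1) by blast
  show "Poly_Mapping.lookup ?L (t, s) = Poly_Mapping.lookup ?R (t, s)"
  proof (cases "set_ptree s = G \<and> graftable s t")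
    case True
    then have s: "set_ptree s = G" and gr: "graftable s t" by auto
    obtain p q where pq: "leaf_list t = p @ Min G # q"
      "leaf_list (graft (Min G) s t) = p @ leaf_list s @ q" "distinct (p @ leaf_list s @ q)"
      using graftable_leaf_list[OF gr] s by metis
    have m: "Min G \<in> set g" using s g by (metis Min_in finite_set_ptree set_ptree_nonempty)
    have i: "inner s = length (leaf_list s) - 1" using length_leaf_list[of s] by simp
    have "(-1) ^ (inner s * inner_after G (graft (Min G) s t)) *
        (rotation_sign (g @ r) (leaf_list (graft (Min G) s t)) * tree_sign (graft (Min G) s t)) =
        rotation_sign (g @ r) (p @ leaf_list s @ q) * (tree_sign (graft (Min G) s t) *
        (-1 :: 'k) ^ (inner s * inner_after G (graft (Min G) s t)))"
      by (simp add: pq)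
    also have "\<dots> = rotation_sign (g @ r) (p @ leaf_list s @ q) *
        (-1) ^ ((length (leaf_list s) - 1) * length q) * (tree_sign t * tree_sign s)"
    proof -
      have "tree_sign (graft (Min G) s t) *
          (-1 :: 'k) ^ (inner s * inner_after G (graft (Min G) s t)) =
          tree_sign t * tree_sign s * (-1) ^ ((length (leaf_list s) - 1) * length q)"
        using tree_sign_graft[OF gr, of p q] s pq i by simp
      then show ?thesis by (simp only: ac_simps)
    qed
    also have "\<dots> = (if leaf_list s = g then (-1) ^ (length (g @ r) * (length g + 1)) *
        rotation_sign (Min G # r) (leaf_list t) else 0) * (tree_sign t * tree_sign s)"
    proof -
      have "set (leaf_list s) = set g" using s g by simp
      from rotation_sign_block[OF d r this g0 m pq(3)] show ?thesis
        unfolding pq(1) by (rule arg_cong)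
    qed
    finally show ?thesis
      unfolding lookup_decomp[OF dist]
      using True graft_admissible_iff[OF \<Gamma> _ gr] tube s
      by (auto simp: lookup_linear_sum lookup_cyclic_sum)
  next
    case False
    then have "\<not> (t \<in> admissible_trees (contract_tube \<Gamma> G) \<and> s \<in> admissible_trees (restr \<Gamma> G))"
      using graftableI_admissible by blast
    then show ?thesis unfolding lookup_decomp[OF dist] using False
      by (auto simp: lookup_linear_sum lookup_cyclic_sum)
  qed
qed

text \<open>Leaf sets of subtrees are arcs of the cyclic order, and the assumptions on G exclude
  arcs.\<close>

lemma decomp_cyclic_sum_zero:
  assumes d: "distinct w" and G: "G \<noteq> set w"
    and no: "\<And>g r. g @ r \<in> rotations w \<Longrightarrow> set g = G \<Longrightarrow> r \<noteq> [] \<Longrightarrow> False"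
  shows "lin_ext (decomp G) (cyclic_sum \<Gamma> w) = (0 :: _ \<Rightarrow>\<^sub>0 'k::field)"
proof (rule poly_pair_eqI)
  fix t s :: "nat ptree"
  have dist: "\<forall>t\<in>Poly_Mapping.keys (cyclic_sum \<Gamma> w :: _ \<Rightarrow>\<^sub>0 'k). distinct (leaf_list t)"
    using keys_cyclic_sum admissibleD(1) by blast
  have "leaf_list (graft (Min G) s t) \<notin> rotations w" if s: "set_ptree s = G" and gr: "graftable s t"
  proof
    assume rot: "leaf_list (graft (Min G) s t) \<in> rotations w"
    obtain p q where pq: "leaf_list (graft (Min G) s t) = p @ leaf_list s @ q"
      using graftable_leaf_list[OF gr] s by metis
    then have rot': "leaf_list s @ q @ p \<in> rotations w"
      using rot rotations_append[of "leaf_list s @ q" p] rotations_trans by fastforce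
    moreover have "q @ p \<noteq> []"
      using rotations_set[OF rot'] s G by auto
    ultimately show False using no[of "leaf_list s" "q @ p"] s by simp
  qed
  then show "Poly_Mapping.lookup (lin_ext (decomp G) (cyclic_sum \<Gamma> w)) (t, s) =
      Poly_Mapping.lookup (0 :: _ \<Rightarrow>\<^sub>0 'k) (t, s)"
    unfolding lookup_decomp[OF dist] by (auto simp: lookup_cyclic_sum rotation_sign_zero)
qed

section \<open>Elements of the Koszul duals\<close>

lemma leaf_list_map_ptree: "leaf_list (map_ptree f t) = map f (leaf_list t)"
  by (induction t) auto

lemma inner_map_ptree [simp]: "inner (map_ptree f t) = inner t"
  by (induction t) auto

lemma tree_sign_map_ptree [simp]: "tree_sign (map_ptree f t) = tree_sign t"
  by (induction t) auto

lemma subtrees_map_ptree: "subtrees (map_ptree f t) = map_ptree f ` subtrees t"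
  by (induction t) auto

lemma admissible_map_ptree:
  assumes "simple_graph \<Gamma>" "inj_on \<sigma> (verts \<Gamma>)" "set_ptree t \<subseteq> verts \<Gamma>"
  shows "map_ptree \<sigma> t \<in> admissible_trees (relabel \<sigma> \<Gamma>) \<longleftrightarrow> t \<in> admissible_trees \<Gamma>"
proof -
  have "tube (relabel \<sigma> \<Gamma>) (\<sigma> ` set_ptree s) \<longleftrightarrow> tube \<Gamma> (set_ptree s)" if "s \<in> subtrees t" for s
    using tube_relabel_iff[OF assms(1,2)] subtrees_subset[OF that] assms(3) by blast
  moreover have "\<sigma> ` set_ptree t = \<sigma> ` verts \<Gamma> \<longleftrightarrow> set_ptree t = verts \<Gamma>"
    using assms by (simp add: inj_on_image_eq_iff)
  moreover have "inj_on \<sigma> (set_ptree t)"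
    using assms by (meson inj_on_subset)
  ultimately show ?thesis
    by (simp add: admissible_trees_def leaf_list_map_ptree distinct_map ptree.set_map subtrees_map_ptree)
qed

lemma relabel_vec_linear_sum:
  assumes \<Gamma>: "simple_graph \<Gamma>" and inj: "inj_on \<sigma> (verts \<Gamma>)" and w: "set w \<subseteq> verts \<Gamma>"
  shows "relabel_vec \<sigma> (linear_sum \<Gamma> w) = linear_sum (relabel \<sigma> \<Gamma>) (map \<sigma> w)"
proof -
  let ?T = "{t. t \<in> admissible_trees \<Gamma> \<and> leaf_list t = w}"
  let ?T' = "{t. t \<in> admissible_trees (relabel \<sigma> \<Gamma>) \<and> leaf_list t = map \<sigma> w}"
  let ?\<tau> = "inv_into (verts \<Gamma>) \<sigma>"
  have \<tau>: "?\<tau> (\<sigma> v) = v" if "v \<in> verts \<Gamma>" for v using inj that by simp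
  have "bij_betw (map_ptree \<sigma>) ?T ?T'"
  proof (rule bij_betw_byWitness[where f' = "map_ptree ?\<tau>"])
    show "\<forall>t\<in>?T. map_ptree ?\<tau> (map_ptree \<sigma> t) = t"
    proof
      fix t assume "t \<in> ?T"
      then have "set_ptree t \<subseteq> verts \<Gamma>" using w by auto
      then have "map_ptree (?\<tau> \<circ> \<sigma>) t = map_ptree id t"
        using \<tau> by (intro ptree.map_cong0) auto
      then show "map_ptree ?\<tau> (map_ptree \<sigma> t) = t" by (simp add: ptree.map_comp ptree.map_id)
    qed
    have inv: "map_ptree \<sigma> (map_ptree ?\<tau> t) = t" "set_ptree (map_ptree ?\<tau> t) \<subseteq> verts \<Gamma>"
      "leaf_list (map_ptree ?\<tau> t) = w" if "t \<in> ?T'" for t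
    proof -
      have s: "set_ptree t = \<sigma> ` set w" using that by (metis (mono_tags) mem_Collect_eq set_leaf_list set_map)
      then have "map_ptree (\<sigma> \<circ> ?\<tau>) t = map_ptree id t"
        using \<tau> w by (intro ptree.map_cong0) auto
      then show "map_ptree \<sigma> (map_ptree ?\<tau> t) = t" by (simp add: ptree.map_comp ptree.map_id)
      show "set_ptree (map_ptree ?\<tau> t) \<subseteq> verts \<Gamma>" using s \<tau> w by (auto simp: ptree.set_map)
      have "map ?\<tau> (map \<sigma> w) = w" using \<tau> w by (auto intro!: map_idI simp del: inv_into_f_f)
      then show "leaf_list (map_ptree ?\<tau> t) = w" using that by (simp add: leaf_list_map_ptree)
    qed
    show "\<forall>t\<in>?T'. map_ptree \<sigma> (map_ptree ?\<tau> t) = t" using inv(1) by blast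
    show "map_ptree \<sigma> ` ?T \<subseteq> ?T'"
      using admissible_map_ptree[OF \<Gamma> inj] admissibleD(2)
      by (auto simp: leaf_list_map_ptree)
    show "map_ptree ?\<tau> ` ?T' \<subseteq> ?T"
    proof
      fix u assume "u \<in> map_ptree ?\<tau> ` ?T'"
      then obtain t where t: "t \<in> ?T'" "u = map_ptree ?\<tau> t" by blast
      then show "u \<in> ?T" using inv[OF t(1)] admissible_map_ptree[OF \<Gamma> inj inv(2)[OF t(1)]] by simp
    qed
  qed
  then have "(\<Sum>t\<in>?T. Poly_Mapping.single (map_ptree \<sigma> t) (tree_sign (map_ptree \<sigma> t))) =
      (\<Sum>t\<in>?T'. Poly_Mapping.single t (tree_sign t))"
    by (rule sum.reindex_bij_betw)
  then show ?thesis
    by (simp add: linear_sum_def relabel_vec_def lin_ext.sum)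
qed

lemma relabel_vec_cyclic_sum:
  assumes \<Gamma>: "simple_graph \<Gamma>" and inj: "inj_on \<sigma> (verts \<Gamma>)" and w: "set w \<subseteq> verts \<Gamma>"
  shows "relabel_vec \<sigma> (cyclic_sum \<Gamma> w) = (cyclic_sum (relabel \<sigma> \<Gamma>) (map \<sigma> w) :: _ \<Rightarrow>\<^sub>0 'k::field)"
proof -
  have "relabel_vec \<sigma> (linear_sum \<Gamma> (rotate k w)) =
      (linear_sum (relabel \<sigma> \<Gamma>) (rotate k (map \<sigma> w)) :: _ \<Rightarrow>\<^sub>0 'k)" for k
    using w by (simp add: rotate_map relabel_vec_linear_sum[OF \<Gamma> inj])
  then show ?thesis
    by (simp add: cyclic_sum_def relabel_vec_def lin_ext.sum lin_ext.scale)
qed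

definition orderings :: "'a set \<Rightarrow> 'a list set"
  where "orderings V = {w. distinct w \<and> set w = V}"

lemma orderings_relabel:
  assumes "inj_on \<sigma> V"
  shows "orderings (\<sigma> ` V) = map \<sigma> ` orderings V"
proof
  show "map \<sigma> ` orderings V \<subseteq> orderings (\<sigma> ` V)"
    using assms by (auto simp: orderings_def distinct_map)
  show "orderings (\<sigma> ` V) \<subseteq> map \<sigma> ` orderings V"
  proof
    fix w assume w: "w \<in> orderings (\<sigma> ` V)"
    let ?v = "map (inv_into V \<sigma>) w"
    have "map \<sigma> ?v = w" using w by (auto simp: orderings_def f_inv_into_f intro!: map_idI)
    moreover have "?v \<in> orderings V"
      using w assms by (auto simp: orderings_def distinct_map inj_on_inv_into inv_into_into)
    ultimately show "w \<in> map \<sigma> ` orderings V" by (metis imageI)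
  qed
qed

definition linear_sums :: "graph \<Rightarrow> (nat ptree \<Rightarrow>\<^sub>0 'k::field) set"
  where "linear_sums \<Gamma> = free.span (linear_sum \<Gamma> ` orderings (verts \<Gamma>))"

definition cyclic_sums :: "graph \<Rightarrow> (nat ptree \<Rightarrow>\<^sub>0 'k::field) set"
  where "cyclic_sums \<Gamma> = free.span (cyclic_sum \<Gamma> ` orderings (verts \<Gamma>))"

lemma linear_sum_in_cofree: "linear_sum \<Gamma> w \<in> cofree \<Gamma>"
  unfolding cofree_def span_basis_vec using keys_linear_sum by blast

lemma cyclic_sum_in_cofree: "cyclic_sum \<Gamma> w \<in> cofree \<Gamma>"
  unfolding cofree_def span_basis_vec using keys_cyclic_sum by blast

lemma subcollection_linear_sums: "subcollection (linear_sums :: graph \<Rightarrow> (nat ptree \<Rightarrow>\<^sub>0 'k::field) set)"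
  unfolding subcollection_def
proof (intro allI impI conjI)
  fix \<Gamma> :: graph assume "connected_graph \<Gamma>"
  then have \<Gamma>: "simple_graph \<Gamma>" by (simp add: connected_graph_def)
  show "free.subspace (linear_sums \<Gamma> :: (nat ptree \<Rightarrow>\<^sub>0 'k) set)" by (simp add: linear_sums_def)
  show "linear_sums \<Gamma> \<subseteq> (cofree \<Gamma> :: (nat ptree \<Rightarrow>\<^sub>0 'k) set)"
    unfolding linear_sums_def using linear_sum_in_cofree
    by (intro free.span_minimal) (auto simp: cofree_def)
  fix \<sigma> :: "nat \<Rightarrow> nat" assume inj: "inj_on \<sigma> (verts \<Gamma>)"
  have "linear_sum (relabel \<sigma> \<Gamma>) ` orderings (verts (relabel \<sigma> \<Gamma>)) =
      relabel_vec \<sigma> ` (linear_sum \<Gamma> ` orderings (verts \<Gamma>) :: (nat ptree \<Rightarrow>\<^sub>0 'k) set)"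
    unfolding relabel_simps orderings_relabel[OF inj] image_image
    by (auto simp: orderings_def relabel_vec_linear_sum[OF \<Gamma> inj] intro!: image_cong)
  then show "linear_sums (relabel \<sigma> \<Gamma>) = relabel_vec \<sigma> ` (linear_sums \<Gamma> :: (nat ptree \<Rightarrow>\<^sub>0 'k) set)"
    by (simp add: linear_sums_def relabel_vec_def span_image_lin_ext)
qed

lemma subcollection_cyclic_sums: "subcollection (cyclic_sums :: graph \<Rightarrow> (nat ptree \<Rightarrow>\<^sub>0 'k::field) set)"
  unfolding subcollection_def
proof (intro allI impI conjI)
  fix \<Gamma> :: graph assume "connected_graph \<Gamma>"
  then have \<Gamma>: "simple_graph \<Gamma>" by (simp add: connected_graph_def)
  show "free.subspace (cyclic_sums \<Gamma> :: (nat ptree \<Rightarrow>\<^sub>0 'k) set)" by (simp add: cyclic_sums_def)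
  show "cyclic_sums \<Gamma> \<subseteq> (cofree \<Gamma> :: (nat ptree \<Rightarrow>\<^sub>0 'k) set)"
    unfolding cyclic_sums_def using cyclic_sum_in_cofree
    by (intro free.span_minimal) (auto simp: cofree_def)
  fix \<sigma> :: "nat \<Rightarrow> nat" assume inj: "inj_on \<sigma> (verts \<Gamma>)"
  have "cyclic_sum (relabel \<sigma> \<Gamma>) ` orderings (verts (relabel \<sigma> \<Gamma>)) =
      relabel_vec \<sigma> ` (cyclic_sum \<Gamma> ` orderings (verts \<Gamma>) :: (nat ptree \<Rightarrow>\<^sub>0 'k) set)"
    unfolding relabel_simps orderings_relabel[OF inj] image_image
    by (auto simp: orderings_def relabel_vec_cyclic_sum[OF \<Gamma> inj] intro!: image_cong)
  then show "cyclic_sums (relabel \<sigma> \<Gamma>) = relabel_vec \<sigma> ` (cyclic_sums \<Gamma> :: (nat ptree \<Rightarrow>\<^sub>0 'k) set)"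
    by (simp add: cyclic_sums_def relabel_vec_def span_image_lin_ext)
qed

lemma lin_ext_image_span_subset:
  assumes "\<And>x. x \<in> S \<Longrightarrow> lin_ext f x \<in> T" "free.subspace T"
  shows "lin_ext f ` free.span S \<subseteq> T"
  unfolding span_image_lin_ext using assms by (intro free.span_minimal) auto

lemma Min_tube: "simple_graph \<Gamma> \<Longrightarrow> tube \<Gamma> G \<Longrightarrow> Min G \<in> G"
  by (simp add: finite_tube tube_nonempty)

lemma orderings_contract_tube:
  assumes "simple_graph \<Gamma>" "tube \<Gamma> G" "p @ g @ q \<in> orderings (verts \<Gamma>)" "set g = G"
  shows "p @ Min G # q \<in> orderings (verts (contract_tube \<Gamma> G))"
  using assms(3,4) Min_tube[OF assms(1,2)]
  by (auto simp: orderings_def verts_contract_tube)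

lemma sub_cocontractad_linear_sums:
  "sub_cocontractad (linear_sums :: graph \<Rightarrow> (nat ptree \<Rightarrow>\<^sub>0 'k::field) set)"
  unfolding sub_cocontractad_def
proof (intro conjI allI impI)
  show "subcollection (linear_sums :: graph \<Rightarrow> (nat ptree \<Rightarrow>\<^sub>0 'k) set)"
    by (rule subcollection_linear_sums)
  fix \<Gamma> G assume "connected_graph \<Gamma>" and tube: "tube \<Gamma> G"
  then have \<Gamma>: "simple_graph \<Gamma>" by (simp add: connected_graph_def)
  let ?T = "tensor_space (linear_sums (contract_tube \<Gamma> G)) (linear_sums (restr \<Gamma> G)) ::
    (nat ptree \<times> nat ptree \<Rightarrow>\<^sub>0 'k) set"
  show "lin_ext (decomp G) ` linear_sums \<Gamma> \<subseteq> ?T"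
    unfolding linear_sums_def[of \<Gamma>]
  proof (rule lin_ext_image_span_subset)
    fix x :: "nat ptree \<Rightarrow>\<^sub>0 'k" assume "x \<in> linear_sum \<Gamma> ` orderings (verts \<Gamma>)"
    then obtain w where w: "w \<in> orderings (verts \<Gamma>)" "x = linear_sum \<Gamma> w" by blast
    then have d: "distinct w" by (simp add: orderings_def)
    show "lin_ext (decomp G) x \<in> ?T"
    proof (cases "\<exists>p g q. w = p @ g @ q \<and> set g = G")
      case True
      then obtain p g q where pgq: "w = p @ g @ q" "set g = G" by blast
      have "linear_sum (contract_tube \<Gamma> G) (p @ Min G # q) \<in>
          (linear_sums (contract_tube \<Gamma> G) :: (nat ptree \<Rightarrow>\<^sub>0 'k) set)"
        unfolding linear_sums_def using orderings_contract_tube[OF \<Gamma> tube] w pgq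
        by (intro free.span_base) blast
      moreover have "linear_sum (restr \<Gamma> G) g \<in> (linear_sums (restr \<Gamma> G) :: (nat ptree \<Rightarrow>\<^sub>0 'k) set)"
        unfolding linear_sums_def using d pgq
        by (intro free.span_base imageI) (simp add: orderings_def)
      ultimately show ?thesis
        unfolding w(2) pgq(1) decomp_linear_sum[OF \<Gamma> tube d[unfolded pgq(1)] pgq(2)]
        by (intro free.subspace_scale[OF subspace_tensor_space] tensor_in_tensor_space)
    next
      case False
      then show ?thesis unfolding w(2)
        using decomp_linear_sum_zero[OF d, of G \<Gamma>] free.subspace_0[OF subspace_tensor_space] by metis
    qed
  qed (rule subspace_tensor_space)
qed

section \<open>Quadratic relations and the inclusion into the duals\<close>

lemma leaf_list_singleton: "leaf_list t = [a] \<longleftrightarrow> t = Lf a"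
  by (cases t) (auto simp: append_eq_Cons_conv)

lemma leaf_list_pair: "leaf_list t = [a, b] \<longleftrightarrow> t = Br (Lf a) (Lf b)"
  by (cases t) (auto simp: append_eq_Cons_conv leaf_list_singleton)

lemma leaf_list_triple: "leaf_list t = [a, b, c] \<longleftrightarrow>
    t = Br (Br (Lf a) (Lf b)) (Lf c) \<or> t = Br (Lf a) (Br (Lf b) (Lf c))"
  by (cases t) (auto simp: append_eq_Cons_conv leaf_list_singleton leaf_list_pair)

lemma admissible_Br_iff: "Br l r \<in> admissible_trees \<Gamma> \<longleftrightarrow>
    distinct (leaf_list (Br l r)) \<and> set_ptree (Br l r) = verts \<Gamma> \<and> tube \<Gamma> (verts \<Gamma>) \<and>
    (\<forall>s\<in>subtrees l \<union> subtrees r. tube \<Gamma> (set_ptree s))"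
  by (auto simp: admissible_trees_def)

text \<open>\<open>tree_sign\<close> is -1 on the left comb and 1 on the right comb, whereas
  \<open>ham_relator\<close> takes the left comb with coefficient 1 whenever it occurs; hence the
  factor -1 exactly when the left comb is admissible.\<close>

lemma linear_sum_triple:
  assumes \<Gamma>: "connected_graph \<Gamma>" and d: "distinct [a, b, c]" and V: "verts \<Gamma> = {a, b, c}"
  shows "linear_sum \<Gamma> [a, b, c] =
    smul (if (a, b) \<in> edges \<Gamma> then -1 else 1) (ham_relator \<Gamma> a b c :: _ \<Rightarrow>\<^sub>0 'k::field)"
proof (rule poly_mapping_eqI)
  fix t
  have s: "simple_graph \<Gamma>" and t: "tube \<Gamma> {a, b, c}"
    using \<Gamma> V by (simp_all add: connected_graph_def)
  have s1: "tube \<Gamma> {a}" "tube \<Gamma> {b}" "tube \<Gamma> {c}" by (simp_all add: V tube_singleton)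
  have l: "Br (Br (Lf a) (Lf b)) (Lf c) \<in> admissible_trees \<Gamma> \<longleftrightarrow> (a, b) \<in> edges \<Gamma>"
    using tube_pair_iff[OF s, of a b] d t s1 by (auto simp: admissible_Br_iff V insert_commute)
  have r: "Br (Lf a) (Br (Lf b) (Lf c)) \<in> admissible_trees \<Gamma> \<longleftrightarrow> (b, c) \<in> edges \<Gamma>"
    using tube_pair_iff[OF s, of b c] d t s1 by (auto simp: admissible_Br_iff V insert_commute)
  show "Poly_Mapping.lookup (linear_sum \<Gamma> [a, b, c]) t =
      Poly_Mapping.lookup (smul (if (a, b) \<in> edges \<Gamma> then -1 else 1)
        (ham_relator \<Gamma> a b c :: _ \<Rightarrow>\<^sub>0 'k)) t"
    using l r by (auto simp: lookup_linear_sum leaf_list_triple ham_relator_def lookup_minus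
        lookup_single when_def)
qed

lemma card_3_list:
  assumes "distinct w" "length w = 3"
  obtains a b c where "w = [a, b, c]" "distinct [a, b, c]"
  using assms by (auto simp: numeral_3_eq_3 length_Suc_conv)

lemma card_2_list:
  assumes "distinct w" "length w = 2"
  obtains a b where "w = [a, b]" "a \<noteq> b"
  using assms by (auto simp: numeral_2_eq_2 length_Suc_conv)

lemma length_orderings: "w \<in> orderings V \<Longrightarrow> length w = card V"
  by (auto simp: orderings_def distinct_card)

lemma satisfies_linear_sums:
  "satisfies_relations ham_relations 3 (linear_sums :: graph \<Rightarrow> (nat ptree \<Rightarrow>\<^sub>0 'k::field) set)"
  unfolding satisfies_relations_def
proof (intro allI impI)
  fix \<Gamma> assume \<Gamma>: "connected_graph \<Gamma>" and card: "card (verts \<Gamma>) = 3"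
  show "linear_sums \<Gamma> \<subseteq> (ham_relations \<Gamma> :: (nat ptree \<Rightarrow>\<^sub>0 'k) set)"
    unfolding linear_sums_def
  proof (rule free.span_minimal)
    show "free.subspace (ham_relations \<Gamma> :: (nat ptree \<Rightarrow>\<^sub>0 'k) set)"
      by (simp add: ham_relations_def)
    show "linear_sum \<Gamma> ` orderings (verts \<Gamma>) \<subseteq> (ham_relations \<Gamma> :: (nat ptree \<Rightarrow>\<^sub>0 'k) set)"
    proof
      fix x :: "nat ptree \<Rightarrow>\<^sub>0 'k" assume "x \<in> linear_sum \<Gamma> ` orderings (verts \<Gamma>)"
      then obtain w where w: "w \<in> orderings (verts \<Gamma>)" "x = linear_sum \<Gamma> w" by blast
      then have d: "distinct w" "set w = verts \<Gamma>" "length w = 3"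
        using card length_orderings[OF w(1)] by (simp_all add: orderings_def)
      obtain a b c where abc: "w = [a, b, c]" "distinct [a, b, c]"
        using d by (metis card_3_list)
      then have "x = smul (if (a, b) \<in> edges \<Gamma> then -1 else 1) (ham_relator \<Gamma> a b c)"
        using d w by (simp add: linear_sum_triple[OF \<Gamma>])
      moreover have "ham_relator \<Gamma> a b c \<in> (ham_relations \<Gamma> :: (nat ptree \<Rightarrow>\<^sub>0 'k) set)"
        unfolding ham_relations_def using abc d by (intro free.span_base) auto
      ultimately show "x \<in> ham_relations \<Gamma>"
        unfolding ham_relations_def by (simp only: free.span_scale)
    qed
  qed
qed

lemma subspace_ham_relations: "free.subspace (ham_relations \<Gamma>)"
  and subspace_cycham_relations: "free.subspace (cycham_relations \<Gamma>)"
  by (simp_all add: ham_relations_def cycham_relations_def)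

lemmas ham_dual_largest = koszul_dual_is_largest[where R = ham_relations,
    OF subspace_ham_relations, folded ham_dual_def]

lemmas cycham_dual_largest = koszul_dual_comodule_is_largest[where H = cycham_relations,
    OF subspace_cycham_relations ham_dual_largest(1), folded cycham_dual_def]

lemma linear_sums_subset_dual: "linear_sums \<Gamma> \<subseteq> ham_dual \<Gamma>"
  by (rule ham_dual_largest(3)[OF sub_cocontractad_linear_sums satisfies_linear_sums])

lemma cyclic_sum_in_linear_sums:
  assumes "w \<in> orderings (verts \<Gamma>)"
  shows "cyclic_sum \<Gamma> w \<in> linear_sums \<Gamma>"
  unfolding cyclic_sum_def linear_sums_def using assms
  by (intro free.span_sum free.span_scale free.span_base imageI) (simp add: orderings_def)

lemma cyclic_sum_singleton: "cyclic_sum \<Gamma> [v] = linear_sum \<Gamma> [v]"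
  by (simp add: cyclic_sum_def lessThan_Suc)

lemma sub_comodule_cyclic_sums:
  "sub_comodule ham_dual (cyclic_sums :: graph \<Rightarrow> (nat ptree \<Rightarrow>\<^sub>0 'k::field) set)"
  unfolding sub_comodule_def
proof (intro conjI allI impI)
  show "subcollection (cyclic_sums :: graph \<Rightarrow> (nat ptree \<Rightarrow>\<^sub>0 'k) set)"
    by (rule subcollection_cyclic_sums)
  fix \<Gamma> assume \<Gamma>: "connected_graph \<Gamma>"
  show "cyclic_sums \<Gamma> \<subseteq> (ham_dual \<Gamma> :: (nat ptree \<Rightarrow>\<^sub>0 'k) set)"
  proof -
    have "cyclic_sums \<Gamma> \<subseteq> (linear_sums \<Gamma> :: (nat ptree \<Rightarrow>\<^sub>0 'k) set)"
      unfolding cyclic_sums_def using cyclic_sum_in_linear_sums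
      by (intro free.span_minimal) (auto simp: linear_sums_def)
    then show ?thesis using linear_sums_subset_dual by blast
  qed
next
  fix \<Gamma> G assume "connected_graph \<Gamma>" and tube: "tube \<Gamma> G"
  then have \<Gamma>: "simple_graph \<Gamma>" by (simp add: connected_graph_def)
  let ?T = "tensor_space (cyclic_sums (contract_tube \<Gamma> G)) (ham_dual (restr \<Gamma> G)) ::
    (nat ptree \<times> nat ptree \<Rightarrow>\<^sub>0 'k) set"
  show "lin_ext (decomp G) ` cyclic_sums \<Gamma> \<subseteq> ?T"
    unfolding cyclic_sums_def[of \<Gamma>]
  proof (rule lin_ext_image_span_subset)
    fix x :: "nat ptree \<Rightarrow>\<^sub>0 'k" assume "x \<in> cyclic_sum \<Gamma> ` orderings (verts \<Gamma>)"
    then obtain w where w: "w \<in> orderings (verts \<Gamma>)" "x = cyclic_sum \<Gamma> w" by blast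
    then have d: "distinct w" "set w = verts \<Gamma>" by (simp_all add: orderings_def)
    have lin: "linear_sum (restr \<Gamma> G) g \<in> (ham_dual (restr \<Gamma> G) :: (nat ptree \<Rightarrow>\<^sub>0 'k) set)"
      if "distinct g" "set g = G" for g
    proof -
      have "linear_sum (restr \<Gamma> G) g \<in> (linear_sums (restr \<Gamma> G) :: (nat ptree \<Rightarrow>\<^sub>0 'k) set)"
        unfolding linear_sums_def using that
        by (intro free.span_base imageI) (simp add: orderings_def)
      then show ?thesis using linear_sums_subset_dual by blast
    qed
    have cyc: "cyclic_sum (contract_tube \<Gamma> G) (Min G # r) \<in>
          (cyclic_sums (contract_tube \<Gamma> G) :: (nat ptree \<Rightarrow>\<^sub>0 'k) set)"
      if "g @ r \<in> orderings (verts \<Gamma>)" "set g = G" for g r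
      unfolding cyclic_sums_def using orderings_contract_tube[OF \<Gamma> tube, of "[]" g r] that
      by (intro free.span_base) auto
    \<comment> \<open>G is everything, a proper arc, or no arc. In the first case the contraction is
      a single vertex and every rotation gives its own linear sum as second factor; the other two
      cases are \<open>decomp_cyclic_sum\<close> and \<open>decomp_cyclic_sum_zero\<close>.\<close>
    consider "G = set w" | g r where "g @ r \<in> rotations w" "set g = G" "r \<noteq> []"
      | "G \<noteq> set w" "\<And>g r. g @ r \<in> rotations w \<Longrightarrow> set g = G \<Longrightarrow> r \<noteq> [] \<Longrightarrow> False"
      by blast
    then show "lin_ext (decomp G) x \<in> ?T"
    proof cases
      case 1
      have "lin_ext (decomp G) (linear_sum \<Gamma> (rotate k w)) \<in> ?T" for k
      proof -
        have "lin_ext (decomp G) (linear_sum \<Gamma> ([] @ rotate k w @ [])) =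
            tensor (cyclic_sum (contract_tube \<Gamma> G) [Min G])
              (linear_sum (restr \<Gamma> G) (rotate k w) :: _ \<Rightarrow>\<^sub>0 'k)"
          using d 1 by (subst decomp_linear_sum[OF \<Gamma> tube]) (simp_all add: cyclic_sum_singleton)
        moreover have "tensor (cyclic_sum (contract_tube \<Gamma> G) [Min G])
              (linear_sum (restr \<Gamma> G) (rotate k w) :: _ \<Rightarrow>\<^sub>0 'k) \<in> ?T"
          using d 1 lin[of "rotate k w"] cyc[of "rotate k w" "[]"]
          by (intro tensor_in_tensor_space) (simp_all add: orderings_def)
        ultimately show ?thesis by simp
      qed
      then show ?thesis unfolding w(2) cyclic_sum_def lin_ext.sum lin_ext.scale
        by (intro free.subspace_sum[OF subspace_tensor_space]
            free.subspace_scale[OF subspace_tensor_space])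
    next
      case 2
      have d2: "distinct (g @ r)" "set (g @ r) = verts \<Gamma>"
        using rotations_distinct[OF 2(1)] rotations_set[OF 2(1)] d by simp_all
      have w0: "w \<noteq> []" using 2 by (auto simp: mem_rotations_iff)
      have "lin_ext (decomp G) (cyclic_sum \<Gamma> (g @ r)) \<in> ?T"
        unfolding decomp_cyclic_sum[OF \<Gamma> tube d2(1) 2(3,2)]
        using lin[of g] cyc[of g r] d2 2(2)
        by (intro free.subspace_scale[OF subspace_tensor_space] tensor_in_tensor_space)
          (auto simp: orderings_def)
      then show ?thesis
        unfolding w(2) cyclic_sum_rotation[OF d(1) w0 2(1)] lin_ext.scale
        by (rule free.subspace_scale[OF subspace_tensor_space])
    next
      case 3
      have "lin_ext (decomp G) (cyclic_sum \<Gamma> w) = (0 :: _ \<Rightarrow>\<^sub>0 'k)"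
        by (rule decomp_cyclic_sum_zero[OF d(1) 3(1)]) (rule 3(2))
      then show ?thesis unfolding w(2) using free.subspace_0[OF subspace_tensor_space] by metis
    qed
  qed (rule subspace_tensor_space)
qed

lemma linear_sum_pair:
  assumes "connected_graph \<Gamma>" "a \<noteq> b" "verts \<Gamma> = {a, b}"
  shows "linear_sum \<Gamma> [a, b] = basis_vec (Br (Lf a) (Lf b))"
proof -
  have "Br (Lf a) (Lf b) \<in> admissible_trees \<Gamma>"
    using assms by (auto simp: admissible_Br_iff tube_singleton connected_graph_def)
  then show ?thesis
    by (intro poly_mapping_eqI)
      (auto simp: lookup_linear_sum leaf_list_pair lookup_single when_def)
qed

lemma cyclic_sum_pair: "cyclic_sum \<Gamma> [a, b] = linear_sum \<Gamma> [a, b] - linear_sum \<Gamma> [b, a]"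
  by (rule poly_mapping_eqI) (simp add: cyclic_sum_def lessThan_Suc lookup_add lookup_minus)

lemma satisfies_cyclic_sums:
  "satisfies_relations cycham_relations 2 (cyclic_sums :: graph \<Rightarrow> (nat ptree \<Rightarrow>\<^sub>0 'k::field) set)"
  unfolding satisfies_relations_def
proof (intro allI impI)
  fix \<Gamma> assume \<Gamma>: "connected_graph \<Gamma>" and card: "card (verts \<Gamma>) = 2"
  show "cyclic_sums \<Gamma> \<subseteq> (cycham_relations \<Gamma> :: (nat ptree \<Rightarrow>\<^sub>0 'k) set)"
    unfolding cyclic_sums_def
  proof (rule free.span_minimal[OF _ subspace_cycham_relations])
    show "cyclic_sum \<Gamma> ` orderings (verts \<Gamma>) \<subseteq> (cycham_relations \<Gamma> :: (nat ptree \<Rightarrow>\<^sub>0 'k) set)"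
    proof
      fix x :: "nat ptree \<Rightarrow>\<^sub>0 'k" assume "x \<in> cyclic_sum \<Gamma> ` orderings (verts \<Gamma>)"
      then obtain w where w: "w \<in> orderings (verts \<Gamma>)" "x = cyclic_sum \<Gamma> w" by blast
      then have d: "distinct w" "set w = verts \<Gamma>" "length w = 2"
        using card length_orderings[OF w(1)] by (simp_all add: orderings_def)
      obtain a b where ab: "w = [a, b]" "a \<noteq> b"
        using d by (metis card_2_list)
      then have V: "verts \<Gamma> = {a, b}" "verts \<Gamma> = {b, a}" using d by auto
      have "x = basis_vec (Br (Lf a) (Lf b)) - basis_vec (Br (Lf b) (Lf a))"
        using w ab by (simp add: cyclic_sum_pair linear_sum_pair[OF \<Gamma> ab(2) V(1)]
            linear_sum_pair[OF \<Gamma> ab(2)[symmetric] V(2)])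
      then show "x \<in> cycham_relations \<Gamma>"
        unfolding cycham_relations_def using ab V by (intro free.span_base) auto
    qed
  qed
qed

lemma cyclic_sums_subset_dual: "cyclic_sums \<Gamma> \<subseteq> cycham_dual \<Gamma>"
  by (rule cycham_dual_largest(3)[OF sub_comodule_cyclic_sums satisfies_cyclic_sums])

section \<open>Moving cherries\<close>

abbreviation left_comb :: "nat \<Rightarrow> nat \<Rightarrow> nat \<Rightarrow> nat ptree"
  where "left_comb u v w \<equiv> Br (Br (Lf u) (Lf v)) (Lf w)"

abbreviation right_comb :: "nat \<Rightarrow> nat \<Rightarrow> nat \<Rightarrow> nat ptree"
  where "right_comb u v w \<equiv> Br (Lf u) (Br (Lf v) (Lf w))"

lemma set_small_trees: "set_ptree (Br (Lf a) (Lf b)) = {a, b}"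
  "set_ptree (left_comb u v w) = {u, v, w}" "set_ptree (right_comb u v w) = {u, v, w}"
  by auto

text \<open>Only combs on three leaves are exchanged: cutting such a comb off lands in a
  three-vertex component of \<open>ham_dual\<close>, where the relations can be applied.
  Admissibility of the two trees is a separate matter that depends on the edges.\<close>

definition flip :: "nat ptree \<Rightarrow> nat ptree \<Rightarrow> bool"
  where "flip t t' \<longleftrightarrow> (\<exists>t0 u v w. graftable (left_comb u v w) t0 \<and>
    t = graft (Min {u, v, w}) (left_comb u v w) t0 \<and>
    t' = graft (Min {u, v, w}) (right_comb u v w) t0)"

lemma admissible_subtree:
  assumes \<Gamma>: "simple_graph \<Gamma>" and t: "t \<in> admissible_trees \<Gamma>" and s: "s \<in> subtrees t"
  obtains t0 where "t = graft (Min (set_ptree s)) s t0" "graftable s t0"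
    "t0 \<in> admissible_trees (contract_tube \<Gamma> (set_ptree s))"
    "s \<in> admissible_trees (restr \<Gamma> (set_ptree s))"
proof -
  let ?t0 = "collapse (set_ptree s) t"
  have 1: "graft (Min (set_ptree s)) s ?t0 = t" "graftable s ?t0"
    using collapse_subtree[OF admissibleD(1)[OF t] s] by auto
  then show ?thesis
    using graft_admissible_iff[OF \<Gamma> admissibleD(3)[OF t s] 1(2)] t by (intro that) auto
qed

lemma graftable_cong: "set_ptree s = set_ptree s' \<Longrightarrow> distinct (leaf_list s') \<Longrightarrow>
    graftable s t \<Longrightarrow> graftable s' t"
  by (simp add: graftable_def)

lemma leaf_list_graft_cong:
  "leaf_list s = leaf_list s' \<Longrightarrow> leaf_list (graft m s t) = leaf_list (graft m s' t)"
  by (simp add: leaf_list_graft_concat cong: if_cong)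

text \<open>The leaf set of the comb is a tube already; the flipped tree needs in addition the tube
  {v, w}, which is the given edge.\<close>

lemma flip_left:
  assumes \<Gamma>: "simple_graph \<Gamma>" and t: "t \<in> admissible_trees \<Gamma>"
    and s: "left_comb u v w \<in> subtrees t" and e: "(v, w) \<in> edges \<Gamma>"
  obtains t' where "t' \<in> admissible_trees \<Gamma>" "flip t t'" "leaf_list t' = leaf_list t"
    "Br (Lf v) (Lf w) \<in> subtrees t'"
proof -
  let ?s = "left_comb u v w" and ?s' = "right_comb u v w"
  let ?G = "set_ptree ?s"
  obtain t0 where t0: "t = graft (Min ?G) ?s t0" "graftable ?s t0"
      "t0 \<in> admissible_trees (contract_tube \<Gamma> ?G)" "?s \<in> admissible_trees (restr \<Gamma> ?G)"
    by (rule admissible_subtree[OF \<Gamma> t s])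
  have tube: "tube \<Gamma> ?G" by (rule admissibleD(3)[OF t s])
  have G: "set_ptree ?s' = ?G" "?G = {u, v, w}" by auto
  have d: "distinct [u, v, w]" using distinct_subtree[OF s admissibleD(1)[OF t]] by simp
  then have "tube \<Gamma> {v, w}" using tube_pair_iff[OF \<Gamma>, of v w] e by simp
  then have "?s' \<in> admissible_trees (restr \<Gamma> ?G)"
    using d tube tube_subset[OF tube] tube_restr_iff[OF \<Gamma>, of ?G]
    by (auto simp: admissible_trees_def tube_singleton insert_commute)
  moreover have g: "graftable ?s' t0" using graftable_cong[OF G(1)[symmetric] _ t0(2)] d by simp
  ultimately have "graft (Min ?G) ?s' t0 \<in> admissible_trees \<Gamma>"
    using graft_admissible_iff[OF \<Gamma> _ g] tube t0(3) unfolding G(1) by blast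
  moreover have "flip t (graft (Min ?G) ?s' t0)"
    unfolding flip_def using t0(1,2) G(2) by metis
  moreover have "leaf_list (graft (Min ?G) ?s' t0) = leaf_list t"
    unfolding t0(1) by (rule leaf_list_graft_cong) simp
  moreover have "Br (Lf v) (Lf w) \<in> subtrees (graft (Min ?G) ?s' t0)"
    using graftableD(3)[OF t0(2)] by (simp add: subtrees_graft)
  ultimately show ?thesis by (rule that)
qed

lemma flip_right:
  assumes \<Gamma>: "simple_graph \<Gamma>" and t: "t \<in> admissible_trees \<Gamma>"
    and s: "right_comb u v w \<in> subtrees t" and e: "(u, v) \<in> edges \<Gamma>"
  obtains t' where "t' \<in> admissible_trees \<Gamma>" "flip t' t" "leaf_list t' = leaf_list t"
    "Br (Lf u) (Lf v) \<in> subtrees t'"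
proof -
  let ?s' = "left_comb u v w" and ?s = "right_comb u v w"
  let ?G = "set_ptree ?s"
  obtain t0 where t0: "t = graft (Min ?G) ?s t0" "graftable ?s t0"
      "t0 \<in> admissible_trees (contract_tube \<Gamma> ?G)" "?s \<in> admissible_trees (restr \<Gamma> ?G)"
    by (rule admissible_subtree[OF \<Gamma> t s])
  have tube: "tube \<Gamma> ?G" by (rule admissibleD(3)[OF t s])
  have G: "set_ptree ?s' = ?G" "?G = {u, v, w}" by auto
  have d: "distinct [u, v, w]" using distinct_subtree[OF s admissibleD(1)[OF t]] by simp
  then have "tube \<Gamma> {u, v}" using tube_pair_iff[OF \<Gamma>, of u v] e by simp
  then have "?s' \<in> admissible_trees (restr \<Gamma> ?G)"
    using d tube tube_subset[OF tube] tube_restr_iff[OF \<Gamma>, of ?G]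
    by (auto simp: admissible_trees_def tube_singleton insert_commute)
  moreover have g: "graftable ?s' t0" using graftable_cong[OF G(1)[symmetric] _ t0(2)] d by simp
  ultimately have "graft (Min ?G) ?s' t0 \<in> admissible_trees \<Gamma>"
    using graft_admissible_iff[OF \<Gamma> _ g] tube t0(3) unfolding G(1) by blast
  moreover have "flip (graft (Min ?G) ?s' t0) t"
    unfolding flip_def using t0(1) g G(2) by metis
  moreover have "leaf_list (graft (Min ?G) ?s' t0) = leaf_list t"
    unfolding t0(1) by (rule leaf_list_graft_cong) simp
  moreover have "Br (Lf u) (Lf v) \<in> subtrees (graft (Min ?G) ?s' t0)"
    using graftableD(3)[OF t0(2)] by (simp add: subtrees_graft)
  ultimately show ?thesis by (rule that)
qed

lemma cherry_exists: "inner t > 0 \<Longrightarrow> \<exists>a b. Br (Lf a) (Lf b) \<in> subtrees t"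
proof (induction t)
  case (Br l r)
  then show ?case by (cases l; cases r) auto
qed simp

text \<open>The positions of a cyclically consecutive pair c, d relative to a, b: equal, overlapping
  in a, overlapping in b, disjoint. With R empty there would be one more, c = b and d = a.\<close>

lemma rotations_of_pair:
  assumes "c # d # r \<in> rotations (a # b # R)" "R \<noteq> []"
  obtains "c = a" "d = b"
  | R' where "d = a" "R = R' @ [c]"
  | R' where "c = b" "R = d # R'"
  | R1 R2 where "R = R1 @ c # d # R2"
proof -
  obtain p q where pq: "a # b # R = p @ q" "c # d # r = q @ p"
    using assms(1) by (auto simp: mem_rotations_iff)
  consider "p = []" | "p = [a]" "q = b # R" | p' where "p = a # b # p'" "R = p' @ q"
    using pq(1) by (cases p; cases "tl p") auto
  then show ?thesis
  proof cases
    case 1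
    then show ?thesis using pq that(1) by auto
  next
    case 2
    then show ?thesis using pq that(3)[of "tl R"] assms(2) by (cases R) auto
  next
    case 3
    consider "q = []" | "q = [c]" | q' where "q = c # d # q'"
      using pq(2) by (cases q; cases "tl q") auto
    then show ?thesis
    proof cases
      case 1
      then show ?thesis using pq 3 that(1) by auto
    next
      case 2
      then show ?thesis using pq 3 that(2) by auto
    next
      case q: 3
      then show ?thesis using 3 that(4) by auto
    qed
  qed
qed

lemma rotation_block_swap:
  assumes "distinct (p @ m # q)" "p' @ m # q' \<in> rotations (p @ m # q)"
  shows "q' @ p' = q @ p"
proof -
  have "m # q' @ p' \<in> rotations (m # q @ p)"
  proof -
    have "m # q' @ p' \<in> rotations (p' @ m # q')" using rotations_append[of "m # q'" p'] by simp
    moreover have "p @ m # q \<in> rotations (m # q @ p)" using rotations_append[of p "m # q"] by simp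
    ultimately show ?thesis using assms(2) rotations_trans by blast
  qed
  moreover have "distinct (m # q @ p)" using assms(1) by auto
  ultimately show ?thesis
    using rotation_block[of "[m]" "q @ p" "[m]" "q' @ p'"] rotations_length[of "m # q' @ p'" "m # q @ p"]
    by (cases "q @ p = []") auto
qed

lemma rotations_block_rotations:
  assumes "q' @ p' = q @ p"
  shows "p' @ g @ q' \<in> rotations (p @ g @ q)"
proof -
  have "g @ q @ p \<in> rotations (p @ g @ q)" using rotations_append[of "g @ q" p] by simp
  moreover have "p' @ g @ q' \<in> rotations (g @ q' @ p')" using rotations_append[of p' "g @ q'"] by simp
  ultimately show ?thesis using assms rotations_trans by metis
qed

lemma edges_contract_tube_iff:
  assumes "simple_graph \<Gamma>" "tube \<Gamma> G"
  shows "x \<in> verts \<Gamma> - G \<Longrightarrow> (x, Min G) \<in> edges (contract_tube \<Gamma> G) \<longleftrightarrow> (\<exists>v\<in>G. (x, v) \<in> edges \<Gamma>)"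
    "x \<in> verts \<Gamma> - G \<Longrightarrow> (Min G, x) \<in> edges (contract_tube \<Gamma> G) \<longleftrightarrow> (\<exists>v\<in>G. (v, x) \<in> edges \<Gamma>)"
    "x \<in> verts \<Gamma> - G \<Longrightarrow> y \<in> verts \<Gamma> - G \<Longrightarrow> x \<noteq> y \<Longrightarrow>
      (x, y) \<in> edges (contract_tube \<Gamma> G) \<longleftrightarrow> (x, y) \<in> edges \<Gamma>"
proof -
  interpret graph_partition \<Gamma> "tube_blocks \<Gamma> G"
    using assms by (intro graph_partition_tube_blocks)
  have G: "G \<in> tube_blocks \<Gamma> G" by (simp add: tube_blocks_def)
  have x: "{x} \<in> tube_blocks \<Gamma> G" "{x} \<noteq> G" if "x \<in> verts \<Gamma> - G" for x
    using that by (auto simp: tube_blocks_def)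
  show "x \<in> verts \<Gamma> - G \<Longrightarrow> (x, Min G) \<in> edges (contract_tube \<Gamma> G) \<longleftrightarrow> (\<exists>v\<in>G. (x, v) \<in> edges \<Gamma>)"
    using edges_contract_iff[of "{x}" G] x G by (simp add: contract_tube_eq)
  show "x \<in> verts \<Gamma> - G \<Longrightarrow> (Min G, x) \<in> edges (contract_tube \<Gamma> G) \<longleftrightarrow> (\<exists>v\<in>G. (v, x) \<in> edges \<Gamma>)"
    using edges_contract_iff[of G "{x}"] x G by (auto simp add: contract_tube_eq)
  show "x \<in> verts \<Gamma> - G \<Longrightarrow> y \<in> verts \<Gamma> - G \<Longrightarrow> x \<noteq> y \<Longrightarrow>
      (x, y) \<in> edges (contract_tube \<Gamma> G) \<longleftrightarrow> (x, y) \<in> edges \<Gamma>"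
    using edges_contract_iff[of "{x}" "{y}"] x by (simp add: contract_tube_eq)
qed

lemma card_contract_tube_pair:
  assumes "simple_graph \<Gamma>" "tube \<Gamma> {a, b}" "a \<noteq> b"
  shows "Suc (card (verts (contract_tube \<Gamma> {a, b}))) = card (verts \<Gamma>)"
proof -
  have "finite (verts \<Gamma>)" "{a, b} \<subseteq> verts \<Gamma>"
    using assms tube_subset by (auto simp: simple_graph_def)
  moreover have "card (verts \<Gamma> - {a, b}) = card (verts \<Gamma>) - 2"
    using calculation assms(3) by (simp add: card_Diff_subset)
  moreover have "card {a, b} \<le> card (verts \<Gamma>)" using calculation by (intro card_mono)
  moreover have "Min {a, b} \<in> {a, b}" by (rule Min_in) auto
  ultimately show ?thesis using assms(3) by (simp add: verts_contract_tube)
qed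

lemma admissible_length: "t \<in> admissible_trees \<Gamma> \<Longrightarrow> length (leaf_list t) = card (verts \<Gamma>)"
  using admissibleD(1,2) distinct_card set_leaf_list by metis

lemma graftable_cherry_leaf_list:
  assumes "graftable (Br (Lf a) (Lf b)) t"
  obtains p q where "leaf_list t = p @ Min {a, b} # q"
    "leaf_list (graft (Min {a, b}) (Br (Lf a) (Lf b)) t) = p @ [a, b] @ q"
    "distinct (p @ [a, b] @ q)"
proof -
  have "leaf_list (Br (Lf a) (Lf b)) = [a, b]" by simp
  then show ?thesis using graftable_leaf_list[OF assms] that unfolding set_small_trees by metis
qed

text \<open>Links t to a tree with a prescribed cherry at adjacent cyclic neighbours c, d through
  trees whose coefficients can be compared: t and t' share the cherry a, b, while t' and t'' agree
  or differ by a flip. The cherry a, b is contracted. Then c, d remain adjacent neighbours, possibly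
  with one of them replaced by the new vertex, and the induction hypothesis gives a tree of the
  contraction with this cherry. When a, b is grafted back, the new cherry is untouched or becomes a
  comb on three leaves, and then one flip finishes.\<close>

lemma cherry_move:
  assumes "connected_graph \<Gamma>" "t \<in> admissible_trees \<Gamma>" "c # d # r \<in> rotations (leaf_list t)"
    "(c, d) \<in> edges \<Gamma>" "Br (Lf a) (Lf b) \<in> subtrees t"
  shows "\<exists>t' t''. t' \<in> admissible_trees \<Gamma> \<and> t'' \<in> admissible_trees \<Gamma> \<and>
    leaf_list t' \<in> rotations (leaf_list t) \<and> leaf_list t'' \<in> rotations (leaf_list t) \<and>
    Br (Lf a) (Lf b) \<in> subtrees t' \<and> Br (Lf c) (Lf d) \<in> subtrees t'' \<and>
    (r \<noteq> [] \<longrightarrow> t' = t'' \<or> flip t' t'' \<or> flip t'' t')"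
  using assms
proof (induction "card (verts \<Gamma>)" arbitrary: \<Gamma> t c d r a b rule: less_induct)
  case less
  have \<Gamma>: "simple_graph \<Gamma>" using less.prems by (simp add: connected_graph_def)
  let ?s = "Br (Lf a) (Lf b)" let ?G = "{a, b}" let ?m = "Min {a, b}"
  let ?\<Gamma>' = "contract_tube \<Gamma> {a, b}"
  obtain t0 where t0: "t = graft ?m ?s t0" "graftable ?s t0"
    "t0 \<in> admissible_trees ?\<Gamma>'" "?s \<in> admissible_trees (restr \<Gamma> {a, b})"
    using admissible_subtree[OF \<Gamma> less.prems(2,5)] unfolding set_small_trees by blast
  have tube: "tube \<Gamma> {a, b}" using admissibleD(3)[OF less.prems(2,5)] unfolding set_small_trees .
  have ab: "a \<noteq> b" using distinct_subtree[OF less.prems(5) admissibleD(1)[OF less.prems(2)]] by simp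
  have conn': "connected_graph ?\<Gamma>'" by (rule connected_contract_tube[OF less.prems(1) tube])
  have m: "?m \<in> {a, b}" by (rule Min_in) auto
  obtain p q where pq: "leaf_list t0 = p @ ?m # q" "leaf_list t = p @ [a, b] @ q"
    "distinct (p @ [a, b] @ q)"
    using graftable_cherry_leaf_list[OF t0(2)] t0(1) by metis
  define R where "R = q @ p"
  have dR: "distinct (a # b # R)" using pq(3) by (auto simp: R_def)
  have rot: "c # d # r \<in> rotations (a # b # R)"
  proof -
    have "leaf_list t \<in> rotations (a # b # R)"
      unfolding pq(2) R_def using rotations_append[of p "[a, b] @ q"] by simp
    then show ?thesis using less.prems(3) rotations_trans by blast
  qed
  have V: "verts \<Gamma> = set (a # b # R)"
    using admissibleD(2)[OF less.prems(2)] set_leaf_list[of t] unfolding pq(2) R_def by auto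
  have rot0: "leaf_list t0 \<in> rotations (?m # R)" "?m # R \<in> rotations (leaf_list t0)"
    unfolding pq(1) R_def using rotations_append[of p "?m # q"] rotations_append[of "?m # q" p] by auto
  show ?case
  proof (cases "R = []")
    case True
    \<comment> \<open>Two vertices: the pair may be b, a, and exchanging the branches of the root is
      not a flip. Here r is empty, so no relation between t' and t'' is claimed.\<close>
    then have "(c = a \<and> d = b \<or> c = b \<and> d = a) \<and> r = []"
      using rot by (auto simp: mem_rotations_iff Cons_eq_append_conv)
    moreover have "t = ?s" using pq True by (simp add: R_def leaf_list_pair)
    moreover have "Br (Lf c) (Lf d) \<in> admissible_trees \<Gamma>"
      using less.prems(1) V True ab calculation
      by (auto simp: admissible_Br_iff tube_singleton connected_graph_def insert_commute)
    moreover have "[b, a] \<in> rotations [a, b]" using rotations_append[of "[b]" "[a]"] by simp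
    ultimately show ?thesis using less.prems(2)
      by (intro exI[of _ t] exI[of _ "Br (Lf c) (Lf d)"]) auto
  next
    case False
    \<comment> \<open>The induction hypothesis in the contraction, for a pair x, y that may involve
      the new vertex \<open>Min {a, b}\<close>, followed by grafting the cherry a, b back.\<close>
    have step: "\<exists>t0'. t0' \<in> admissible_trees ?\<Gamma>' \<and> Br (Lf x) (Lf y) \<in> subtrees t0' \<and>
        graft ?m ?s t0' \<in> admissible_trees \<Gamma> \<and>
        leaf_list (graft ?m ?s t0') \<in> rotations (leaf_list t) \<and>
        ?s \<in> subtrees (graft ?m ?s t0') \<and>
        graft ?m ?s (Br (Lf x) (Lf y)) \<in> subtrees (graft ?m ?s t0') \<and> x \<noteq> y"
      if xy: "x # y # \<rho> \<in> rotations (?m # R)" "(x, y) \<in> edges ?\<Gamma>'" for x y \<rho>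
    proof -
      have "card (verts ?\<Gamma>') < card (verts \<Gamma>)"
        using card_contract_tube_pair[OF \<Gamma> tube ab] by simp
      moreover have "x # y # \<rho> \<in> rotations (leaf_list t0)" using xy(1) rot0 rotations_trans by blast
      moreover have "inner t0 > 0"
      proof -
        have "length (leaf_list t0) = Suc (length R)" by (simp add: pq(1) R_def)
        then show ?thesis using length_leaf_list[of t0] False by simp
      qed
      then obtain a' b' where "Br (Lf a') (Lf b') \<in> subtrees t0" using cherry_exists by blast
      ultimately obtain t0' where t0': "t0' \<in> admissible_trees ?\<Gamma>'"
          "leaf_list t0' \<in> rotations (leaf_list t0)" "Br (Lf x) (Lf y) \<in> subtrees t0'"
        using less.hyps[OF _ conn' t0(3) _ xy(2)] by blast
      have g: "graftable ?s t0'" by (rule graftableI_admissible(1)[OF t0'(1) t0(4)])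
      have adm: "graft ?m ?s t0' \<in> admissible_trees \<Gamma>"
        using graft_admissible_iff[OF \<Gamma> _ g] tube t0'(1) t0(4) unfolding set_small_trees by blast
      obtain p' q' where pq': "leaf_list t0' = p' @ ?m # q'" "leaf_list (graft ?m ?s t0') = p' @ [a, b] @ q'"
        using graftable_cherry_leaf_list[OF g] by metis
      have "q' @ p' = q @ p"
      proof (rule rotation_block_swap)
        show "distinct (p @ ?m # q)" using admissibleD(1)[OF t0(3)] pq(1) by simp
        show "p' @ ?m # q' \<in> rotations (p @ ?m # q)" using t0'(2) pq(1) pq'(1) by simp
      qed
      then have rt: "leaf_list (graft ?m ?s t0') \<in> rotations (leaf_list t)"
        unfolding pq' pq by (rule rotations_block_rotations)
      have mem: "?m \<in> set_ptree t0'" using graftableD(3)[OF g] unfolding set_small_trees .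
      have "x \<noteq> y" using distinct_subtree[OF t0'(3) admissibleD(1)[OF t0'(1)]] by simp
      then show ?thesis using adm rt t0' mem
        by (intro exI[of _ t0']) (auto simp only: subtrees_graft subtrees_self if_True)
    qed
    have out: "x \<in> verts \<Gamma> - {a, b}" "x \<noteq> ?m" if "x \<in> set R" for x
      using that V dR m by auto
    from rot False show ?thesis
    proof (cases rule: rotations_of_pair)
      case 1
      then show ?thesis using less.prems by (intro exI[of _ t]) auto
    next
      case (2 R')
      have x: "c \<in> verts \<Gamma> - {a, b}" "c \<noteq> ?m" using out[of c] 2 by auto
      have "c # ?m # R' \<in> rotations (?m # R)"
        using rotations_append[of "[c]" "?m # R'"] 2 by simp
      moreover have "(c, ?m) \<in> edges ?\<Gamma>'"
        using edges_contract_tube_iff(1)[OF \<Gamma> tube x(1)] less.prems(4) 2 by blast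
      ultimately obtain t0' where t0': "graft ?m ?s t0' \<in> admissible_trees \<Gamma>"
          "leaf_list (graft ?m ?s t0') \<in> rotations (leaf_list t)"
          "?s \<in> subtrees (graft ?m ?s t0')"
          "graft ?m ?s (Br (Lf c) (Lf ?m)) \<in> subtrees (graft ?m ?s t0')"
        using step by blast
      \<comment> \<open>The leaf \<open>Min {a, b}\<close> of the new cherry has become the cherry
        a, b. The flip needs the edge (c, a), which is the given edge (c, d).\<close>
      have "right_comb c a b \<in> subtrees (graft ?m ?s t0')" using t0'(4) x by simp
      then obtain t' where "t' \<in> admissible_trees \<Gamma>" "flip t' (graft ?m ?s t0')"
          "leaf_list t' = leaf_list (graft ?m ?s t0')" "Br (Lf c) (Lf a) \<in> subtrees t'"
        using flip_right[OF \<Gamma> t0'(1)] less.prems(4) 2 by metis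
      then show ?thesis using t0' 2 by (intro exI[of _ "graft ?m ?s t0'"] exI[of _ t']) auto
    next
      case (3 R')
      have x: "d \<in> verts \<Gamma> - {a, b}" "d \<noteq> ?m" using out[of d] 3 by auto
      have "?m # d # R' \<in> rotations (?m # R)" using 3 by simp
      moreover have "(?m, d) \<in> edges ?\<Gamma>'"
        using edges_contract_tube_iff(2)[OF \<Gamma> tube x(1)] less.prems(4) 3 by blast
      ultimately obtain t0' where t0': "graft ?m ?s t0' \<in> admissible_trees \<Gamma>"
          "leaf_list (graft ?m ?s t0') \<in> rotations (leaf_list t)"
          "?s \<in> subtrees (graft ?m ?s t0')"
          "graft ?m ?s (Br (Lf ?m) (Lf d)) \<in> subtrees (graft ?m ?s t0')"
        using step by blast
      have "left_comb a b d \<in> subtrees (graft ?m ?s t0')" using t0'(4) x by simp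
      then obtain t' where "t' \<in> admissible_trees \<Gamma>" "flip (graft ?m ?s t0') t'"
          "leaf_list t' = leaf_list (graft ?m ?s t0')" "Br (Lf b) (Lf d) \<in> subtrees t'"
        using flip_left[OF \<Gamma> t0'(1)] less.prems(4) 3 by metis
      then show ?thesis using t0' 3 by (intro exI[of _ "graft ?m ?s t0'"] exI[of _ t']) auto
    next
      case (4 R1 R2)
      have x: "c \<in> verts \<Gamma> - {a, b}" "c \<noteq> ?m" "d \<in> verts \<Gamma> - {a, b}" "d \<noteq> ?m"
        using out[of c] out[of d] 4 by auto
      have "c # d # R2 @ ?m # R1 \<in> rotations (?m # R)"
        using rotations_append[of "c # d # R2" "?m # R1"] 4 by simp
      moreover have "c \<noteq> d" using 4 dR by auto
      then have "(c, d) \<in> edges ?\<Gamma>'"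
        using edges_contract_tube_iff(3)[OF \<Gamma> tube x(1,3)] less.prems(4) by blast
      ultimately obtain t0' where t0': "graft ?m ?s t0' \<in> admissible_trees \<Gamma>"
          "leaf_list (graft ?m ?s t0') \<in> rotations (leaf_list t)"
          "?s \<in> subtrees (graft ?m ?s t0')"
          "graft ?m ?s (Br (Lf c) (Lf d)) \<in> subtrees (graft ?m ?s t0')"
        using step by blast
      then show ?thesis using x by (intro exI[of _ "graft ?m ?s t0'"]) auto
    qed
  qed
qed

section \<open>The Koszul dual comodule is spanned by the cyclic tree sums\<close>

text \<open>The two signs undo those of \<open>cyclic_sum\<close>, for which this number is 1 on all
  admissible trees with leaf word in \<open>rotations w\<close>. So \<open>coherent\<close> says
  that on each cyclic order x is a multiple of the cyclic sum.\<close>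

definition cyclic_coeff :: "(nat ptree \<Rightarrow>\<^sub>0 'k::field) \<Rightarrow> nat list \<Rightarrow> nat ptree \<Rightarrow> 'k"
  where "cyclic_coeff x w t =
    Poly_Mapping.lookup x t * tree_sign t * rotation_sign w (leaf_list t)"

definition coherent :: "graph \<Rightarrow> (nat ptree \<Rightarrow>\<^sub>0 'k::field) \<Rightarrow> bool"
  where "coherent \<Gamma> x \<longleftrightarrow> (\<forall>w. \<forall>t\<in>admissible_trees \<Gamma>. \<forall>t'\<in>admissible_trees \<Gamma>.
    leaf_list t \<in> rotations w \<longrightarrow> leaf_list t' \<in> rotations w \<longrightarrow>
    cyclic_coeff x w t = cyclic_coeff x w t')"

lemma cyclic_coeff_rotation:
  assumes "distinct w" "w \<noteq> []" "w' \<in> rotations w"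
  shows "cyclic_coeff x w t = rotation_sign w w' * cyclic_coeff x w' t"
  unfolding cyclic_coeff_def rotation_sign_trans[OF assms, of "leaf_list t"] by (simp add: ac_simps)

text \<open>The factor in front depends on s and on lengths of words, not on t. Hence the
  coefficients of two trees with a common subtree s can be compared in the contraction, on the slice
  of the decomposition at s.\<close>

lemma cyclic_coeff_graft:
  assumes x: "x \<in> cofree \<Gamma>" and g: "graftable s t" and d: "distinct (leaf_list s @ r)" and r: "r \<noteq> []"
  shows "cyclic_coeff x (leaf_list s @ r) (graft (Min (set_ptree s)) s t) =
    (-1) ^ (length (leaf_list s @ r) * (length (leaf_list s) + 1)) * tree_sign s *
    cyclic_coeff (slice_fst s (lin_ext (decomp (set_ptree s)) x)) (Min (set_ptree s) # r) t"
proof -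
  let ?G = "set_ptree s" let ?m = "Min ?G" let ?t = "graft ?m s t"
  let ?x' = "slice_fst s (lin_ext (decomp ?G) x)"
  obtain p q where pq: "leaf_list t = p @ ?m # q" "leaf_list ?t = p @ leaf_list s @ q"
    "distinct (p @ leaf_list s @ q)"
    by (rule graftable_leaf_list[OF g])
  have i: "inner s = length (leaf_list s) - 1" using length_leaf_list[of s] by simp
  let ?a = "(-1 :: 'a) ^ (inner s * inner_after ?G ?t)" and ?b = "(-1 :: 'a) ^ (inner s * length q)"
  let ?c = "(-1 :: 'a) ^ (length (leaf_list s @ r) * (length (leaf_list s) + 1))"
  have aa: "?a * ?a = 1" "?b * ?b = 1" by (simp_all flip: power_add)
  have "\<forall>t\<in>Poly_Mapping.keys x. distinct (leaf_list t)"
    using x admissibleD(1) unfolding cofree_def span_basis_vec by blast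
  from lookup_decomp[OF this, of ?G t s] have 1: "Poly_Mapping.lookup ?x' t = ?a * Poly_Mapping.lookup x ?t"
    using g by simp
  have 2: "tree_sign ?t * ?a = tree_sign t * tree_sign s * ?b"
    by (rule tree_sign_graft[OF g pq(1)])
  have 3: "rotation_sign (leaf_list s @ r) (leaf_list ?t) * ?b =
      ?c * rotation_sign (?m # r) (leaf_list t)"
    using rotation_sign_block[OF d r refl leaf_list_nonempty _ pq(3), of ?m] i
    by (simp add: pq(1,2))
  \<comment> \<open>The squares of the signs \<open>?a\<close> and \<open>?b\<close> are inserted so
    that each of the identities 1, 2 and 3 finds its factor.\<close>
  have "cyclic_coeff x (leaf_list s @ r) ?t =
      (?a * ?a) * (?b * ?b) * (Poly_Mapping.lookup x ?t * tree_sign ?t *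
        rotation_sign (leaf_list s @ r) (leaf_list ?t))"
    by (simp add: aa cyclic_coeff_def)
  also have "\<dots> = (?a * Poly_Mapping.lookup x ?t) * (tree_sign ?t * ?a) * ?b *
      (rotation_sign (leaf_list s @ r) (leaf_list ?t) * ?b)"
    by (simp only: ac_simps)
  also have "\<dots> = (?b * ?b) * (Poly_Mapping.lookup ?x' t * tree_sign t * tree_sign s *
      ?c * rotation_sign (?m # r) (leaf_list t))"
    unfolding 1[symmetric] 2 3 by (simp only: ac_simps)
  finally show ?thesis by (simp add: aa cyclic_coeff_def ac_simps)
qed

lemma subspace_ham_dual:
  assumes "connected_graph \<Gamma>"
  shows "free.subspace (ham_dual \<Gamma> :: (nat ptree \<Rightarrow>\<^sub>0 'k::field) set)"
proof -
  have "sub_cocontractad (ham_dual :: graph \<Rightarrow> (nat ptree \<Rightarrow>\<^sub>0 'k) set)"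
    by (rule ham_dual_largest(1))
  then show ?thesis using assms unfolding sub_cocontractad_def subcollection_def by blast
qed

lemma ham_dual_subset_relations:
  assumes "connected_graph \<Gamma>" "card (verts \<Gamma>) = 3"
  shows "ham_dual \<Gamma> \<subseteq> (ham_relations \<Gamma> :: (nat ptree \<Rightarrow>\<^sub>0 'k::field) set)"
proof -
  have "satisfies_relations ham_relations 3 (ham_dual :: graph \<Rightarrow> (nat ptree \<Rightarrow>\<^sub>0 'k) set)"
    by (rule ham_dual_largest(2))
  then show ?thesis using assms unfolding satisfies_relations_def by blast
qed

lemma sub_comodule_cycham_dual:
  "sub_comodule ham_dual (cycham_dual :: graph \<Rightarrow> (nat ptree \<Rightarrow>\<^sub>0 'k::field) set)"
  by (rule cycham_dual_largest(1))

lemma cycham_dual_subset_cofree: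
  "connected_graph \<Gamma> \<Longrightarrow> cycham_dual \<Gamma> \<subseteq> (cofree \<Gamma> :: (nat ptree \<Rightarrow>\<^sub>0 'k::field) set)"
  using sub_comodule_cycham_dual[where 'k = 'k] unfolding sub_comodule_def subcollection_def
  by blast

lemma subspace_cycham_dual:
  "connected_graph \<Gamma> \<Longrightarrow> free.subspace (cycham_dual \<Gamma> :: (nat ptree \<Rightarrow>\<^sub>0 'k::field) set)"
  using sub_comodule_cycham_dual[where 'k = 'k] unfolding sub_comodule_def subcollection_def
  by blast

lemma decomp_cycham_dual:
  assumes "connected_graph \<Gamma>" "tube \<Gamma> G" "x \<in> (cycham_dual \<Gamma> :: (nat ptree \<Rightarrow>\<^sub>0 'k::field) set)"
  shows "lin_ext (decomp G) x \<in> tensor_space (cycham_dual (contract_tube \<Gamma> G)) (ham_dual (restr \<Gamma> G))"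
  using sub_comodule_cycham_dual[where 'k = 'k] assms unfolding sub_comodule_def by blast

text \<open>Both trees arise by grafting s onto trees of the contraction with the same cyclic order.
  If no leaf lies outside s, both trees are s itself.\<close>

lemma coherent_common_subtree:
  assumes \<Gamma>: "connected_graph \<Gamma>" and x: "x \<in> cycham_dual \<Gamma>"
    and IH: "coherent (contract_tube \<Gamma> (set_ptree s)) (slice_fst s (lin_ext (decomp (set_ptree s)) x))"
    and t: "t \<in> admissible_trees \<Gamma>" "t' \<in> admissible_trees \<Gamma>"
    and s: "s \<in> subtrees t" "s \<in> subtrees t'"
    and rot: "leaf_list t \<in> rotations w" "leaf_list t' \<in> rotations w"
  shows "cyclic_coeff x w t = cyclic_coeff x w t'"
proof -
  have \<Gamma>': "simple_graph \<Gamma>" using \<Gamma> by (simp add: connected_graph_def)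
  let ?G = "set_ptree s" let ?m = "Min ?G" let ?\<Gamma>' = "contract_tube \<Gamma> ?G"
  let ?x' = "slice_fst s (lin_ext (decomp ?G) x)"
  obtain t0 where t0: "t = graft ?m s t0" "graftable s t0" "t0 \<in> admissible_trees ?\<Gamma>'"
    using admissible_subtree[OF \<Gamma>' t(1) s(1)] by metis
  obtain t1 where t1: "t' = graft ?m s t1" "graftable s t1" "t1 \<in> admissible_trees ?\<Gamma>'"
    using admissible_subtree[OF \<Gamma>' t(2) s(2)] by metis
  obtain p q where pq: "leaf_list t0 = p @ ?m # q" "leaf_list t = p @ leaf_list s @ q"
    "distinct (p @ leaf_list s @ q)" using graftable_leaf_list[OF t0(2)] t0(1) by metis
  obtain p' q' where pq': "leaf_list t1 = p' @ ?m # q'" "leaf_list t' = p' @ leaf_list s @ q'"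
    "distinct (p' @ leaf_list s @ q')" using graftable_leaf_list[OF t1(2)] t1(1) by metis
  define r where "r = q @ p"
  let ?w = "leaf_list s @ r"
  have w: "?w \<in> rotations (leaf_list t)" "leaf_list t \<in> rotations ?w"
    unfolding pq(2) r_def using rotations_append[of "leaf_list s @ q" p]
      rotations_append[of p "leaf_list s @ q"] by auto
  have dw: "distinct w" "w \<noteq> []" "?w \<in> rotations w"
    using rotations_distinct[OF rot(1)] admissibleD(1)[OF t(1)] rotations_length[OF rot(1)] length_leaf_list[of t]
      rotations_trans[OF rot(1) w(1)] by auto
  have d: "distinct ?w" using pq(3) by (auto simp: r_def)
  have rot': "leaf_list t' \<in> rotations ?w" using rot(2) dw(3) rotations_eq by blast
  have "q' @ p' = r"
  proof (cases "r = []")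
    case True
    then show ?thesis using rotations_length[OF rot'] by (simp add: pq'(2))
  next
    case False
    have "leaf_list s @ q' @ p' \<in> rotations (leaf_list t')"
      unfolding pq'(2) using rotations_append[of "leaf_list s @ q'" p'] by simp
    then have "leaf_list s @ q' @ p' \<in> rotations ?w" using rot' rotations_trans by blast
    from rotation_block[OF d False refl _ this] show ?thesis by simp
  qed
  then have rots: "leaf_list t0 \<in> rotations (?m # r)" "leaf_list t1 \<in> rotations (?m # r)"
    unfolding pq(1) pq'(1) using rotations_append[of p "?m # q"] rotations_append[of p' "?m # q'"]
    by (auto simp: r_def)
  show ?thesis
  proof (cases "r = []")
    case True
    then have "t0 = Lf ?m" "t1 = Lf ?m" using pq pq' \<open>q' @ p' = r\<close>
      by (auto simp: r_def leaf_list_singleton)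
    then show ?thesis using t0 t1 by simp
  next
    case False
    have xc: "x \<in> cofree \<Gamma>" using x cycham_dual_subset_cofree[OF \<Gamma>] by blast
    have "cyclic_coeff x ?w t = cyclic_coeff x ?w t'"
      unfolding t0(1) t1(1) cyclic_coeff_graft[OF xc t0(2) d False] cyclic_coeff_graft[OF xc t1(2) d False]
      using IH t0(3) t1(3) rots unfolding coherent_def by metis
    then show ?thesis unfolding cyclic_coeff_rotation[OF dw] by simp
  qed
qed

text \<open>A linear condition that can be checked on generators: with these two edges present, a
  relator contains the two combs with opposite coefficients or contains neither.\<close>

lemma ham_relations_combs:
  assumes "r \<in> ham_relations \<Gamma>" "(u, v) \<in> edges \<Gamma>" "(v, w) \<in> edges \<Gamma>"
  shows "Poly_Mapping.lookup r (left_comb u v w) + Poly_Mapping.lookup r (right_comb u v w) = (0::'k::field)"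
proof -
  let ?S = "{r :: _ \<Rightarrow>\<^sub>0 'k. Poly_Mapping.lookup r (left_comb u v w) +
    Poly_Mapping.lookup r (right_comb u v w) = 0}"
  have "free.subspace ?S"
    unfolding free.subspace_def
  proof (intro conjI ballI allI)
    fix x y c assume "x \<in> ?S" "y \<in> ?S"
    then have e: "Poly_Mapping.lookup x (right_comb u v w) = - Poly_Mapping.lookup x (left_comb u v w)"
      "Poly_Mapping.lookup y (right_comb u v w) = - Poly_Mapping.lookup y (left_comb u v w)"
      by (simp_all add: eq_neg_iff_add_eq_0 add.commute)
    show "x + y \<in> ?S" by (simp add: lookup_add e)
  next
    fix x c assume "x \<in> ?S"
    then show "smul c x \<in> ?S" by (simp flip: distrib_left)
  qed simp
  moreover have "ham_relator \<Gamma> a b c \<in> ?S" for a b c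
    using assms(2,3) by (auto simp: ham_relator_def Let_def lookup_single when_def lookup_minus)
  ultimately have "ham_relations \<Gamma> \<subseteq> ?S"
    unfolding ham_relations_def by (intro free.span_minimal) auto
  then show ?thesis using assms(1) by blast
qed

text \<open>When the comb is cut off, the slice at t0 lies in \<open>ham_dual\<close> of a connected
  three-vertex graph and satisfies the relations, so the two coefficients are opposite. So are the
  two values of \<open>tree_sign\<close>.\<close>

lemma coherent_flip:
  assumes \<Gamma>: "connected_graph \<Gamma>" and x: "x \<in> cycham_dual \<Gamma>"
    and t: "t \<in> admissible_trees \<Gamma>" "t' \<in> admissible_trees \<Gamma>" and fl: "flip t t'"
  shows "cyclic_coeff x w t = cyclic_coeff x w t'"
proof -
  have \<Gamma>': "simple_graph \<Gamma>" using \<Gamma> by (simp add: connected_graph_def)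
  obtain t0 a b c where f: "graftable (left_comb a b c) t0"
    "t = graft (Min {a, b, c}) (left_comb a b c) t0"
    "t' = graft (Min {a, b, c}) (right_comb a b c) t0"
    using fl unfolding flip_def by blast
  let ?G = "{a, b, c}" let ?l = "left_comb a b c" and ?r = "right_comb a b c"
  have G: "set_ptree ?l = ?G" "set_ptree ?r = ?G" by auto
  have d: "distinct [a, b, c]" using graftableD(1)[OF f(1)] by simp
  have g: "graftable ?r t0" using graftable_cong[OF _ _ f(1), of ?r] d by simp
  have sub: "?l \<in> subtrees t" "?r \<in> subtrees t'"
    using graftableD(3)[OF f(1)] unfolding set_small_trees by (simp_all only: f subtrees_graft) simp_all
  have tube: "tube \<Gamma> ?G" using admissibleD(3)[OF t(1) sub(1)] unfolding set_small_trees .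
  have "Br (Lf a) (Lf b) \<in> subtrees t" "Br (Lf b) (Lf c) \<in> subtrees t'"
    using subtrees_trans[OF sub(1)] subtrees_trans[OF sub(2)] by simp_all
  then have "tube \<Gamma> {a, b}" "tube \<Gamma> {b, c}"
    using admissibleD(3)[OF t(1), of "Br (Lf a) (Lf b)"] admissibleD(3)[OF t(2), of "Br (Lf b) (Lf c)"]
    unfolding set_small_trees by blast+
  then have e: "(a, b) \<in> edges (restr \<Gamma> ?G)" "(b, c) \<in> edges (restr \<Gamma> ?G)"
    using tube_pair_iff[OF \<Gamma>'] d by (auto simp: restr_def)
  let ?u = "lin_ext (decomp ?G) x"
  have conn: "connected_graph (restr \<Gamma> ?G)" by (rule connected_graph_restr[OF \<Gamma>' tube])
  have "slice_snd t0 ?u \<in> ham_dual (restr \<Gamma> ?G)"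
    by (rule slice_snd_tensor_space[OF subspace_ham_dual[OF conn] decomp_cycham_dual[OF \<Gamma> tube x]])
  moreover have "card (verts (restr \<Gamma> ?G)) = 3" using d by simp
  ultimately have rel: "slice_snd t0 ?u \<in> ham_relations (restr \<Gamma> ?G)"
    using ham_dual_subset_relations[OF conn] by blast
  have "x \<in> cofree \<Gamma>" using x cycham_dual_subset_cofree[OF \<Gamma>] by blast
  then have dist: "\<forall>t\<in>Poly_Mapping.keys x. distinct (leaf_list t)"
    using admissibleD(1) unfolding cofree_def span_basis_vec by blast
  \<comment> \<open>A comb has two inner vertices, so moving it past the others costs no Koszul
    sign.\<close>
  have lk: "Poly_Mapping.lookup (slice_snd t0 ?u) ?l = Poly_Mapping.lookup x t"
    "Poly_Mapping.lookup (slice_snd t0 ?u) ?r = Poly_Mapping.lookup x t'"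
    using f g by (simp_all add: lookup_decomp[OF dist] insert_commute power_mult)
  have sum0: "Poly_Mapping.lookup x t + Poly_Mapping.lookup x t' = 0"
    using ham_relations_combs[OF rel e] by (simp only: lk)
  obtain p q where pq: "leaf_list t0 = p @ Min ?G # q"
    using graftable_leaf_list[OF f(1)] unfolding G by metis
  have "tree_sign t = - (tree_sign t0 :: 'a)" "tree_sign t' = (tree_sign t0 :: 'a)"
    using tree_sign_graft[OF f(1), of p q, where 'k = 'a] tree_sign_graft[OF g, of p q, where 'k = 'a] pq
    unfolding G f(2,3) by (simp_all add: power_mult)
  moreover have "leaf_list t = leaf_list t'"
    unfolding f by (rule leaf_list_graft_cong) simp
  moreover have "Poly_Mapping.lookup x t' = - Poly_Mapping.lookup x t"
    using sum0 by (simp add: eq_neg_iff_add_eq_0 add.commute)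
  ultimately show ?thesis by (simp add: cyclic_coeff_def)
qed

lemma cycham_relations_pair:
  assumes "x \<in> cycham_relations \<Gamma>" "a \<noteq> b"
  shows "Poly_Mapping.lookup x (Br (Lf a) (Lf b)) = - (Poly_Mapping.lookup x (Br (Lf b) (Lf a)) :: 'k::field)"
proof -
  let ?S = "{x :: _ \<Rightarrow>\<^sub>0 'k. Poly_Mapping.lookup x (Br (Lf a) (Lf b)) =
    - Poly_Mapping.lookup x (Br (Lf b) (Lf a))}"
  have "free.subspace ?S"
    unfolding free.subspace_def by (simp add: lookup_add)
  moreover have "basis_vec (Br (Lf u) (Lf v)) - basis_vec (Br (Lf v) (Lf u)) \<in> ?S" for u v
    using assms(2) by (auto simp: lookup_single when_def lookup_minus)
  ultimately have "cycham_relations \<Gamma> \<subseteq> ?S"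
    unfolding cycham_relations_def by (intro free.span_minimal) auto
  then show ?thesis using assms(1) by blast
qed

text \<open>Here the relation of \<open>CycHam\<close> enters: the rotation sign of a pair is -1,
  which matches the opposite coefficients that the relation forces on the two trees. Larger graphs
  reach this exchange of root branches by contraction.\<close>

lemma coherent_pair:
  assumes \<Gamma>: "connected_graph \<Gamma>" and x: "x \<in> (cycham_dual \<Gamma> :: (_ \<Rightarrow>\<^sub>0 'k::field) set)" and card: "card (verts \<Gamma>) = 2"
  shows "coherent \<Gamma> x"
  unfolding coherent_def
proof (intro allI ballI impI)
  fix w t t' assume t: "t \<in> admissible_trees \<Gamma>" "t' \<in> admissible_trees \<Gamma>"
    "leaf_list t \<in> rotations w" "leaf_list t' \<in> rotations w"
  have rel: "x \<in> cycham_relations \<Gamma>"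
    using cycham_dual_largest(2) \<Gamma> card x unfolding satisfies_relations_def by blast
  have "distinct w" "length w = 2"
    using t rotations_distinct[OF t(3)] rotations_length[OF t(3)] admissibleD(1)[OF t(1)]
      admissible_length[OF t(1)] card by auto
  then obtain a b where w: "w = [a, b]" "a \<noteq> b" by (metis card_2_list)
  have tr: "u = Br (Lf a) (Lf b) \<or> u = Br (Lf b) (Lf a)" if "leaf_list u \<in> rotations w" for u
  proof -
    from that have "leaf_list u = [a, b] \<or> leaf_list u = [b, a]"
      unfolding w(1) by (auto simp: mem_rotations_iff Cons_eq_append_conv)
    then show ?thesis by (simp add: leaf_list_pair)
  qed
  have "rotation_sign [a, b] [a, b] = (1 :: 'k)"
    by (rule rotation_sign_self) (use w in auto)
  moreover have "rotation_sign [a, b] [b, a] = (-1 :: 'k)"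
    using rotation_sign_append[of "[a]" "[b]", where 'k = 'k] w by simp
  ultimately have "cyclic_coeff x w u = Poly_Mapping.lookup x (Br (Lf a) (Lf b))"
    if "leaf_list u \<in> rotations w" for u
    using tr[OF that] cycham_relations_pair[OF rel w(2)]
    unfolding cyclic_coeff_def w(1) by (elim disjE) simp_all
  then show "cyclic_coeff x w t = cyclic_coeff x w t'" using t by simp
qed

text \<open>Two trees with a common cherry are compared in the contraction of this cherry, by
  induction. For arbitrary t and t' the chain t, t1, t2, t' from \<open>cherry_move\<close> has a
  common cherry in its first and last step and at most a flip in the middle.\<close>

lemma coherent_cycham_dual:
  "connected_graph \<Gamma> \<Longrightarrow> x \<in> (cycham_dual \<Gamma> :: (_ \<Rightarrow>\<^sub>0 'k::field) set) \<Longrightarrow> coherent \<Gamma> x"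
proof (induction "card (verts \<Gamma>)" arbitrary: \<Gamma> x rule: less_induct)
  case less
  note \<Gamma> = less.prems(1) and x = less.prems(2)
  have \<Gamma>': "simple_graph \<Gamma>" using \<Gamma> by (simp add: connected_graph_def)
  have "card (verts \<Gamma>) \<noteq> 0"
    using \<Gamma> by (auto simp: connected_graph_def simple_graph_def tube_def)
  then consider "card (verts \<Gamma>) = 1" | "card (verts \<Gamma>) = 2" | "card (verts \<Gamma>) \<ge> 3" by linarith
  then show ?case
  proof cases
    case 1
    have "\<exists>v. verts \<Gamma> = {v} \<and> t = Lf v" if "t \<in> admissible_trees \<Gamma>" for t
      using admissible_length[OF that] admissibleD(2)[OF that] 1
      by (cases t) (auto simp: length_leaf_list)
    then show ?thesis unfolding coherent_def by (metis singleton_inject)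
  next
    case 2
    then show ?thesis by (rule coherent_pair[OF \<Gamma> x])
  next
    case 3
    have same: "cyclic_coeff x w t = cyclic_coeff x w t'"
      if "t \<in> admissible_trees \<Gamma>" "t' \<in> admissible_trees \<Gamma>"
        "Br (Lf a) (Lf b) \<in> subtrees t" "Br (Lf a) (Lf b) \<in> subtrees t'"
        "leaf_list t \<in> rotations w" "leaf_list t' \<in> rotations w" for w t t' a b
    proof (rule coherent_common_subtree[OF \<Gamma> x _ that(1,2,3,4,5,6)])
      let ?G = "set_ptree (Br (Lf a) (Lf b))"
      have tube: "tube \<Gamma> ?G" by (rule admissibleD(3)[OF that(1,3)])
      have ab: "a \<noteq> b" using distinct_subtree[OF that(3) admissibleD(1)[OF that(1)]] by simp
      have conn: "connected_graph (contract_tube \<Gamma> ?G)" by (rule connected_contract_tube[OF \<Gamma> tube])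
      have "slice_fst (Br (Lf a) (Lf b)) (lin_ext (decomp ?G) x) \<in> cycham_dual (contract_tube \<Gamma> ?G)"
        by (rule slice_fst_tensor_space[OF subspace_cycham_dual[OF conn] decomp_cycham_dual[OF \<Gamma> tube x]])
      moreover have "?G = {a, b}" by auto
      then have "card (verts (contract_tube \<Gamma> ?G)) < card (verts \<Gamma>)"
        using card_contract_tube_pair[OF \<Gamma>' _ ab] tube by simp
      ultimately show "coherent (contract_tube \<Gamma> ?G)
          (slice_fst (Br (Lf a) (Lf b)) (lin_ext (decomp ?G) x))"
        using less.hyps conn by blast
    qed
    show ?thesis
      unfolding coherent_def
    proof (intro allI ballI impI)
      fix w t t' assume t: "t \<in> admissible_trees \<Gamma>" and t': "t' \<in> admissible_trees \<Gamma>"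
        and rot: "leaf_list t \<in> rotations w" "leaf_list t' \<in> rotations w"
      have "inner t > 0" "inner t' > 0"
        using length_leaf_list[of t] length_leaf_list[of t'] admissible_length[OF t]
          admissible_length[OF t'] 3 by auto
      then obtain a b c d where ab: "Br (Lf a) (Lf b) \<in> subtrees t"
        and cd: "Br (Lf c) (Lf d) \<in> subtrees t'"
        using cherry_exists by meson
      have "c \<noteq> d" using distinct_subtree[OF cd admissibleD(1)[OF t']] by simp
      then have e: "(c, d) \<in> edges \<Gamma>"
        using admissibleD(3)[OF t' cd] tube_pair_iff[OF \<Gamma>', of c d]
        unfolding set_small_trees by blast
      obtain t0 where "t' = graft (Min {c, d}) (Br (Lf c) (Lf d)) t0"
        "graftable (Br (Lf c) (Lf d)) t0"
        using admissible_subtree[OF \<Gamma>' t' cd] unfolding set_small_trees by metis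
      then obtain p q where pq: "leaf_list t' = p @ [c, d] @ q"
        using graftable_cherry_leaf_list by metis
      define r where "r = q @ p"
      have "c # d # r \<in> rotations (leaf_list t')"
        unfolding pq r_def using rotations_append[of "[c, d] @ q" p] by simp
      then have cdr: "c # d # r \<in> rotations (leaf_list t)"
        using rot rotations_sym rotations_trans by blast
      have "length (c # d # r) \<ge> 3"
        using rotations_length[OF cdr] admissible_length[OF t] 3 by simp
      \<comment> \<open>This is the condition under which \<open>cherry_move\<close> relates t1 and
        t2, and it is why two vertices form a base case.\<close>
      then have "r \<noteq> []" by auto
      then obtain t1 t2 where t12: "t1 \<in> admissible_trees \<Gamma>" "t2 \<in> admissible_trees \<Gamma>"
          "leaf_list t1 \<in> rotations (leaf_list t)" "leaf_list t2 \<in> rotations (leaf_list t)"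
          "Br (Lf a) (Lf b) \<in> subtrees t1" "Br (Lf c) (Lf d) \<in> subtrees t2"
          "t1 = t2 \<or> flip t1 t2 \<or> flip t2 t1"
        using cherry_move[OF \<Gamma> t cdr e ab] by blast
      have r12: "leaf_list t1 \<in> rotations w" "leaf_list t2 \<in> rotations w"
        using t12(3,4) rot(1) rotations_trans by blast+
      have "cyclic_coeff x w t = cyclic_coeff x w t1"
        by (rule same[OF t t12(1) ab t12(5) rot(1) r12(1)])
      also have "\<dots> = cyclic_coeff x w t2"
        using t12(7) coherent_flip[OF \<Gamma> x t12(1,2)] coherent_flip[OF \<Gamma> x t12(2,1)] by metis
      also have "\<dots> = cyclic_coeff x w t'"
        by (rule same[OF t12(2) t' t12(6) cd r12(2) rot(2)])
      finally show "cyclic_coeff x w t = cyclic_coeff x w t'" .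
    qed
  qed
qed

text \<open>By coherence, subtracting a multiple of one cyclic sum removes all trees of a cyclic
  order from the support at once and adds no others, so induction on the size of the support ends at
  0.\<close>

lemma cycham_dual_eq:
  assumes \<Gamma>: "connected_graph \<Gamma>"
  shows "cycham_dual \<Gamma> = (cyclic_sums \<Gamma> :: (_ \<Rightarrow>\<^sub>0 'k::field) set)"
proof
  have "x \<in> cyclic_sums \<Gamma>" if "x \<in> cycham_dual \<Gamma>" for x :: "nat ptree \<Rightarrow>\<^sub>0 'k"
    using that
  proof (induction "card (Poly_Mapping.keys x)" arbitrary: x rule: less_induct)
    case less
    have keys: "Poly_Mapping.keys x \<subseteq> admissible_trees \<Gamma>"
      using less.prems cycham_dual_subset_cofree[OF \<Gamma>] unfolding cofree_def span_basis_vec[symmetric] by blast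
    show ?case
    proof (cases "Poly_Mapping.keys x = {}")
      case True
      then have "x = 0" by simp
      then show ?thesis by (simp add: cyclic_sums_def free.span_zero)
    next
      case False
      then obtain t where t: "t \<in> Poly_Mapping.keys x" by blast
      then have adm: "t \<in> admissible_trees \<Gamma>" using keys by blast
      let ?w = "leaf_list t" let ?c = "Poly_Mapping.lookup x t * tree_sign t"
      let ?y = "x - smul ?c (cyclic_sum \<Gamma> ?w)"
      have d: "distinct ?w" "?w \<noteq> []" using admissibleD(1)[OF adm] by auto
      have w: "?w \<in> orderings (verts \<Gamma>)" using admissibleD[OF adm] by (simp add: orderings_def)
      have cyc: "cyclic_sum \<Gamma> ?w \<in> cyclic_sums \<Gamma>"
        unfolding cyclic_sums_def using w by (intro free.span_base imageI)
      have sub: "free.subspace (cycham_dual \<Gamma> :: (_ \<Rightarrow>\<^sub>0 'k) set)" by (rule subspace_cycham_dual[OF \<Gamma>])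
      have y: "?y \<in> cycham_dual \<Gamma>"
        using cyc cyclic_sums_subset_dual less.prems
        by (intro free.subspace_diff[OF sub] free.subspace_scale[OF sub]) blast+
      have z: "Poly_Mapping.lookup ?y u = 0" if u: "u \<in> admissible_trees \<Gamma>" "leaf_list u \<in> rotations ?w" for u
      proof -
        have "cyclic_coeff x ?w t = cyclic_coeff x ?w u"
          using coherent_cycham_dual[OF \<Gamma> less.prems, unfolded coherent_def, rule_format, of t u ?w]
            adm u by simp
        then have c: "?c = Poly_Mapping.lookup x u * tree_sign u * rotation_sign ?w (leaf_list u)"
          by (simp add: cyclic_coeff_def rotation_sign_self[OF d])
        have "rotation_sign ?w (leaf_list u) * rotation_sign ?w (leaf_list u) = (1 :: 'k)"
        proof -
          obtain k where "leaf_list u = rotate k ?w" using u(2) by (auto simp: rotations_def)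
          then show ?thesis by (simp add: rotation_sign_rotate[OF d] flip: power_add)
        qed
        moreover have "Poly_Mapping.lookup ?y u = Poly_Mapping.lookup x u - Poly_Mapping.lookup x u *
            (tree_sign u * tree_sign u) *
            (rotation_sign ?w (leaf_list u) * rotation_sign ?w (leaf_list u))"
          using u(1) unfolding lookup_minus lookup_smul c lookup_cyclic_sum by (simp add: ac_simps)
        ultimately show ?thesis by simp
      qed
      have "Poly_Mapping.keys ?y \<subseteq> Poly_Mapping.keys x - {t}"
      proof
        fix u assume u: "u \<in> Poly_Mapping.keys ?y"
        then have nz: "Poly_Mapping.lookup ?y u \<noteq> 0" by (simp add: in_keys_iff)
        have "u \<in> admissible_trees \<Gamma>"
          using nz keys by (auto simp: lookup_minus lookup_cyclic_sum in_keys_iff split: if_splits)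
        then have nr: "leaf_list u \<notin> rotations ?w" using z nz by blast
        then have "rotation_sign ?w (leaf_list u) = (0 :: 'k)" by (rule rotation_sign_zero)
        then have "Poly_Mapping.lookup x u \<noteq> 0"
          using nz by (auto simp: lookup_minus lookup_cyclic_sum split: if_splits)
        moreover have "u \<noteq> t" using nr by auto
        ultimately have "Poly_Mapping.lookup x u \<noteq> 0" "u \<noteq> t" by auto
        then show "u \<in> Poly_Mapping.keys x - {t}" by (simp add: in_keys_iff)
      qed
      then have "Poly_Mapping.keys ?y \<subset> Poly_Mapping.keys x" using t by blast
      then have "card (Poly_Mapping.keys ?y) < card (Poly_Mapping.keys x)"
        by (intro psubset_card_mono) simp_all
      then have "?y \<in> cyclic_sums \<Gamma>" using less.hyps y by blast
      moreover have "smul ?c (cyclic_sum \<Gamma> ?w) \<in> cyclic_sums \<Gamma>"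
        using cyc unfolding cyclic_sums_def by (rule free.span_scale)
      ultimately have "?y + smul ?c (cyclic_sum \<Gamma> ?w) \<in> cyclic_sums \<Gamma>"
        unfolding cyclic_sums_def by (rule free.span_add)
      then show ?thesis by simp
    qed
  qed
  then show "cycham_dual \<Gamma> \<subseteq> (cyclic_sums \<Gamma> :: (_ \<Rightarrow>\<^sub>0 'k) set)" by blast
qed (rule cyclic_sums_subset_dual)

section \<open>The cyclic boundary of a list of words\<close>

text \<open>The bar differential: the alternating sum of f over the merges of neighbouring words
  (\<open>linear_bd_sum\<close>). The recursion absorbs the first word into f, so identities are
  proved by induction with f arbitrary.\<close>

fun linear_bd :: "('a list list \<Rightarrow> 'v::ab_group_add) \<Rightarrow> 'a list list \<Rightarrow> 'v"
  where
    "linear_bd f (a # b # R) = f ((a @ b) # R) - linear_bd (\<lambda>M. f (a # M)) (b # R)"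
  | "linear_bd f [a] = 0"
  | "linear_bd f [] = 0"

fun merges :: "'a list list \<Rightarrow> 'a list list set"
  where
    "merges (a # b # R) = insert ((a @ b) # R) ((#) a ` merges (b # R))"
  | "merges [a] = {}"
  | "merges [] = {}"

definition append_last :: "'a list \<Rightarrow> 'a list list \<Rightarrow> 'a list list"
  where "append_last v N = butlast N @ [last N @ v]"

definition wrap :: "'a list list \<Rightarrow> 'a list list"
  where "wrap L = append_last (hd L) (tl L)"

text \<open>The merge across the end has coefficient -1 for every length: its sign (-1)^(n-1) in the
  sum over all n gaps meets the sign (-1)^(n-2) of rotating the merged word from the front to the
  end (\<open>cyclic_bd_sum\<close>).\<close>

definition cyclic_bd :: "('a list list \<Rightarrow> 'v::ab_group_add) \<Rightarrow> 'a list list \<Rightarrow> 'v"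
  where "cyclic_bd f L = linear_bd f L - f (wrap L)"

lemma merges_length: "M \<in> merges L \<Longrightarrow> Suc (length M) = length L"
  by (induction L arbitrary: M rule: merges.induct) auto

lemma merges_concat: "M \<in> merges L \<Longrightarrow> concat M = concat L"
  by (induction L arbitrary: M rule: merges.induct) auto

lemma merges_nonempty: "M \<in> merges L \<Longrightarrow> M \<noteq> []"
  by (induction L arbitrary: M rule: merges.induct) auto

lemma linear_bd_cong: "(\<And>M. M \<in> merges L \<Longrightarrow> f M = g M) \<Longrightarrow> linear_bd f L = linear_bd g L"
proof (induction L arbitrary: f g rule: merges.induct)
  case (1 a b R)
  have "linear_bd (\<lambda>M. f (a # M)) (b # R) = linear_bd (\<lambda>M. g (a # M)) (b # R)"
    by (rule 1(1)) (simp add: 1(2))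
  moreover have "f ((a @ b) # R) = g ((a @ b) # R)" by (rule 1(2)) simp
  ultimately show ?case by simp
qed simp_all

lemma linear_bd_diff: "linear_bd (\<lambda>M. f M - g M) L = linear_bd f L - linear_bd g L"
proof (induction L arbitrary: f g rule: merges.induct)
  case (1 a b R)
  show ?case
    unfolding linear_bd.simps(1) 1[of "\<lambda>M. f (a # M)" "\<lambda>M. g (a # M)"] by simp
qed simp_all

text \<open>Pairs of merges that leave a alone cancel by induction. Those in which a is merged
  second make up \<open>linear_bd f ((a @ b) # R)\<close>, which is also what arises from merging a
  and b first, with the opposite sign.\<close>

lemma linear_bd_linear_bd: "linear_bd (linear_bd f) L = 0"
proof (induction L arbitrary: f rule: merges.induct)
  case (1 a b R)
  show ?case
  proof (cases R)
    case (Cons c R')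
    \<comment> \<open>Merges a into whatever word comes first in M.\<close>
    let ?g = "\<lambda>M. f ((a @ hd M) # tl M)"
    have "linear_bd (\<lambda>M. linear_bd f (a # M)) (b # R) =
        linear_bd (\<lambda>M. ?g M - linear_bd (\<lambda>N. f (a # N)) M) (b # R)"
    proof (rule linear_bd_cong)
      fix M assume "M \<in> merges (b # R)"
      then obtain x M' where "M = x # M'" using merges_nonempty by (metis neq_Nil_conv)
      then show "linear_bd f (a # M) = ?g M - linear_bd (\<lambda>N. f (a # N)) M" by simp
    qed
    also have "\<dots> = linear_bd ?g (b # R) - linear_bd (linear_bd (\<lambda>N. f (a # N))) (b # R)"
      by (rule linear_bd_diff)
    also have "linear_bd (linear_bd (\<lambda>N. f (a # N))) (b # R) = 0" by (rule 1)
    also have "linear_bd ?g (b # R) = linear_bd f ((a @ b) # R)"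
      unfolding Cons linear_bd.simps(1) by simp
    finally show ?thesis unfolding linear_bd.simps(1) by simp
  qed simp
qed simp_all

lemma append_last_Cons: "N \<noteq> [] \<Longrightarrow> append_last v (x # N) = x # append_last v N"
  by (simp add: append_last_def)

lemma append_last_append_last: "append_last w (append_last v N) = append_last (v @ w) N"
  by (simp add: append_last_def)

lemma linear_bd_append_last:
  "length N \<ge> 2 \<Longrightarrow> linear_bd (\<lambda>M. f (append_last v M)) N = linear_bd f (append_last v N)"
proof (induction N arbitrary: f rule: merges.induct)
  case (1 x y R)
  show ?case
  proof (cases R)
    case Nil
    then show ?thesis by (simp add: append_last_def)
  next
    case (Cons z R')
    have "linear_bd (\<lambda>M. f (append_last v (x # M))) (y # R) =
        linear_bd (\<lambda>M. f (x # append_last v M)) (y # R)"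
    proof (rule linear_bd_cong)
      fix M assume "M \<in> merges (y # R)"
      then have "append_last v (x # M) = x # append_last v M"
        using merges_nonempty append_last_Cons by blast
      then show "f (append_last v (x # M)) = f (x # append_last v M)" by (rule arg_cong)
    qed
    then show ?thesis
      using 1(1)[of "\<lambda>M. f (x # M)"] Cons by (simp add: append_last_Cons)
  qed
qed simp_all

text \<open>The linear part squares to zero, and merging commutes with wrapping except for the merge
  of the first two words; wrapping after that merge equals wrapping twice, and the two terms cancel.
  With only two words the second boundary would be that of a single word, where \<open>wrap\<close>
  has no meaning.\<close>

lemma cyclic_bd_cyclic_bd:
  assumes "length L \<ge> 3"
  shows "cyclic_bd (cyclic_bd f) L = 0"
proof -
  obtain v b M where L: "L = v # b # M" and M: "M \<noteq> []"
    using assms by (cases L; cases "tl L"; cases "tl (tl L)") auto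
  have wL: "wrap L = b # append_last v M" using M by (simp add: L wrap_def append_last_Cons)
  have "linear_bd (\<lambda>N. f (wrap N)) L =
      f (append_last (v @ b) M) - linear_bd (\<lambda>N. f (wrap (v # N))) (b # M)"
    by (simp add: L wrap_def)
  also have "linear_bd (\<lambda>N. f (wrap (v # N))) (b # M) = linear_bd (\<lambda>N. f (append_last v N)) (b # M)"
    by (simp add: wrap_def)
  also have "\<dots> = linear_bd f (wrap L)"
    using linear_bd_append_last[of "b # M" f v] M by (cases M) (simp_all add: wL append_last_Cons)
  finally have "linear_bd (\<lambda>N. f (wrap N)) L = f (append_last (v @ b) M) - linear_bd f (wrap L)" .
  moreover have "wrap (wrap L) = append_last (v @ b) M"
    unfolding wL by (simp add: wrap_def append_last_append_last)
  ultimately show ?thesis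
    unfolding cyclic_bd_def linear_bd_diff by (simp add: linear_bd_linear_bd)
qed

section \<open>The cyclic boundary as a sum over all gaps\<close>

definition merge_first :: "'a list list \<Rightarrow> 'a list list"
  where "merge_first L = (hd L @ hd (tl L)) # tl (tl L)"

lemma linear_bd_sum:
  fixes f :: "'a list list \<Rightarrow> ('b \<Rightarrow>\<^sub>0 'k::field)"
  shows "linear_bd f L = (\<Sum>j<length L - 1. smul ((-1) ^ j) (f (take j L @ merge_first (drop j L))))"
proof (induction L arbitrary: f rule: merges.induct)
  case (1 a b R)
  have "linear_bd f (a # b # R) = f ((a @ b) # R) -
      (\<Sum>j<length R. smul ((-1) ^ j) (f (a # take j (b # R) @ merge_first (drop j (b # R)))))"
    using 1[of "\<lambda>M. f (a # M)"] by simp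
  then show ?case
    by (simp add: sum.lessThan_Suc_shift merge_first_def sum_negf[symmetric] del: sum.lessThan_Suc)
qed simp_all

text \<open>The Koszul differential treats all gaps of a cyclic order alike; here gap j is rotated
  to the front and then merged. Rotating n words by j costs the exponent j(n-1), rotating the n-1
  words after the merge costs j(n-2), and the sum has the parity of j, as in the bar
  differential.\<close>

lemma cyclic_bd_sum:
  fixes f :: "'a list list \<Rightarrow> ('b \<Rightarrow>\<^sub>0 'k::field)"
  assumes len: "length L \<ge> 2" and L: "distinct (concat L)" "[] \<notin> set L"
    and rot: "\<And>M k. distinct (concat M) \<Longrightarrow> [] \<notin> set M \<Longrightarrow> set (concat M) = set (concat L) \<Longrightarrow>
      f (rotate k M) = smul ((-1) ^ (k * (length M - 1))) (f M)"
  shows "cyclic_bd f L =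
    (\<Sum>j<length L. smul ((-1) ^ (j * (length L - 1))) (f (merge_first (rotate j L))))"
proof -
  let ?n = "length L"
  define k where "k = ?n - 2"
  have k: "?n = Suc (Suc k)" using len by (simp add: k_def)
  have "smul ((-1) ^ (j * (?n - 1))) (f (merge_first (rotate j L))) =
      smul ((-1) ^ j) (f (take j L @ merge_first (drop j L)))" if j: "j < ?n - 1" for j
  proof -
    obtain x y D where D: "drop j L = x # y # D"
      using j by (metis Cons_nth_drop_Suc Suc_lessD less_diff_conv Suc_eq_plus1)
    let ?M = "take j L @ (x @ y) # D"
    have LM: "L = take j L @ x # y # D" using D by (metis append_take_drop_id)
    have M: "concat ?M = concat L" by (subst LM) simp
    have ne: "[] \<notin> set ?M" using L(2) by (subst (asm) LM) auto
    have len: "length ?M = ?n - 1" "length (take j L) = j"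
      using j arg_cong[OF D, of length] by auto
    have "merge_first (rotate j L) = (x @ y) # D @ take j L"
      using j D by (simp add: rotate_drop_take merge_first_def)
    also have "\<dots> = rotate j ?M"
      using rotate_append[of "take j L" "(x @ y) # D"] len by simp
    finally have "merge_first (rotate j L) = rotate j ?M" .
    then have "f (merge_first (rotate j L)) = smul ((-1) ^ (j * (?n - 1 - 1))) (f ?M)"
    proof -
      have "distinct (concat ?M)" "set (concat ?M) = set (concat L)" using L(1) by (simp_all only: M)
      then have "f (rotate j ?M) = smul ((-1) ^ (j * (?n - 1 - 1))) (f ?M)"
        using rot[of ?M j] ne by (simp only: len(1) simp_thms)
      then show ?thesis by (simp only: \<open>merge_first (rotate j L) = rotate j ?M\<close>)
    qed
    moreover have "(-1 :: 'k) ^ (j * (?n - 1)) * (-1) ^ (j * (?n - 1 - 1)) = (-1) ^ j"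
      unfolding power_add[symmetric] by (intro sign_eqI) (auto simp: k)
    ultimately show ?thesis by (simp add: D merge_first_def)
  qed
  then have 1: "linear_bd f L =
      (\<Sum>j<?n - 1. smul ((-1) ^ (j * (?n - 1))) (f (merge_first (rotate j L))))"
    unfolding linear_bd_sum by (intro sum.cong) auto
  obtain v M u where vu: "L = v # M @ [u]"
    using len by (cases L; cases "tl L" rule: rev_cases) auto
  have "rotate (Suc (length M)) L = [u] @ v # M"
    using rotate_append[of "v # M" "[u]"] by (simp add: vu)
  then have r: "rotate (?n - 1) L = u # v # M" by (simp add: vu)
  have "wrap L = M @ [u @ v]" by (simp add: vu wrap_def append_last_def)
  \<comment> \<open>The last gap, j = n - 1, is the one closed by \<open>wrap\<close>, up to a
    rotation by one place.\<close>
  then have w: "wrap L = rotate 1 (merge_first (rotate (?n - 1) L))"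
    unfolding r by (simp add: merge_first_def)
  have "f (wrap L) = smul ((-1) ^ (1 * (?n - 1 - 1))) (f (merge_first (rotate (?n - 1) L)))"
    unfolding w using rot[of "merge_first (rotate (?n - 1) L)" 1] L
    unfolding r by (auto simp: merge_first_def vu)
  moreover have "- ((-1 :: 'k) ^ (1 * (?n - 1 - 1))) = (-1) ^ ((?n - 1) * (?n - 1))"
    by (simp add: k minus_one_power_iff)
  ultimately have "- f (wrap L) =
      smul ((-1) ^ ((?n - 1) * (?n - 1))) (f (merge_first (rotate (?n - 1) L)))"
    by (metis free.scale_minus_left)
  moreover have "{..<?n} = insert (?n - 1) {..<?n - 1}" using len by auto
  ultimately show ?thesis using 1 by (simp add: cyclic_bd_def)
qed

section \<open>Cells of the Koszul complex\<close>

abbreviation path_word :: "graph \<Rightarrow> nat list \<Rightarrow> bool"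
  where "path_word \<Gamma> \<equiv> successively (\<lambda>u v. (u, v) \<in> edges \<Gamma>)"

lemma tube_path_word:
  assumes "simple_graph \<Gamma>" "l \<noteq> []" "set l \<subseteq> verts \<Gamma>" "path_word \<Gamma> l"
  shows "tube \<Gamma> (set l)"
  using assms(2-)
proof (induction l rule: induct_list012)
  case (2 x)
  then show ?case by (simp add: tube_singleton)
next
  case (3 x y l)
  have sym: "sym (edges \<Gamma>)" using assms(1) by (simp add: simple_graph_def)
  have e: "(x, y) \<in> edges \<Gamma>" "(y, x) \<in> edges \<Gamma>" using 3 sym by (auto dest: symD)
  have t: "tube \<Gamma> (set (y # l))" using 3 by simp
  show ?case
  proof (rule tubeI_cut[OF sym])
    fix Y assume Y: "Y \<noteq> {}" "Y \<subset> set (x # y # l)"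
    consider "y \<in> Y" "x \<notin> Y" | "Y \<inter> set (y # l) = {}" "Y = {x}"
      | "Y \<inter> set (y # l) \<noteq> {}" "Y \<inter> set (y # l) \<subset> set (y # l)"
      using Y by auto
    then show "\<exists>u\<in>Y. \<exists>v\<in>set (x # y # l) - Y. (u, v) \<in> edges \<Gamma>"
    proof cases
      case 1
      then show ?thesis using e by (intro bexI[of _ y] bexI[of _ x]) auto
    next
      case 2
      then show ?thesis using e by (intro bexI[of _ x] bexI[of _ y]) auto
    next
      case 3
      then obtain u v where "u \<in> Y \<inter> set (y # l)" "v \<in> set (y # l) - Y \<inter> set (y # l)" "(u, v) \<in> edges \<Gamma>"
        using tube_cutD[OF sym t] by metis
      then show ?thesis by (intro bexI[of _ u] bexI[of _ v]) auto
    qed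
  qed (use 3 in auto)
qed simp

lemma path_word_restr:
  "set w \<subseteq> U \<Longrightarrow> path_word (restr \<Gamma> U) w \<longleftrightarrow> path_word \<Gamma> w"
  by (induction w rule: induct_list012) (auto simp: restr_def)

lemma (in graph_partition) Min_Union_blocks_in:
  assumes "X \<subseteq> Min ` I" "X \<noteq> {}"
  shows "Min (\<Union>(blocks_in I X)) = Min X"
proof (rule Min_eqI)
  have fin: "finite X" using assms(1) finite_blocks finite_subset by blast
  show "finite (\<Union>(blocks_in I X))"
    using finite_blocks block_finite by (auto simp: blocks_in_def)
  have "Min X \<in> X" using fin assms(2) by (rule Min_in)
  then obtain A where A: "A \<in> I" "Min A = Min X" "Min A \<in> X" using assms(1) by force
  then show "Min X \<in> \<Union>(blocks_in I X)"
    using Min_in_block[OF A(1)] by (auto simp: blocks_in_def)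
  fix y assume "y \<in> \<Union>(blocks_in I X)"
  then obtain B where B: "B \<in> I" "Min B \<in> X" "y \<in> B" by (auto simp: blocks_in_def)
  have "Min X \<le> Min B" using fin B by simp
  also have "Min B \<le> y" using block_finite B by simp
  finally show "Min X \<le> y" .
qed

lemma (in graph_partition) graph_partition_merge_blocks:
  assumes "tube (contract \<Gamma> I) X"
  shows "graph_partition \<Gamma> (merge_blocks I X)"
proof
  have X: "X \<subseteq> Min ` I" using tube_subset[OF assms] by simp
  have t: "tube \<Gamma> (\<Union>(blocks_in I X))" using assms tube_contract_iff[OF X] by simp
  have "partition_on (verts \<Gamma>) (merge_blocks I X)"
  proof (rule partition_onI)
    show "\<Union>(merge_blocks I X) = verts \<Gamma>"
      using Union_blocks by (auto simp: merge_blocks_def blocks_in_def)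
    show "{} \<notin> merge_blocks I X"
      using block_nonempty tube_nonempty[OF t] by (auto simp: merge_blocks_def)
    show "disjnt p q" if "p \<in> merge_blocks I X" "q \<in> merge_blocks I X" "p \<noteq> q" for p q
      using that blocks_eq unfolding merge_blocks_def blocks_in_def disjnt_def by blast
  qed
  then show "tube_partition \<Gamma> (merge_blocks I X)"
    using t block_tube by (auto simp: tube_partition_def merge_blocks_def)
qed (rule simple)

text \<open>The minimum of a union of blocks is the minimum of their minima, so both sides give the
  merged block the same name; therefore an equality of graphs and not just an isomorphism.\<close>

lemma (in graph_partition) contract_contract:
  assumes tube: "tube (contract \<Gamma> I) X"
  shows "contract_tube (contract \<Gamma> I) X = contract \<Gamma> (merge_blocks I X)"
proof -
  let ?\<Gamma>' = "contract \<Gamma> I" let ?B = "blocks_in I X" let ?J = "merge_blocks I X"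
  have X: "X \<subseteq> Min ` I" "X \<noteq> {}" using tube_subset[OF tube] tube_nonempty[OF tube] by auto
  interpret J: graph_partition \<Gamma> ?J by (rule graph_partition_merge_blocks[OF tube])
  have m: "Min (\<Union>?B) = Min X" by (rule Min_Union_blocks_in[OF X])
  have U: "\<Union>?B \<in> ?J" by (simp add: merge_blocks_def)
  have MinB: "Min ` ?B = X" using X by (auto simp: blocks_in_def)
  have out: "Min ` (I - ?B) = Min ` I - X" by (auto simp: blocks_in_def)
  have V: "verts (contract_tube ?\<Gamma>' X) = insert (Min X) (Min ` I - X)"
    by (simp add: verts_contract_tube)
  have V': "verts (contract \<Gamma> ?J) = insert (Min X) (Min ` I - X)"
    unfolding J.verts_contract using m out by (simp add: merge_blocks_def)
  have s: "simple_graph (contract_tube ?\<Gamma>' X)" by (rule simple_contract_tube[OF simple_contract tube])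
  have s': "simple_graph (contract \<Gamma> ?J)" by (rule J.simple_contract)
  have edge: "(x, y) \<in> edges (contract_tube ?\<Gamma>' X) \<longleftrightarrow> (x, y) \<in> edges (contract \<Gamma> ?J)"
    if xy: "x \<in> insert (Min X) (Min ` I - X)" "y \<in> insert (Min X) (Min ` I - X)" "x \<noteq> y" for x y
  proof -
    have blk: "\<exists>A. A \<in> I \<and> A \<in> ?J \<and> A \<notin> ?B \<and> x = Min A" if "x \<in> Min ` I - X" for x
      using that by (auto simp: merge_blocks_def blocks_in_def)
    consider "x \<in> Min ` I - X" "y \<in> Min ` I - X" | "x \<in> Min ` I - X" "y = Min X"
      | "x = Min X" "y \<in> Min ` I - X" using xy by blast
    then show ?thesis
    proof cases
      case 1
      obtain A B where "A \<in> I" "A \<in> ?J" "x = Min A" "B \<in> I" "B \<in> ?J" "y = Min B"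
        using blk[OF 1(1)] blk[OF 1(2)] by blast
      then show ?thesis
        using edges_contract_tube_iff(3)[OF simple_contract tube, of x y] 1 xy(3)
          edges_contract_iff[of A B] J.edges_contract_iff[of A B] by auto
    next
      case 2
      obtain A where A: "A \<in> I" "A \<in> ?J" "x = Min A" "A \<notin> ?B" using blk[OF 2(1)] by blast
      have "(x, y) \<in> edges (contract_tube ?\<Gamma>' X) \<longleftrightarrow> (\<exists>v\<in>X. (x, v) \<in> edges ?\<Gamma>')"
        using edges_contract_tube_iff(1)[OF simple_contract tube, of x] 2 by simp
      also have "\<dots> \<longleftrightarrow> (\<exists>B\<in>?B. (Min A, Min B) \<in> edges ?\<Gamma>')"
        unfolding A(3) by (subst MinB[symmetric]) blast
      also have "\<dots> \<longleftrightarrow> (\<exists>B\<in>?B. \<exists>u\<in>A. \<exists>v\<in>B. (u, v) \<in> edges \<Gamma>)"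
        using A edges_contract_iff by (metis (no_types, lifting) blocks_in_def mem_Collect_eq)
      also have "\<dots> \<longleftrightarrow> (\<exists>u\<in>A. \<exists>v\<in>\<Union>?B. (u, v) \<in> edges \<Gamma>)" by blast
      also have "\<dots> \<longleftrightarrow> (Min A, Min (\<Union>?B)) \<in> edges (contract \<Gamma> ?J)"
        using J.edges_contract_iff[OF A(2) U] xy(3) A(3) 2 m by auto
      finally show ?thesis using m A(3) 2 by simp
    next
      case 3
      obtain A where A: "A \<in> I" "A \<in> ?J" "y = Min A" "A \<notin> ?B" using blk[OF 3(2)] by blast
      have "(x, y) \<in> edges (contract_tube ?\<Gamma>' X) \<longleftrightarrow> (\<exists>v\<in>X. (v, y) \<in> edges ?\<Gamma>')"
        using edges_contract_tube_iff(2)[OF simple_contract tube, of y] 3 by simp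
      also have "\<dots> \<longleftrightarrow> (\<exists>B\<in>?B. (Min B, Min A) \<in> edges ?\<Gamma>')"
        unfolding A(3) by (subst MinB[symmetric]) blast
      also have "\<dots> \<longleftrightarrow> (\<exists>B\<in>?B. \<exists>u\<in>B. \<exists>v\<in>A. (u, v) \<in> edges \<Gamma>)"
        using A edges_contract_iff by (metis (no_types, lifting) blocks_in_def mem_Collect_eq)
      also have "\<dots> \<longleftrightarrow> (\<exists>u\<in>\<Union>?B. \<exists>v\<in>A. (u, v) \<in> edges \<Gamma>)" by blast
      also have "\<dots> \<longleftrightarrow> (Min (\<Union>?B), Min A) \<in> edges (contract \<Gamma> ?J)"
        using J.edges_contract_iff[OF U A(2)] xy(3) A(3) 3 m by auto
      finally show ?thesis using m A(3) 3 by simp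
    qed
  qed
  have "edges (contract_tube ?\<Gamma>' X) = edges (contract \<Gamma> ?J)"
  proof (rule set_eqI, clarify)
    fix x y
    show "(x, y) \<in> edges (contract_tube ?\<Gamma>' X) \<longleftrightarrow> (x, y) \<in> edges (contract \<Gamma> ?J)"
    proof (cases "x \<noteq> y \<and> x \<in> insert (Min X) (Min ` I - X) \<and> y \<in> insert (Min X) (Min ` I - X)")
      case True
      then show ?thesis using edge by blast
    next
      case False
      then show ?thesis
        using s s' V V' unfolding simple_graph_def irrefl_def by (metis mem_Sigma_iff subsetD)
    qed
  qed
  then show ?thesis using V V' by (simp add: graph.expand)
qed

text \<open>No adjacency is imposed, so cells are closed under merging, wrapping and rotation, and
  \<open>cyclic_bd\<close> may run over all gaps.\<close>

definition cell :: "graph \<Rightarrow> nat list list \<Rightarrow> bool"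
  where "cell \<Gamma> L \<longleftrightarrow> [] \<notin> set L \<and> distinct (concat L) \<and> set (concat L) = verts \<Gamma>"

abbreviation cell_blocks :: "nat list list \<Rightarrow> nat set set"
  where "cell_blocks L \<equiv> set ` set L"

abbreviation cell_word :: "nat list list \<Rightarrow> nat list"
  where "cell_word L \<equiv> map (\<lambda>l. Min (set l)) L"

text \<open>Restricted to the blocks in order to match the extensional functions in
  \<open>koszul_complex\<close>.\<close>

definition cell_paths :: "nat list list \<Rightarrow> nat set \<Rightarrow> nat list"
  where "cell_paths L = restrict (\<lambda>A. THE l. l \<in> set L \<and> set l = A) (cell_blocks L)"

text \<open>A list of paths stands for the cyclic order on its blocks together with the paths themselves;
  lists that contain a word which is not a path are sent to zero, like in \<open>Ham\<close>.\<close>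

definition cell_vec :: "graph \<Rightarrow> nat list list \<Rightarrow> koszul_basis \<Rightarrow>\<^sub>0 'k::field"
  where "cell_vec \<Gamma> L = (if \<forall>l\<in>set L. path_word \<Gamma> l
    then lin_ext (\<lambda>t. basis_vec (cell_blocks L, t, cell_paths L))
      (cyclic_sum (contract \<Gamma> (cell_blocks L)) (cell_word L))
    else 0)"

lemma cell_rotate: "cell \<Gamma> (rotate k L) \<longleftrightarrow> cell \<Gamma> L"
proof -
  obtain p q where pq: "L = p @ q" "rotate k L = q @ p"
    using rotate_drop_take[of k L] append_take_drop_id by metis
  show ?thesis unfolding pq(2) cell_def by (auto simp: pq(1) Int_commute)
qed

lemma cell_words_eq:
  assumes "cell \<Gamma> L" "l \<in> set L" "l' \<in> set L" "x \<in> set l" "x \<in> set l'"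
  shows "l = l'"
  using assms unfolding cell_def distinct_concat_iff by blast

lemma cell_word_nonempty: "cell \<Gamma> L \<Longrightarrow> l \<in> set L \<Longrightarrow> set l \<noteq> {}"
  by (auto simp: cell_def)

lemma cell_set_inj:
  assumes "cell \<Gamma> L" "l \<in> set L" "l' \<in> set L" "set l = set l'"
  shows "l = l'"
proof -
  obtain x where "x \<in> set l" using cell_word_nonempty[OF assms(1,2)] by (meson equals0I)
  then show ?thesis using cell_words_eq[OF assms(1-3), of x] assms(4) by simp
qed

lemma cell_paths_set:
  assumes "cell \<Gamma> L" "l \<in> set L"
  shows "cell_paths L (set l) = l"
proof -
  have "(THE l'. l' \<in> set L \<and> set l' = set l) = l"
  proof (rule the_equality)
    fix l' assume "l' \<in> set L \<and> set l' = set l"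
    then show "l' = l" using cell_set_inj[OF assms(1) _ assms(2)] by blast
  qed (use assms in simp)
  then show ?thesis using assms(2) by (simp add: cell_paths_def)
qed

lemma graph_partition_cell:
  assumes \<Gamma>: "simple_graph \<Gamma>" and L: "cell \<Gamma> L" "\<forall>l\<in>set L. path_word \<Gamma> l"
  shows "graph_partition \<Gamma> (cell_blocks L)"
proof
  have "partition_on (verts \<Gamma>) (cell_blocks L)"
  proof (rule partition_onI)
    show "\<Union>(cell_blocks L) = verts \<Gamma>" using L by (simp add: cell_def)
    show "{} \<notin> cell_blocks L" using L(1) by (auto simp: cell_def)
    show "disjnt p q" if "p \<in> cell_blocks L" "q \<in> cell_blocks L" "p \<noteq> q" for p q
      using that cell_words_eq[OF L(1)] unfolding disjnt_def by blast
  qed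
  moreover have "tube \<Gamma> (set l)" if "l \<in> set L" for l
    using that L by (intro tube_path_word[OF \<Gamma>]) (auto simp: cell_def)
  ultimately show "tube_partition \<Gamma> (cell_blocks L)" by (auto simp: tube_partition_def)
qed fact

lemma distinct_cell: "cell \<Gamma> L \<Longrightarrow> distinct L"
  unfolding cell_def distinct_concat_iff by (metis removeAll_id)

lemma cell_Min_in: "cell \<Gamma> L \<Longrightarrow> l \<in> set L \<Longrightarrow> Min (set l) \<in> set l"
  by (metis List.finite_set Min_in cell_word_nonempty)

lemma cell_Min_inj: "cell \<Gamma> L \<Longrightarrow> l \<in> set L \<Longrightarrow> l' \<in> set L \<Longrightarrow> Min (set l) = Min (set l') \<Longrightarrow> l = l'"
  using cell_words_eq cell_Min_in by metis

lemma distinct_cell_word: "cell \<Gamma> L \<Longrightarrow> distinct (cell_word L)"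
  using distinct_cell cell_Min_inj by (auto simp: distinct_map inj_on_def)

lemma cell_word_orderings:
  assumes "cell \<Gamma> L"
  shows "cell_word L \<in> orderings (verts (contract \<Gamma> (cell_blocks L)))"
  using distinct_cell_word[OF assms] by (auto simp: orderings_def contract_def)

lemma card_cell_blocks:
  assumes "cell \<Gamma> L"
  shows "card (cell_blocks L) = length L"
proof -
  have "inj_on set (set L)"
    using cell_set_inj[OF assms] by (intro inj_onI)
  then show ?thesis using distinct_cell[OF assms] by (simp add: card_image distinct_card)
qed

lemma cell_vec_rotate:
  assumes "cell \<Gamma> L"
  shows "cell_vec \<Gamma> (rotate k L) = smul ((-1) ^ (k * (length L - 1))) (cell_vec \<Gamma> L :: _ \<Rightarrow>\<^sub>0 'k::field)"
proof (cases "L = []")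
  case True
  then show ?thesis by (simp add: cell_vec_def cyclic_sum_def lin_ext.zero)
next
  case False
  let ?w = "cell_word L" let ?\<Gamma>' = "contract \<Gamma> (cell_blocks L)"
  have d: "distinct ?w" "?w \<noteq> []" using distinct_cell_word[OF assms] False by auto
  have "cyclic_sum ?\<Gamma>' ?w = smul (rotation_sign ?w (rotate k ?w)) (cyclic_sum ?\<Gamma>' (rotate k ?w) :: _ \<Rightarrow>\<^sub>0 'k)"
    by (rule cyclic_sum_rotation[OF d rotate_in_rotations])
  then have "smul ((-1) ^ (k * (length L - 1))) (cyclic_sum ?\<Gamma>' ?w) =
      (cyclic_sum ?\<Gamma>' (rotate k ?w) :: _ \<Rightarrow>\<^sub>0 'k)"
    by (simp add: rotation_sign_rotate[OF d] flip: power_add)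
  then show ?thesis
    by (simp add: cell_vec_def cell_paths_def rotate_map lin_ext.scale[symmetric])
qed

section \<open>The Koszul differential of a cell\<close>

text \<open>The contribution of one tube as a linear function of the decomposed element, so that the
  decomposition formulas for tree sums can be inserted.\<close>

definition diff_term :: "graph \<Rightarrow> nat set set \<Rightarrow> (nat set \<Rightarrow> nat list) \<Rightarrow> nat set \<Rightarrow>
    (nat ptree \<times> nat ptree \<Rightarrow>\<^sub>0 'k::field) \<Rightarrow> (koszul_basis \<Rightarrow>\<^sub>0 'k)"
  where "diff_term \<Gamma> I p G =
    (let B = blocks_in I G; U = \<Union>B; J = merge_blocks I G
     in lin_ext (\<lambda>(t', s). smul ((-1) ^ inner t')
          (lin_ext (\<lambda>w. basis_vec (J, t', restrict (p(U := w)) J))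
            (ham_comp (restr \<Gamma> U) B (leaf_list s) p))))"

lemma koszul_diff_eq:
  "koszul_diff \<Gamma> (lin_ext (\<lambda>t. basis_vec (I, t, p)) z) =
    (\<Sum>G | tube (contract \<Gamma> I) G \<and> card G = 2. diff_term \<Gamma> I p G (lin_ext (decomp G) z))"
proof -
  have "koszul_diff \<Gamma> (lin_ext (\<lambda>t. basis_vec (I, t, p)) z) =
      lin_ext (\<lambda>t. \<Sum>G | tube (contract \<Gamma> I) G \<and> card G = 2. diff_term \<Gamma> I p G (decomp G t)) z"
    unfolding koszul_diff_def lin_ext_lin_ext
    by (simp add: koszul_diff_basis_def diff_term_def Let_def)
  then show ?thesis
    unfolding lin_ext_sum_fun by (simp add: diff_term_def Let_def lin_ext_lin_ext)
qed

lemma diff_term_scale: "diff_term \<Gamma> I p G (smul c x) = smul c (diff_term \<Gamma> I p G x)"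
  and diff_term_diff: "diff_term \<Gamma> I p G (x - y) = diff_term \<Gamma> I p G x - diff_term \<Gamma> I p G y"
  and diff_term_zero: "diff_term \<Gamma> I p G 0 = 0"
  by (simp_all add: diff_term_def Let_def lin_ext.scale lin_ext.diff lin_ext.zero)

lemma lin_ext_tensor: "lin_ext F (tensor x y) = lin_ext (\<lambda>a. lin_ext (\<lambda>b. F (a, b)) y) x"
  by (simp add: tensor_def lin_ext_lin_ext)

lemma cell_merge:
  assumes "cell \<Gamma> (a # b # R)"
  shows "cell \<Gamma> ((a @ b) # R)"
  using assms by (auto simp: cell_def)

lemma cell_merge_blocks:
  assumes \<Gamma>: "simple_graph \<Gamma>" and L: "cell \<Gamma> (a # b # R)" "\<forall>l\<in>set (a # b # R). path_word \<Gamma> l"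
  defines "G \<equiv> {Min (set a), Min (set b)}" and "I \<equiv> cell_blocks (a # b # R)"
  shows "blocks_in I G = {set a, set b}" "merge_blocks I G = cell_blocks ((a @ b) # R)"
    "Min G = Min (set (a @ b))" "Min (set a) \<noteq> Min (set b)"
proof -
  interpret graph_partition \<Gamma> I unfolding I_def by (rule graph_partition_cell[OF \<Gamma> L])
  have ab: "set a \<in> I" "set b \<in> I" by (auto simp: I_def)
  show B: "blocks_in I G = {set a, set b}"
    using ab Min_inj by (auto simp: blocks_in_def G_def)
  have ne: "set a \<noteq> {}" "set b \<noteq> {}" using cell_word_nonempty[OF L(1)] by auto
  have d: "set a \<inter> set b = {}" "\<forall>l\<in>set R. set l \<inter> set a = {} \<and> set l \<inter> set b = {}"
    using L(1) by (auto simp: cell_def)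
  have "set a \<notin> cell_blocks R" "set b \<notin> cell_blocks R"
    using d(2) ne by (metis Int_absorb image_iff)+
  then have "I - {set a, set b} = cell_blocks R" by (auto simp: I_def)
  then show "merge_blocks I G = cell_blocks ((a @ b) # R)"
    unfolding merge_blocks_def B by simp
  have "Min (\<Union>(blocks_in I G)) = Min G"
    by (rule Min_Union_blocks_in) (use ab in \<open>auto simp: G_def\<close>)
  then show "Min G = Min (set (a @ b))" unfolding B by simp
  show "Min (set a) \<noteq> Min (set b)"
    using Min_inj[OF ab] d(1) ne by auto
qed

lemma ham_comp_cell:
  assumes L: "cell \<Gamma> (a # b # R)" "\<forall>l\<in>set (a # b # R). path_word \<Gamma> l"
  shows "ham_comp (restr \<Gamma> (set (a @ b))) {set a, set b} [Min (set a), Min (set b)] (cell_paths (a # b # R)) =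
    (if path_word \<Gamma> (a @ b) then basis_vec (a @ b) else 0)"
proof -
  have inj: "Min (set a) = Min (set b) \<longleftrightarrow> a = b" using cell_Min_inj[OF L(1), of a b] by auto
  have "block_of {set a, set b} (Min (set a)) = set a" "block_of {set a, set b} (Min (set b)) = set b"
    unfolding block_of_def using inj by (auto intro!: the_equality)
  then have "substitute {set a, set b} (cell_paths (a # b # R)) [Min (set a), Min (set b)] = a @ b"
    using cell_paths_set[OF L(1), of a] cell_paths_set[OF L(1), of b] by (simp add: substitute_def)
  moreover have "a @ b \<in> ham_paths (restr \<Gamma> (set (a @ b))) \<longleftrightarrow> path_word \<Gamma> (a @ b)"
    using L(1) path_word_restr[of "a @ b" "set (a @ b)" \<Gamma>]
    by (auto simp: ham_paths_def cell_def)
  ultimately show ?thesis by (simp add: ham_comp_def)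
qed

lemma cell_paths_merge:
  assumes "cell \<Gamma> (a # b # R)"
  shows "restrict ((cell_paths (a # b # R))(set (a @ b) := a @ b)) (cell_blocks ((a @ b) # R)) =
    cell_paths ((a @ b) # R)" (is "?L = ?R")
proof
  fix A
  have L': "cell \<Gamma> ((a @ b) # R)" by (rule cell_merge[OF assms])
  show "?L A = ?R A"
  proof (cases "A \<in> cell_blocks ((a @ b) # R)")
    case True
    then obtain l where l: "l \<in> set ((a @ b) # R)" "A = set l" by blast
    have R: "?R A = l" unfolding l(2) by (rule cell_paths_set[OF L' l(1)])
    show ?thesis
    proof (cases "l = a @ b")
      case True
      then show ?thesis using R l by simp
    next
      case False
      then have "set l \<noteq> set (a @ b)"
        using cell_set_inj[OF L' l(1), of "a @ b"] by (metis list.set_intros(1))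
      moreover have "cell_paths (a # b # R) (set l) = l"
        using False l by (intro cell_paths_set[OF assms]) auto
      ultimately show ?thesis using R l True by simp
    qed
  next
    case False
    then show ?thesis by (simp add: cell_paths_def)
  qed
qed

text \<open>The trees on the contraction have \<open>length R\<close> inner vertices; this gives the
  sign of moving the inverse shift past them. If \<open>a @ b\<close> is no path, the composition in
  \<open>Ham\<close> and the merged cell vanish together.\<close>

lemma diff_term_pair:
  assumes \<Gamma>: "simple_graph \<Gamma>" and L: "cell \<Gamma> (a # b # R)" "\<forall>l\<in>set (a # b # R). path_word \<Gamma> l"
  defines "G \<equiv> {Min (set a), Min (set b)}" and "I \<equiv> cell_blocks (a # b # R)"
  assumes tube: "tube (contract \<Gamma> I) G"
  shows "diff_term \<Gamma> I (cell_paths (a # b # R)) G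
      (tensor (cyclic_sum (contract_tube (contract \<Gamma> I) G) (Min G # cell_word R))
        (linear_sum (restr (contract \<Gamma> I) G) [Min (set a), Min (set b)])) =
    smul ((-1) ^ length R) (cell_vec \<Gamma> ((a @ b) # R) :: _ \<Rightarrow>\<^sub>0 'k::field)"
proof -
  interpret graph_partition \<Gamma> I unfolding I_def by (rule graph_partition_cell[OF \<Gamma> L])
  note mb = cell_merge_blocks[OF \<Gamma> L, folded G_def I_def]
  let ?L' = "(a @ b) # R" and ?p = "cell_paths (a # b # R)"
  let ?s = "Br (Lf (Min (set a))) (Lf (Min (set b))) :: nat ptree"
  let ?z = "cyclic_sum (contract \<Gamma> (cell_blocks ?L')) (cell_word ?L') :: _ \<Rightarrow>\<^sub>0 'k"
  have L': "cell \<Gamma> ?L'" by (rule cell_merge[OF L(1)])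
  have lin: "linear_sum (restr (contract \<Gamma> I) G) [Min (set a), Min (set b)] = basis_vec ?s"
    by (rule linear_sum_pair[OF connected_graph_restr[OF simple_contract tube]])
      (simp_all add: mb G_def)
  have z: "cyclic_sum (contract_tube (contract \<Gamma> I) G) (Min G # cell_word R) = ?z"
    unfolding contract_contract[OF tube] mb(2,3) by simp
  have inner: "inner t = length R" if "t \<in> Poly_Mapping.keys ?z" for t
    using keys_cyclic_sum[OF that] rotations_length[of "leaf_list t" "cell_word ?L'"]
      length_leaf_list[of t] by simp
  have U: "\<Union>{set a, set b} = set (a @ b)" by auto
  have "diff_term \<Gamma> I ?p G (tensor ?z (basis_vec ?s)) =
      lin_ext (\<lambda>t. smul ((-1) ^ inner t) (lin_ext (\<lambda>w. basis_vec (cell_blocks ?L', t,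
        restrict (?p(set (a @ b) := w)) (cell_blocks ?L')))
        (if path_word \<Gamma> (a @ b) then basis_vec (a @ b) else 0))) ?z"
    unfolding diff_term_def Let_def lin_ext_tensor mb(1,2) U
    by (simp add: ham_comp_cell[OF L] del: set_append)
  also have "\<dots> = lin_ext (\<lambda>t. smul ((-1) ^ length R) (if path_word \<Gamma> (a @ b)
      then basis_vec (cell_blocks ?L', t, cell_paths ?L') else 0)) ?z"
  proof (rule lin_ext_cong)
    fix t assume "t \<in> Poly_Mapping.keys ?z"
    then show "smul ((-1) ^ inner t) (lin_ext (\<lambda>w. basis_vec (cell_blocks ?L', t,
        restrict (?p(set (a @ b) := w)) (cell_blocks ?L')))
        (if path_word \<Gamma> (a @ b) then basis_vec (a @ b) else 0)) =
        smul ((-1) ^ length R) (if path_word \<Gamma> (a @ b)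
        then basis_vec (cell_blocks ?L', t, cell_paths ?L') else (0 :: _ \<Rightarrow>\<^sub>0 'k))"
      unfolding cell_paths_merge[OF L(1), symmetric] using inner by (simp add: lin_ext.zero)
  qed
  also have "\<dots> = smul ((-1) ^ length R) (cell_vec \<Gamma> ?L')"
    using L(2) by (auto simp: cell_vec_def lin_ext_smul_fun)
  finally show ?thesis unfolding lin z .
qed

lemma finite_pair_tubes:
  assumes "simple_graph \<Gamma>"
  shows "finite {G. tube \<Gamma> G \<and> card G = 2}"
proof (rule finite_subset)
  show "{G. tube \<Gamma> G \<and> card G = 2} \<subseteq> Pow (verts \<Gamma>)" using tube_subset by blast
  show "finite (Pow (verts \<Gamma>))" using assms by (simp add: simple_graph_def)
qed

text \<open>Blocks that form no tube have no edge between them, in particular none from the last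
  letter of a to the first letter of b. So the sum over gaps has no terms beyond those that come
  from tubes.\<close>

lemma merge_first_zero:
  assumes \<Gamma>: "simple_graph \<Gamma>" and L: "cell \<Gamma> (a # b # R)" "\<forall>l\<in>set (a # b # R). path_word \<Gamma> l"
    and nt: "\<not> tube (contract \<Gamma> (cell_blocks (a # b # R))) {Min (set a), Min (set b)}"
  shows "cell_vec \<Gamma> ((a @ b) # R) = (0 :: _ \<Rightarrow>\<^sub>0 'k::field)"
proof -
  let ?I = "cell_blocks (a # b # R)"
  interpret graph_partition \<Gamma> ?I by (rule graph_partition_cell[OF \<Gamma> L])
  have ne: "a \<noteq> []" "b \<noteq> []" using L(1) by (auto simp: cell_def)
  have "Min (set a) \<noteq> Min (set b)" by (rule cell_merge_blocks(4)[OF \<Gamma> L])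
  then have "(Min (set a), Min (set b)) \<notin> edges (contract \<Gamma> ?I)"
    using nt tube_pair_iff[OF simple_contract] by blast
  then have "\<not> (\<exists>u\<in>set a. \<exists>v\<in>set b. (u, v) \<in> edges \<Gamma>)"
    using edges_contract_iff[of "set a" "set b"] \<open>Min (set a) \<noteq> Min (set b)\<close> by auto
  then have "(last a, hd b) \<notin> edges \<Gamma>" using ne last_in_set hd_in_set by blast
  then have "\<not> path_word \<Gamma> (a @ b)" using ne by (simp add: successively_append_iff)
  then show ?thesis by (simp add: cell_vec_def)
qed

text \<open>With two letters both gaps have the same pair of neighbours, which is why the
  differential of a cell with two words is computed separately.\<close>

lemma rotate_pair_inj:
  assumes d: "distinct w" and n: "length w \<ge> 3" and ij: "i < length w" "j < length w"
    and eq: "{w ! i, w ! (Suc i mod length w)} = {w ! j, w ! (Suc j mod length w)}"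
  shows "i = j"
proof (rule ccontr)
  assume "i \<noteq> j"
  let ?n = "length w"
  have lt: "Suc k mod ?n < ?n" for k using n by (intro mod_less_divisor) linarith
  have "w ! i = w ! (Suc j mod ?n)" "w ! (Suc i mod ?n) = w ! j"
    using eq \<open>i \<noteq> j\<close> d ij by (auto simp: doubleton_eq_iff nth_eq_iff_index_eq)
  then have "i = Suc j mod ?n" "Suc i mod ?n = j"
    using d ij lt by (simp_all add: nth_eq_iff_index_eq)
  then show False using n ij by (simp add: mod_Suc split: if_splits)
qed

text \<open>The sum over two-vertex tubes is matched with the sum over gaps. A tube that is no pair
  of cyclic neighbours contributes 0 by \<open>decomp_cyclic_sum_zero\<close>, a gap whose
  neighbours form no tube contributes 0 by \<open>merge_first_zero\<close>, and the remaining terms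
  agree.\<close>

lemma koszul_diff_path_cell:
  assumes conn: "connected_graph \<Gamma>" and L: "cell \<Gamma> L" "\<forall>l\<in>set L. path_word \<Gamma> l" and len: "length L \<ge> 2"
  shows "koszul_diff \<Gamma> (cell_vec \<Gamma> L) = (cyclic_bd (cell_vec \<Gamma>) L :: _ \<Rightarrow>\<^sub>0 'k::field)"
proof -
  let ?I = "cell_blocks L" let ?\<Gamma>' = "contract \<Gamma> ?I" let ?w = "cell_word L" let ?n = "length L"
  let ?p = "cell_paths L"
  let ?z = "cyclic_sum ?\<Gamma>' ?w :: _ \<Rightarrow>\<^sub>0 'k"
  have \<Gamma>: "simple_graph \<Gamma>" using conn by (simp add: connected_graph_def)
  interpret graph_partition \<Gamma> ?I by (rule graph_partition_cell[OF \<Gamma> L])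
  have conn': "connected_graph ?\<Gamma>'" by (rule connected_contract[OF conn])
  have d: "distinct ?w" by (rule distinct_cell_word[OF L(1)])
  have eq: "koszul_diff \<Gamma> (cell_vec \<Gamma> L) =
      (\<Sum>G | tube ?\<Gamma>' G \<and> card G = 2. diff_term \<Gamma> ?I ?p G (lin_ext (decomp G) ?z))"
    using L by (simp add: cell_vec_def koszul_diff_eq)
  show ?thesis
  proof (cases "?n = 2")
    case True
    \<comment> \<open>One tube but two gaps: the tube is the whole contracted graph, and both linear
      orders of the pair survive in its decomposition.\<close>
    then obtain a b where ab: "L = [a, b]" by (auto simp: numeral_2_eq_2 length_Suc_conv)
    let ?ma = "Min (set a)" and ?mb = "Min (set b)"
    have L2: "cell \<Gamma> [b, a]" "\<forall>l\<in>set [b, a]. path_word \<Gamma> l"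
      using L cell_rotate[of \<Gamma> 1 L] by (auto simp: ab)
    have sw: "cell_blocks [b, a] = ?I" "cell_paths [b, a] = ?p"
      by (simp_all add: ab cell_paths_def insert_commute disj_commute)
    have mm: "?ma \<noteq> ?mb" using d by (simp add: ab)
    have V: "verts ?\<Gamma>' = {?ma, ?mb}" by (simp add: ab contract_def)
    have tube: "tube ?\<Gamma>' {?ma, ?mb}" using conn' V by (simp add: connected_graph_def)
    have "{G. tube ?\<Gamma>' G \<and> card G = 2} = {{?ma, ?mb}}"
    proof (intro set_eqI iffI)
      fix G assume G: "G \<in> {G. tube ?\<Gamma>' G \<and> card G = 2}"
      then have "G \<subseteq> {?ma, ?mb}" using tube_subset V by blast
      then show "G \<in> {{?ma, ?mb}}" using G mm by (simp add: card_subset_eq)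
    qed (use tube mm in simp)
    then have "koszul_diff \<Gamma> (cell_vec \<Gamma> L) = diff_term \<Gamma> ?I ?p {?ma, ?mb} (lin_ext (decomp {?ma, ?mb}) ?z)"
      unfolding eq by simp
    also have "?z = linear_sum ?\<Gamma>' [?ma, ?mb] - linear_sum ?\<Gamma>' [?mb, ?ma]"
      by (simp add: ab cyclic_sum_pair)
    also have "lin_ext (decomp {?ma, ?mb}) (linear_sum ?\<Gamma>' [?ma, ?mb] - linear_sum ?\<Gamma>' [?mb, ?ma]) =
        tensor (cyclic_sum (contract_tube ?\<Gamma>' {?ma, ?mb}) [Min {?ma, ?mb}])
          (linear_sum (restr ?\<Gamma>' {?ma, ?mb}) [?ma, ?mb]) -
        tensor (cyclic_sum (contract_tube ?\<Gamma>' {?ma, ?mb}) [Min {?ma, ?mb}])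
          (linear_sum (restr ?\<Gamma>' {?ma, ?mb}) [?mb, ?ma] :: _ \<Rightarrow>\<^sub>0 'k)"
      using decomp_linear_sum[OF simple_contract tube, of "[]" "[?ma, ?mb]" "[]", where 'k = 'k]
        decomp_linear_sum[OF simple_contract tube, of "[]" "[?mb, ?ma]" "[]", where 'k = 'k] mm
      by (simp add: lin_ext.diff cyclic_sum_singleton insert_commute del: Min_insert)
    also have "diff_term \<Gamma> ?I ?p {?ma, ?mb} \<dots> =
        cell_vec \<Gamma> [a @ b] - cell_vec \<Gamma> [b @ a]"
    proof -
      have "diff_term \<Gamma> ?I ?p {?ma, ?mb}
          (tensor (cyclic_sum (contract_tube ?\<Gamma>' {?ma, ?mb}) [Min {?ma, ?mb}])
          (linear_sum (restr ?\<Gamma>' {?ma, ?mb}) [?ma, ?mb])) = (cell_vec \<Gamma> [a @ b] :: _ \<Rightarrow>\<^sub>0 'k)"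
        using diff_term_pair[OF \<Gamma> L(1)[unfolded ab] L(2)[unfolded ab], where 'k = 'k] tube
        unfolding ab by (simp del: Min_insert)
      moreover have "diff_term \<Gamma> ?I ?p {?ma, ?mb}
          (tensor (cyclic_sum (contract_tube ?\<Gamma>' {?ma, ?mb}) [Min {?ma, ?mb}])
          (linear_sum (restr ?\<Gamma>' {?ma, ?mb}) [?mb, ?ma])) = (cell_vec \<Gamma> [b @ a] :: _ \<Rightarrow>\<^sub>0 'k)"
        using diff_term_pair[OF \<Gamma> L2, where 'k = 'k] tube
        unfolding sw insert_commute[of ?mb ?ma] by (simp del: Min_insert)
      ultimately show ?thesis by (simp only: diff_term_diff)
    qed
    also have "\<dots> = cyclic_bd (cell_vec \<Gamma>) L"
      by (simp add: ab cyclic_bd_def wrap_def append_last_def)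
    finally show ?thesis .
  next
    case False
    then have n3: "?n \<ge> 3" using len by simp
    then have L0: "L \<noteq> []" by auto
    \<comment> \<open>The neighbours of gap j in the cyclic word.\<close>
    define \<gamma> where "\<gamma> j = {?w ! j, ?w ! (Suc j mod ?n)}" for j
    let ?S = "{G. tube ?\<Gamma>' G \<and> card G = 2}"
    let ?\<phi> = "\<lambda>G. diff_term \<Gamma> ?I ?p G (lin_ext (decomp G) ?z)"
    let ?c = "\<lambda>j. smul ((-1) ^ (j * (?n - 1))) (cell_vec \<Gamma> (merge_first (rotate j L))) :: _ \<Rightarrow>\<^sub>0 'k"
    have inj: "inj_on \<gamma> {..<?n}"
      using rotate_pair_inj[OF d] n3 by (intro inj_onI) (simp add: \<gamma>_def)
    have rot: "\<exists>a b R. rotate j L = a # b # R \<and> R \<noteq> [] \<and> \<gamma> j = {Min (set a), Min (set b)}"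
      if j: "j < ?n" for j
    proof -
      obtain a b R where abR: "rotate j L = a # b # R" "R \<noteq> []"
        using n3 length_rotate[of j L]
        by (cases "rotate j L"; cases "tl (rotate j L)"; cases "tl (tl (rotate j L))") auto
      have "a = L ! j" using nth_rotate[of 0 L j] abR j n3 by fastforce
      moreover have "b = L ! (Suc j mod ?n)"
        using nth_rotate[of 1 L j] abR j n3 by simp
      moreover have "Suc j mod ?n < ?n" using n3 by (intro mod_less_divisor) linarith
      ultimately show ?thesis using abR j by (auto simp: \<gamma>_def)
    qed
    have good: "?\<phi> (\<gamma> j) = ?c j" if j: "j < ?n" and t: "tube ?\<Gamma>' (\<gamma> j)" for j
    proof -
      obtain a b R where abR: "rotate j L = a # b # R" "R \<noteq> []" "\<gamma> j = {Min (set a), Min (set b)}"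
        using rot[OF j] by blast
      let ?L' = "a # b # R"
      have L': "cell \<Gamma> ?L'" "\<forall>l\<in>set ?L'. path_word \<Gamma> l"
        using L cell_rotate[of \<Gamma> j L] set_rotate[of j L] unfolding abR(1) by simp_all
      have "set ?L' = set L" using set_rotate[of j L] abR(1) by simp
      then have sw: "cell_blocks ?L' = ?I" "cell_paths ?L' = ?p"
        unfolding cell_paths_def by simp_all
      have w': "cell_word ?L' = rotate j ?w" unfolding abR(1)[symmetric] by (simp add: rotate_map)
      have w0: "?w \<noteq> []" using n3 by auto
      have z: "?z = smul ((-1) ^ (j * (?n - 1))) (cyclic_sum ?\<Gamma>' (cell_word ?L'))"
        using cyclic_sum_rotation[OF d w0 rotate_in_rotations, of ?\<Gamma>' j, where 'k = 'k]
          rotation_sign_rotate[OF d w0, of j, where 'k = 'k] unfolding w' by simp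
      let ?g = "[Min (set a), Min (set b)]"
      have cw: "cell_word ?L' = ?g @ cell_word R" by simp
      have dg: "distinct (?g @ cell_word R)" using distinct_cell_word[OF L'(1)] by simp
      have set_g: "set ?g = \<gamma> j" by (simp add: abR(3))
      have ln: "length (?g @ cell_word R) = ?n" "length R = ?n - 2"
        using arg_cong[OF abR(1), of length] by simp_all
      have r0: "cell_word R \<noteq> []" and lg: "length ?g + 1 = 3" using abR(2) by simp_all
      have dec: "lin_ext (decomp (\<gamma> j)) (cyclic_sum ?\<Gamma>' (cell_word ?L')) =
          smul ((-1) ^ (?n * 3)) (tensor (cyclic_sum (contract_tube ?\<Gamma>' (\<gamma> j)) (Min (\<gamma> j) # cell_word R))
            (linear_sum (restr ?\<Gamma>' (\<gamma> j)) ?g) :: _ \<Rightarrow>\<^sub>0 'k)"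
        unfolding cw using decomp_cyclic_sum[OF simple_contract t dg r0 set_g, where 'k = 'k]
        unfolding ln(1) lg .
      have dt: "diff_term \<Gamma> ?I ?p (\<gamma> j) (tensor (cyclic_sum (contract_tube ?\<Gamma>' (\<gamma> j))
          (Min (\<gamma> j) # cell_word R)) (linear_sum (restr ?\<Gamma>' (\<gamma> j)) ?g)) =
          smul ((-1) ^ length R) (cell_vec \<Gamma> ((a @ b) # R) :: _ \<Rightarrow>\<^sub>0 'k)"
        using diff_term_pair[OF \<Gamma> L', where 'k = 'k] t unfolding sw abR(3)[symmetric] by blast
      \<comment> \<open>The sign of cutting two letters off n and the sign of the inverse shift
        cancel; only the rotation sign is left.\<close>
      have "(-1 :: 'k) ^ (?n * 3) * (-1) ^ (?n - 2) = (-1) ^ 0"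
        unfolding power_add[symmetric] using n3 by (intro sign_eqI) auto
      then have "?\<phi> (\<gamma> j) = smul ((-1) ^ (j * (?n - 1))) (cell_vec \<Gamma> ((a @ b) # R))"
        unfolding z lin_ext.scale dec diff_term_scale dt ln(2) free.scale_scale by simp
      then show ?thesis by (simp add: abR(1) merge_first_def)
    qed
    have zero: "?\<phi> G = 0" if G: "G \<in> ?S - \<gamma> ` {..<?n}" for G
    proof -
      have "lin_ext (decomp G) ?z = 0"
      proof (rule decomp_cyclic_sum_zero[OF d])
        show "G \<noteq> set ?w"
        proof
          assume "G = set ?w"
          then have "card G = ?n" using d distinct_card[of ?w] by simp
          then show False using G n3 by simp
        qed
        fix g r assume gr: "g @ r \<in> rotations ?w" "set g = G" "r \<noteq> []"
        have "distinct (g @ r)" using rotations_distinct[OF gr(1)] d by simp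
        then have "length g = 2" using G gr(2) distinct_card[of g] by simp
        then obtain u v where uv: "g = [u, v]" by (auto simp: numeral_2_eq_2 length_Suc_conv)
        obtain k where k: "g @ r = rotate k ?w" using gr(1) by (auto simp: rotations_def)
        let ?j = "k mod ?n"
        have j: "?j < ?n" using n3 by (intro mod_less_divisor) linarith
        have kj: "u # v # r = rotate ?j ?w" using k rotate_conv_mod[of k ?w] by (simp add: uv)
        have "u = ?w ! ?j" using arg_cong[OF kj, of "\<lambda>x. x ! 0"] nth_rotate[of 0 ?w ?j] L0 j by simp
        moreover have "v = ?w ! (Suc ?j mod ?n)"
          using arg_cong[OF kj, of "\<lambda>x. x ! 1"] nth_rotate[of 1 ?w ?j] n3 by simp
        ultimately have "G = \<gamma> ?j" using gr(2) by (simp add: uv \<gamma>_def)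
        then show False using G j by blast
      qed
      then show ?thesis by (simp add: diff_term_zero)
    qed
    have zero': "?c j = 0" if j: "j < ?n" "\<gamma> j \<notin> ?S" for j
    proof -
      obtain a b R where abR: "rotate j L = a # b # R" "R \<noteq> []" "\<gamma> j = {Min (set a), Min (set b)}"
        using rot[OF j(1)] by blast
      let ?L' = "a # b # R"
      have L': "cell \<Gamma> ?L'" "\<forall>l\<in>set ?L'. path_word \<Gamma> l"
        using L cell_rotate[of \<Gamma> j L] set_rotate[of j L] unfolding abR(1) by simp_all
      have "set ?L' = set L" using set_rotate[of j L] abR(1) by simp
      then have sw: "cell_blocks ?L' = ?I" by simp
      have "card (\<gamma> j) = 2" using cell_merge_blocks(4)[OF \<Gamma> L'] unfolding abR(3) by simp
      then have "\<not> tube ?\<Gamma>' (\<gamma> j)" using j(2) by blast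
      then have "cell_vec \<Gamma> ((a @ b) # R) = (0 :: _ \<Rightarrow>\<^sub>0 'k)"
        using merge_first_zero[OF \<Gamma> L', where 'k = 'k] unfolding sw abR(3) by blast
      then show ?thesis by (simp add: abR(1) merge_first_def)
    qed
    have fin: "finite ?S" by (rule finite_pair_tubes[OF simple_contract])
    have "koszul_diff \<Gamma> (cell_vec \<Gamma> L) = sum ?\<phi> (?S \<inter> \<gamma> ` {..<?n})"
      unfolding eq using fin zero by (intro sum.mono_neutral_right) auto
    also have "?S \<inter> \<gamma> ` {..<?n} = \<gamma> ` {j. j < ?n \<and> \<gamma> j \<in> ?S}" by auto
    also have "sum ?\<phi> (\<gamma> ` {j. j < ?n \<and> \<gamma> j \<in> ?S}) = (\<Sum>j | j < ?n \<and> \<gamma> j \<in> ?S. ?\<phi> (\<gamma> j))"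
      by (subst sum.reindex[OF inj_on_subset[OF inj]]) auto
    also have "\<dots> = (\<Sum>j | j < ?n \<and> \<gamma> j \<in> ?S. ?c j)"
      using good by (intro sum.cong) auto
    also have "\<dots> = (\<Sum>j<?n. ?c j)"
      using zero' by (intro sum.mono_neutral_left) auto
    also have "\<dots> = cyclic_bd (cell_vec \<Gamma>) L"
    proof (rule cyclic_bd_sum[symmetric, OF len])
      show "distinct (concat L)" "[] \<notin> set L" using L(1) by (simp_all add: cell_def)
      fix M k assume "distinct (concat M)" "[] \<notin> set M" "set (concat M) = set (concat L)"
      then have "cell \<Gamma> M" using L(1) by (simp add: cell_def)
      then show "cell_vec \<Gamma> (rotate k M) = smul ((-1) ^ (k * (length M - 1))) (cell_vec \<Gamma> M :: _ \<Rightarrow>\<^sub>0 'k)"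
        by (rule cell_vec_rotate)
    qed
    finally show ?thesis .
  qed
qed

lemma koszul_diff_single_cell:
  assumes "cell \<Gamma> [x]" "simple_graph \<Gamma>"
  shows "koszul_diff \<Gamma> (cell_vec \<Gamma> [x] :: _ \<Rightarrow>\<^sub>0 'k::field) = 0"
proof (cases "path_word \<Gamma> x")
  case True
  let ?\<Gamma>' = "contract \<Gamma> {set x}"
  have "verts ?\<Gamma>' = {Min (set x)}" by (simp add: contract_def)
  then have "card G \<le> 1" if "tube ?\<Gamma>' G" for G
    using tube_subset[OF that] card_mono[of "{Min (set x)}" G] by simp
  then have none: "{G. tube ?\<Gamma>' G \<and> card G = 2} = {}" by fastforce
  show ?thesis using True by (simp add: cell_vec_def koszul_diff_eq none)
next
  case False
  then show ?thesis by (simp add: cell_vec_def koszul_diff_def lin_ext.zero)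
qed

section \<open>Merged cells, and cells with a word that is not a path\<close>

lemma merges_not_path:
  "M \<in> merges L \<Longrightarrow> [] \<notin> set L \<Longrightarrow> \<exists>l\<in>set L. \<not> path_word \<Gamma> l \<Longrightarrow> \<exists>l\<in>set M. \<not> path_word \<Gamma> l"
  by (induction L arbitrary: M rule: merges.induct) (fastforce simp: successively_append_iff)+

lemma wrap_not_path:
  assumes "length L \<ge> 2" "\<exists>l\<in>set L. \<not> path_word \<Gamma> l"
  shows "\<exists>l\<in>set (wrap L). \<not> path_word \<Gamma> l"
proof -
  obtain v M u where "L = v # M @ [u]"
    using assms(1) by (cases L; cases "tl L" rule: rev_cases) auto
  then show ?thesis using assms(2) by (auto simp: wrap_def append_last_def successively_append_iff)
qed

lemma merges_cell: "M \<in> merges L \<Longrightarrow> cell \<Gamma> L \<Longrightarrow> cell \<Gamma> M"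
proof -
  have "[] \<notin> set M" if "M \<in> merges L" "[] \<notin> set L"
    using that by (induction L arbitrary: M rule: merges.induct) fastforce+
  then show "M \<in> merges L \<Longrightarrow> cell \<Gamma> L \<Longrightarrow> cell \<Gamma> M"
    by (simp add: cell_def merges_concat del: set_concat)
qed

lemma wrap_cell:
  assumes "length L \<ge> 2" "cell \<Gamma> L"
  shows "cell \<Gamma> (wrap L)" "Suc (length (wrap L)) = length L"
proof -
  obtain v M u where "L = v # M @ [u]"
    using assms(1) by (cases L; cases "tl L" rule: rev_cases) auto
  then show "cell \<Gamma> (wrap L)" "Suc (length (wrap L)) = length L"
    using assms(2) by (auto simp: wrap_def append_last_def cell_def)
qed

text \<open>A word that is no path remains a factor of some word after every merge, so both sides
  vanish if L contains one.\<close>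

lemma koszul_diff_cell:
  assumes conn: "connected_graph \<Gamma>" and L: "cell \<Gamma> L" and len: "length L \<ge> 2"
  shows "koszul_diff \<Gamma> (cell_vec \<Gamma> L) = (cyclic_bd (cell_vec \<Gamma>) L :: _ \<Rightarrow>\<^sub>0 'k::field)"
proof (cases "\<forall>l\<in>set L. path_word \<Gamma> l")
  case True
  then show ?thesis using koszul_diff_path_cell[OF conn L _ len] by blast
next
  case False
  then have ex: "\<exists>l\<in>set L. \<not> path_word \<Gamma> l" by blast
  have ne: "[] \<notin> set L" using L by (simp add: cell_def)
  have "linear_bd (cell_vec \<Gamma>) L = linear_bd (\<lambda>_. 0 :: _ \<Rightarrow>\<^sub>0 'k) L"
  proof (rule linear_bd_cong)
    fix M assume "M \<in> merges L"
    then show "cell_vec \<Gamma> M = (0 :: _ \<Rightarrow>\<^sub>0 'k)"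
      using merges_not_path[OF _ ne ex] unfolding cell_vec_def by metis
  qed
  also have "\<dots> = 0"
    using linear_bd_diff[of "\<lambda>_. 0 :: _ \<Rightarrow>\<^sub>0 'k" "\<lambda>_. 0" L] by simp
  finally have 1: "linear_bd (cell_vec \<Gamma>) L = (0 :: _ \<Rightarrow>\<^sub>0 'k)" .
  have 2: "cell_vec \<Gamma> (wrap L) = (0 :: _ \<Rightarrow>\<^sub>0 'k)"
    using wrap_not_path[OF len ex] unfolding cell_vec_def by metis
  have 3: "cell_vec \<Gamma> L = (0 :: _ \<Rightarrow>\<^sub>0 'k)" using ex unfolding cell_vec_def by metis
  show ?thesis using 1 2 3 by (simp add: cyclic_bd_def koszul_diff_def lin_ext.zero)
qed

lemma linear_bd_image:
  assumes "Vector_Spaces.linear smul smul h"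
  shows "h (linear_bd f L) = linear_bd (\<lambda>M. h (f M)) L"
proof -
  interpret h: Vector_Spaces.linear smul smul h by fact
  show ?thesis
  proof (induction L arbitrary: f rule: merges.induct)
    case (1 a b R)
    show ?case unfolding linear_bd.simps(1) h.diff 1[of "\<lambda>M. f (a # M)"] by (rule refl)
  qed (simp_all add: h.zero)
qed

text \<open>From three words on this is \<open>cyclic_bd_cyclic_bd\<close>. Two words lead to cells
  with one word, whose contraction has no two-vertex tube.\<close>

lemma koszul_diff_koszul_diff_cell:
  assumes conn: "connected_graph \<Gamma>" and L: "cell \<Gamma> L"
  shows "koszul_diff \<Gamma> (koszul_diff \<Gamma> (cell_vec \<Gamma> L)) = (0 :: _ \<Rightarrow>\<^sub>0 'k::field)"
proof -
  have \<Gamma>: "simple_graph \<Gamma>" using conn by (simp add: connected_graph_def)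
  have lin: "Vector_Spaces.linear smul smul (koszul_diff \<Gamma> :: (_ \<Rightarrow>\<^sub>0 'k) \<Rightarrow> _)"
    unfolding koszul_diff_def by (rule linear_lin_ext)
  interpret h: Vector_Spaces.linear smul smul "koszul_diff \<Gamma> :: (_ \<Rightarrow>\<^sub>0 'k) \<Rightarrow> _" by (rule lin)
  let ?e = "cell_vec \<Gamma> :: _ \<Rightarrow> _ \<Rightarrow>\<^sub>0 'k"
  have "verts \<Gamma> \<noteq> {}" using conn by (simp add: connected_graph_def tube_def)
  then have "length L \<noteq> 0" using L by (auto simp: cell_def)
  then consider x where "L = [x]" | "length L = 2" | "length L \<ge> 3"
    by (cases L; cases "tl L"; cases "tl (tl L)") auto
  then show ?thesis
  proof cases
    case 1
    then show ?thesis using koszul_diff_single_cell[OF _ \<Gamma>, of x, where 'k = 'k] L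
      by (simp add: h.zero)
  next
    case 2
    then obtain a b where ab: "L = [a, b]" by (auto simp: numeral_2_eq_2 length_Suc_conv)
    have "cell \<Gamma> [a @ b]" "cell \<Gamma> [b @ a]" using L by (auto simp: ab cell_def)
    moreover have "koszul_diff \<Gamma> (?e L) = ?e [a @ b] - ?e [b @ a]"
      using koszul_diff_cell[OF conn L, where 'k = 'k] 2
      by (simp add: ab cyclic_bd_def wrap_def append_last_def)
    ultimately show ?thesis by (simp add: h.diff koszul_diff_single_cell[OF _ \<Gamma>])
  next
    case 3
    have "koszul_diff \<Gamma> (?e M) = cyclic_bd ?e M" if "M \<in> insert (wrap L) (merges L)" for M
      using that 3 L merges_cell merges_length[of M L] wrap_cell[of L \<Gamma>]
      by (intro koszul_diff_cell[OF conn]) auto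
    then have "linear_bd (\<lambda>M. koszul_diff \<Gamma> (?e M)) L = linear_bd (cyclic_bd ?e) L"
      "koszul_diff \<Gamma> (?e (wrap L)) = cyclic_bd ?e (wrap L)"
      by (auto intro: linear_bd_cong)
    moreover have "koszul_diff \<Gamma> (?e L) = linear_bd ?e L - ?e (wrap L)"
      using koszul_diff_cell[OF conn L, where 'k = 'k] 3 by (simp add: cyclic_bd_def)
    ultimately have "koszul_diff \<Gamma> (koszul_diff \<Gamma> (?e L)) = cyclic_bd (cyclic_bd ?e) L"
      by (simp add: h.diff linear_bd_image[OF lin] cyclic_bd_def[of "cyclic_bd ?e"])
    then show ?thesis using cyclic_bd_cyclic_bd[OF 3] by metis
  qed
qed

section \<open>A criterion for quasi-isomorphisms onto degree zero\<close>

text \<open>The target has zero differential, so its homology classes are singletons and the induced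
  map sends the class of x to {f x}. Bijectivity can then be read off from kernel and image of
  f.\<close>

lemma quasi_isoI_degree_zero:
  assumes K: "chain_complex K d" and L: "chain_complex L (\<lambda>_. 0)"
    and L_pos: "\<And>n. L (Suc n) = {0}"
    and f: "chain_map K d L (\<lambda>_. 0) f"
    and acyclic: "\<And>n x. x \<in> K (Suc n) \<Longrightarrow> d x = 0 \<Longrightarrow> x \<in> d ` K (Suc (Suc n))"
    and inj: "\<And>x. x \<in> K 0 \<Longrightarrow> f x = 0 \<Longrightarrow> x \<in> d ` K (Suc 0)"
    and surj: "L 0 \<subseteq> f ` K 0"
  shows "quasi_iso K d L (\<lambda>_. 0) f"
proof -
  have linf: "Vector_Spaces.linear smul smul f" and lind: "Vector_Spaces.linear smul smul d"
    using f K by (simp_all add: chain_map_def chain_complex_def)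
  interpret f: Vector_Spaces.linear smul smul f by (rule linf)
  interpret d: Vector_Spaces.linear smul smul d by (rule lind)
  have sub: "free.subspace (K n)" "free.subspace (L n)" for n
    using K L by (simp_all add: chain_complex_def)
  have fK: "f x \<in> L n" if "x \<in> K n" for x n
    using f that by (auto simp: chain_map_def)
  have fd: "f (d x) = 0" if "x \<in> K n" for x n
    using f that by (auto simp: chain_map_def)
  have bd: "x \<in> d ` K (Suc n)" if "x \<in> K n" "d x = 0" "f x = 0" for x n
    using that acyclic inj by (cases n) auto
  have dK: "d x \<in> K n" "d (d x) = 0" if "x \<in> K (Suc n)" for x n
    using K that unfolding chain_complex_def by blast+
  have "bij_betw (\<lambda>c. homologous L (\<lambda>_. 0) n `` (f ` c)) (homology K d n) (homology L (\<lambda>_. 0) n)" for n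
  proof -
    have zero: "0 \<in> L m" "0 \<in> K m" for m using sub free.subspace_0 by blast+
    have hL: "homologous L (\<lambda>_. 0) n = Id_on (L n)"
      using image_constant[OF zero(1), of 0 "Suc n"] by (auto simp: homologous_def cycle_space_def)
    have HL: "homology L (\<lambda>_. 0) n = (\<lambda>w. {w}) ` L n"
      unfolding homology_def hL by (auto simp: cycle_space_def quotient_def)
    have HK: "homology K d n = (\<lambda>x. homologous K d n `` {x}) ` cycle_space K d n"
      by (auto simp: homology_def quotient_def)
    let ?F = "\<lambda>c. homologous L (\<lambda>_. 0) n `` (f ` c)"
    have F: "?F (homologous K d n `` {x}) = {f x}" if x: "x \<in> cycle_space K d n" for x
    proof -
      have "f ` (homologous K d n `` {x}) = {f x}"
      proof
        show "f ` (homologous K d n `` {x}) \<subseteq> {f x}"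
        proof
          fix w assume "w \<in> f ` (homologous K d n `` {x})"
          then obtain y z where "w = f y" "z \<in> K (Suc n)" "x - y = d z"
            by (auto simp: homologous_def)
          then have "f x - w = 0" using fd f.diff by metis
          then show "w \<in> {f x}" by simp
        qed
        have "0 \<in> d ` K (Suc n)" using zero d.zero by (metis imageI)
        then show "{f x} \<subseteq> f ` (homologous K d n `` {x})"
          using x by (auto simp: homologous_def)
      qed
      moreover have "f x \<in> L n" using x fK by (simp add: cycle_space_def)
      ultimately show ?thesis by (auto simp: hL)
    qed
    show ?thesis unfolding bij_betw_def
    proof
      show "inj_on ?F (homology K d n)"
      proof (rule inj_onI)
        fix c c' assume "c \<in> homology K d n" "c' \<in> homology K d n" and eq: "?F c = ?F c'"
        then obtain x y where x: "x \<in> cycle_space K d n" "c = homologous K d n `` {x}"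
          and y: "y \<in> cycle_space K d n" "c' = homologous K d n `` {y}"
          unfolding HK by blast
        have "f x = f y" using eq F[OF x(1)] F[OF y(1)] x(2) y(2) by simp
        then have "x - y \<in> d ` K (Suc n)"
          using x(1) y(1) sub
          by (intro bd) (auto simp: cycle_space_def f.diff d.diff free.subspace_diff)
        then obtain a where a: "a \<in> K (Suc n)" "x - y = d a" by blast
        have "z \<in> c \<longleftrightarrow> z \<in> c'" for z
        proof -
          have "x - z \<in> d ` K (Suc n) \<longleftrightarrow> y - z \<in> d ` K (Suc n)"
          proof
            assume "x - z \<in> d ` K (Suc n)"
            then obtain b where b: "b \<in> K (Suc n)" "x - z = d b" by blast
            then have "y - z = d (b - a)" using a(2) by (simp add: d.diff algebra_simps)
            then show "y - z \<in> d ` K (Suc n)"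
              using free.subspace_diff[OF sub(1) b(1) a(1)] by blast
          next
            assume "y - z \<in> d ` K (Suc n)"
            then obtain b where b: "b \<in> K (Suc n)" "y - z = d b" by blast
            then have "x - z = d (b + a)" using a(2) by (simp add: d.add algebra_simps)
            then show "x - z \<in> d ` K (Suc n)"
              using free.subspace_add[OF sub(1) b(1) a(1)] by blast
          qed
          then show ?thesis using x y by (auto simp: homologous_def)
        qed
        then show "c = c'" by blast
      qed
      show "?F ` homology K d n = homology L (\<lambda>_. 0) n"
      proof -
        have "f ` cycle_space K d n = L n"
        proof
          show "f ` cycle_space K d n \<subseteq> L n" using fK by (auto simp: cycle_space_def)
          show "L n \<subseteq> f ` cycle_space K d n"
          proof (cases n)
            case 0
            have "d x = 0" if "x \<in> K 0" for x using K that by (auto simp: chain_complex_def)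
            then show ?thesis using surj 0 by (auto simp: cycle_space_def)
          next
            case (Suc m)
            have "0 \<in> cycle_space K d n" using zero by (simp add: cycle_space_def d.zero)
            then show ?thesis using Suc L_pos f.zero by (metis image_eqI singletonD subsetI)
          qed
        qed
        moreover have "?F ` homology K d n = (\<lambda>w. {w}) ` f ` cycle_space K d n"
          unfolding HK image_image using F by (intro image_cong) auto
        ultimately show ?thesis unfolding HL by simp
      qed
    qed
  qed
  then show ?thesis using K L f by (simp add: quasi_iso_def)
qed

text \<open>A test for linear independence by a private coordinate of each vector; it serves for the
  boundaries of the base cells and for their images in \<open>CycHam\<close>.\<close>

lemma lin_ext_eq_0D:
  assumes "lin_ext f b = 0"
    and "\<And>a. a \<in> Poly_Mapping.keys b \<Longrightarrow> \<exists>\<kappa>. Poly_Mapping.lookup (f a) \<kappa> \<noteq> 0 \<and>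
      (\<forall>a'\<in>Poly_Mapping.keys b. a' \<noteq> a \<longrightarrow> Poly_Mapping.lookup (f a') \<kappa> = 0)"
  shows "b = 0"
proof (rule ccontr)
  assume "b \<noteq> 0"
  then obtain a where a: "a \<in> Poly_Mapping.keys b" by (metis all_not_in_conv keys_eq_empty)
  obtain \<kappa> where \<kappa>: "Poly_Mapping.lookup (f a) \<kappa> \<noteq> 0"
    "\<forall>a'\<in>Poly_Mapping.keys b. a' \<noteq> a \<longrightarrow> Poly_Mapping.lookup (f a') \<kappa> = 0"
    using assms(2)[OF a] by blast
  have "Poly_Mapping.lookup (lin_ext f b) \<kappa> =
      (\<Sum>a'\<in>Poly_Mapping.keys b. Poly_Mapping.lookup b a' *
        (if a' = a then Poly_Mapping.lookup (f a) \<kappa> else 0))"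
    unfolding lookup_lin_ext using \<kappa>(2) by (intro sum.cong) auto
  then have "Poly_Mapping.lookup b a * Poly_Mapping.lookup (f a) \<kappa> = 0"
    using assms(1) by simp
  then show False using a \<kappa>(1) by (simp add: in_keys_iff)
qed

section \<open>The Koszul complex is spanned by the cells\<close>

text \<open>An ordering of the blocks together with a path on each block is the same as the list of
  these paths in that order.\<close>

lemma koszul_generator_cell:
  assumes \<Gamma>: "simple_graph \<Gamma>" and I: "tube_partition \<Gamma> I"
    and p: "p \<in> (\<Pi>\<^sub>E G\<in>I. ham_paths (restr \<Gamma> G))" and w: "w \<in> orderings (Min ` I)"
  shows "\<exists>L. cell \<Gamma> L \<and> length L = card I \<and>
    lin_ext (\<lambda>t. basis_vec (I, t, p)) (cyclic_sum (contract \<Gamma> I) w) = (cell_vec \<Gamma> L :: _ \<Rightarrow>\<^sub>0 'k::field)"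
proof -
  interpret graph_partition \<Gamma> I using \<Gamma> I by unfold_locales
  have pA: "distinct (p A)" "set (p A) = A" "path_word \<Gamma> (p A)" if "A \<in> I" for A
  proof -
    have pa: "p A \<in> ham_paths (restr \<Gamma> A)" using p that by (auto simp: PiE_iff)
    then show "distinct (p A)" "set (p A) = A" by (simp_all add: ham_paths_def)
    then show "path_word \<Gamma> (p A)" using pa path_word_restr[of "p A" A \<Gamma>] by (simp add: ham_paths_def)
  qed
  define L where "L = map (\<lambda>v. p (block_of I v)) w"
  have w': "distinct w" "set w = Min ` I" using w by (simp_all add: orderings_def)
  have setL: "set L = p ` I" unfolding L_def set_map w'(2) image_image by (intro image_cong) auto
  have blocks: "cell_blocks L = I" unfolding setL image_image using pA(2) by simp
  have word: "cell_word L = w"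
    unfolding L_def map_map using w'(2) pA(2) by (intro map_idI) auto
  have dL: "distinct L"
    using w'(1) word by (metis distinct_map)
  have "distinct (concat L)"
  proof (rule distinct_concat[OF dL])
    show "distinct l" if "l \<in> set L" for l using that setL pA(1) by auto
    fix l l' assume "l \<in> set L" "l' \<in> set L" "l \<noteq> l'"
    then obtain A B where "A \<in> I" "B \<in> I" "l = p A" "l' = p B" "A \<noteq> B" using setL by auto
    then show "set l \<inter> set l' = {}" using pA(2)[of A] pA(2)[of B] blocks_eq[of A B] by auto
  qed
  moreover have "set (concat L) = verts \<Gamma>" using blocks Union_blocks by simp
  moreover have "[] \<notin> set L"
  proof
    assume "[] \<in> set L"
    then obtain A where "A \<in> I" "p A = []" unfolding setL by force
    then show False using pA(2)[of A] block_nonempty[of A] by simp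
  qed
  ultimately have cell: "cell \<Gamma> L" by (simp add: cell_def)
  have paths: "cell_paths L = p"
  proof
    fix A
    show "cell_paths L A = p A"
    proof (cases "A \<in> I")
      case True
      then have "cell_paths L (set (p A)) = p A" using setL by (intro cell_paths_set[OF cell]) simp
      then show ?thesis using pA(2)[OF True] by simp
    next
      case False
      then have "p A = undefined" using p by (auto simp: PiE_iff extensional_def)
      then show ?thesis using False blocks by (simp add: cell_paths_def)
    qed
  qed
  have "\<forall>l\<in>set L. path_word \<Gamma> l" using setL pA(3) by auto
  then have "cell_vec \<Gamma> L = (lin_ext (\<lambda>t. basis_vec (I, t, p)) (cyclic_sum (contract \<Gamma> I) w) :: _ \<Rightarrow>\<^sub>0 'k)"
    by (simp add: cell_vec_def blocks paths word)
  moreover have "length L = card I" using card_cell_blocks[OF cell] blocks by simp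
  ultimately show ?thesis using cell by metis
qed

text \<open>By \<open>cycham_dual_eq\<close> for the contraction, the tree part of a generator may
  be taken to be a cyclic sum. Cells with a word that is no path add only 0 to the span.\<close>

lemma koszul_complex_eq:
  assumes conn: "connected_graph \<Gamma>"
  shows "koszul_complex cycham_dual \<Gamma> n =
    (free.span (cell_vec \<Gamma> ` {L. cell \<Gamma> L \<and> length L = Suc n}) :: (_ \<Rightarrow>\<^sub>0 'k::field) set)"
    (is "?K = ?S")
proof
  have \<Gamma>: "simple_graph \<Gamma>" using conn by (simp add: connected_graph_def)
  show "?K \<subseteq> ?S"
    unfolding koszul_complex_def
  proof (rule free.span_minimal)
    show "{lin_ext (\<lambda>t. basis_vec (I, t, p)) x | I x p.
      tube_partition \<Gamma> I \<and> card I = Suc n \<and> x \<in> cycham_dual (contract \<Gamma> I) \<and>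
      p \<in> (\<Pi>\<^sub>E G\<in>I. ham_paths (restr \<Gamma> G))} \<subseteq> ?S"
    proof clarify
      fix I p and x :: "nat ptree \<Rightarrow>\<^sub>0 'k"
      assume I: "tube_partition \<Gamma> I" "card I = Suc n" and x: "x \<in> cycham_dual (contract \<Gamma> I)"
        and p: "p \<in> (\<Pi>\<^sub>E G\<in>I. ham_paths (restr \<Gamma> G))"
      interpret graph_partition \<Gamma> I using \<Gamma> I by unfold_locales
      have "lin_ext (\<lambda>t. basis_vec (I, t, p)) ` cyclic_sums (contract \<Gamma> I) \<subseteq> ?S"
        unfolding cyclic_sums_def verts_contract
      proof (rule lin_ext_image_span_subset)
        fix y :: "nat ptree \<Rightarrow>\<^sub>0 'k" assume "y \<in> cyclic_sum (contract \<Gamma> I) ` orderings (Min ` I)"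
        then obtain w where "w \<in> orderings (Min ` I)" "y = cyclic_sum (contract \<Gamma> I) w" by blast
        then show "lin_ext (\<lambda>t. basis_vec (I, t, p)) y \<in> ?S"
          using koszul_generator_cell[OF \<Gamma> I(1) p, where 'k = 'k] I(2)
          by (metis (mono_tags, lifting) free.span_base imageI mem_Collect_eq)
      qed simp
      then show "lin_ext (\<lambda>t. basis_vec (I, t, p)) x \<in> ?S"
        using x cycham_dual_eq[OF connected_contract[OF conn], where 'k = 'k] by blast
    qed
  qed simp
  show "?S \<subseteq> ?K"
  proof (rule free.span_minimal)
    show "free.subspace ?K" by (simp add: koszul_complex_def)
    show "cell_vec \<Gamma> ` {L. cell \<Gamma> L \<and> length L = Suc n} \<subseteq> ?K"
    proof clarify
      fix L assume L: "cell \<Gamma> L" "length L = Suc n"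
      show "cell_vec \<Gamma> L \<in> ?K"
      proof (cases "\<forall>l\<in>set L. path_word \<Gamma> l")
        case True
        let ?I = "cell_blocks L"
        interpret graph_partition \<Gamma> ?I by (rule graph_partition_cell[OF \<Gamma> L(1) True])
        have "cyclic_sum (contract \<Gamma> ?I) (cell_word L) \<in>
            (cycham_dual (contract \<Gamma> ?I) :: (_ \<Rightarrow>\<^sub>0 'k) set)"
          unfolding cycham_dual_eq[OF connected_contract[OF conn]] cyclic_sums_def
          using cell_word_orderings[OF L(1)] by (intro free.span_base imageI)
        moreover have "cell_paths L \<in> (\<Pi>\<^sub>E G\<in>?I. ham_paths (restr \<Gamma> G))"
        proof (rule PiE_I)
          fix A assume "A \<in> ?I"
          then obtain l where l: "l \<in> set L" "A = set l" by blast
          have "distinct l" using L(1) l by (auto simp: cell_def distinct_concat_iff)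
          then show "cell_paths L A \<in> ham_paths (restr \<Gamma> A)"
            using l True path_word_restr[of l A \<Gamma>]
            by (simp add: cell_paths_set[OF L(1) l(1)] ham_paths_def)
        qed (simp add: cell_paths_def)
        moreover have "card ?I = Suc n" using card_cell_blocks[OF L(1)] L(2) by simp
        moreover have "cell_vec \<Gamma> L = (lin_ext (\<lambda>t. basis_vec (?I, t, cell_paths L))
            (cyclic_sum (contract \<Gamma> ?I) (cell_word L)) :: _ \<Rightarrow>\<^sub>0 'k)"
          using True by (simp add: cell_vec_def)
        ultimately show ?thesis
          unfolding koszul_complex_def using tube_part by (intro free.span_base) blast
      next
        case False
        then have "cell_vec \<Gamma> L = (0 :: _ \<Rightarrow>\<^sub>0 'k)" unfolding cell_vec_def by metis
        then show ?thesis by (simp add: koszul_complex_def free.span_zero)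
      qed
    qed
  qed
qed

lemma linear_bd_in_subspace:
  assumes "free.subspace T" "\<And>M. M \<in> merges L \<Longrightarrow> f M \<in> T"
  shows "linear_bd f L \<in> T"
  using assms(2)
proof (induction L arbitrary: f rule: merges.induct)
  case (1 a b R)
  have "linear_bd (\<lambda>M. f (a # M)) (b # R) \<in> T" by (rule 1(1)) (simp add: 1(2))
  then show ?case using 1(2) free.subspace_diff[OF assms(1)] by simp
qed (simp_all add: free.subspace_0[OF assms(1)])

lemma chain_complex_koszul_complex:
  assumes conn: "connected_graph \<Gamma>"
  shows "chain_complex (koszul_complex cycham_dual \<Gamma> :: nat \<Rightarrow> (koszul_basis \<Rightarrow>\<^sub>0 'k::field) set)
    (koszul_diff \<Gamma>)"
proof -
  let ?K = "koszul_complex cycham_dual \<Gamma> :: nat \<Rightarrow> (koszul_basis \<Rightarrow>\<^sub>0 'k) set"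
  let ?d = "koszul_diff \<Gamma> :: (_ \<Rightarrow>\<^sub>0 'k) \<Rightarrow> _"
  have \<Gamma>: "simple_graph \<Gamma>" using conn by (simp add: connected_graph_def)
  have lin: "Vector_Spaces.linear smul smul ?d"
    unfolding koszul_diff_def by (rule linear_lin_ext)
  interpret h: Vector_Spaces.linear smul smul ?d by (rule lin)
  have sub: "free.subspace (?K n)" for n by (simp add: koszul_complex_def)
  have "?d ` ?K 0 \<subseteq> {0}"
    unfolding koszul_complex_eq[OF conn] koszul_diff_def
  proof (rule lin_ext_image_span_subset)
    fix x :: "koszul_basis \<Rightarrow>\<^sub>0 'k" assume "x \<in> cell_vec \<Gamma> ` {L. cell \<Gamma> L \<and> length L = Suc 0}"
    then obtain y where "cell \<Gamma> [y]" "x = cell_vec \<Gamma> [y]" by (auto simp: length_Suc_conv)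
    then show "lin_ext (koszul_diff_basis \<Gamma>) x \<in> {0}"
      using koszul_diff_single_cell[OF _ \<Gamma>, where 'k = 'k] by (simp add: koszul_diff_def)
  qed (simp add: free.subspace_def)
  moreover have "?d ` ?K (Suc n) \<subseteq> ?K n" for n
    unfolding koszul_complex_eq[OF conn, of "Suc n"] koszul_diff_def
  proof (rule lin_ext_image_span_subset)
    fix x :: "koszul_basis \<Rightarrow>\<^sub>0 'k" assume "x \<in> cell_vec \<Gamma> ` {L. cell \<Gamma> L \<and> length L = Suc (Suc n)}"
    then obtain L where L: "cell \<Gamma> L" "length L = Suc (Suc n)" "x = cell_vec \<Gamma> L" by auto
    have in_K: "cell_vec \<Gamma> M \<in> ?K n" if "cell \<Gamma> M" "length M = Suc n" for M
      unfolding koszul_complex_eq[OF conn] using that by (intro free.span_base) auto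
    have "linear_bd (cell_vec \<Gamma>) L \<in> ?K n"
    proof (rule linear_bd_in_subspace[OF sub])
      fix M assume "M \<in> merges L"
      then show "cell_vec \<Gamma> M \<in> ?K n" using merges_cell merges_length[of M L] L by (intro in_K) auto
    qed
    moreover have "cell_vec \<Gamma> (wrap L) \<in> ?K n" using wrap_cell[of L \<Gamma>] L by (intro in_K) auto
    ultimately have "cyclic_bd (cell_vec \<Gamma>) L \<in> ?K n"
      unfolding cyclic_bd_def by (rule free.subspace_diff[OF sub])
    then show "lin_ext (koszul_diff_basis \<Gamma>) x \<in> ?K n"
      using koszul_diff_cell[OF conn L(1), where 'k = 'k] L by (simp add: koszul_diff_def)
  qed (rule sub)
  moreover have "?d (?d x) = 0" if "x \<in> ?K n" for x n
  proof -
    have "free.subspace {x. ?d (?d x) = 0}"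
      by (auto simp: free.subspace_def h.zero h.add h.scale)
    then have "?K n \<subseteq> {x. ?d (?d x) = 0}"
      unfolding koszul_complex_eq[OF conn]
      using koszul_diff_koszul_diff_cell[OF conn, where 'k = 'k] by (intro free.span_minimal) auto
    then show ?thesis using that by blast
  qed
  ultimately show ?thesis using sub lin by (simp add: chain_complex_def)
qed

section \<open>The augmentation\<close>

lemma rotations_singleton: "rotations [m] = {[m]}"
  by (auto simp: rotations_def)

lemma closed_ham_paths_rotation:
  assumes \<Gamma>: "simple_graph \<Gamma>" and w: "w \<in> closed_ham_paths \<Gamma>" and rot: "w' \<in> rotations w"
  shows "w' \<in> closed_ham_paths \<Gamma>"
proof -
  obtain p q where pq: "w = p @ q" "w' = q @ p" using rot by (auto simp: mem_rotations_iff)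
  show ?thesis
  proof (cases "p = [] \<or> q = []")
    case True
    then show ?thesis using w pq by auto
  next
    case False
    then have ne: "p \<noteq> []" "q \<noteq> []" by auto
    have path: "path_word \<Gamma> p" "path_word \<Gamma> q" "(last p, hd q) \<in> edges \<Gamma>"
      using w ne by (auto simp: pq closed_ham_paths_def ham_paths_def successively_append_iff)
    have "(last q, hd p) \<in> edges \<Gamma>"
    \<comment> \<open>For two vertices \<open>closed_ham_paths\<close> asks for no closing edge; the
      symmetry of the edges supplies it.\<close>
    proof (cases "length w \<le> 2")
      case True
      then have "length p = 1" "length q = 1" using ne by (auto simp: pq neq_Nil_conv)
      then obtain a b where "p = [a]" "q = [b]" by (auto simp: length_Suc_conv)
      then show ?thesis using path(3) \<Gamma> by (auto simp: simple_graph_def dest: symD)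
    next
      case False
      then show ?thesis using w ne by (simp add: pq closed_ham_paths_def)
    qed
    then show ?thesis using w path ne
      by (auto simp: pq closed_ham_paths_def ham_paths_def successively_append_iff)
  qed
qed

lemma linear_koszul_aug: "Vector_Spaces.linear smul smul (koszul_aug \<Gamma>)"
  unfolding koszul_aug_def by (rule linear_lin_ext)

lemma koszul_aug_single_cell:
  assumes "cell \<Gamma> [x]"
  shows "koszul_aug \<Gamma> (cell_vec \<Gamma> [x]) =
    (if x \<in> closed_ham_paths \<Gamma> then basis_vec (rotations x) else (0 :: _ \<Rightarrow>\<^sub>0 'k::field))"
proof (cases "path_word \<Gamma> x")
  case True
  let ?m = "Min (set x)" let ?\<Gamma>' = "contract \<Gamma> {set x}"
  have V: "verts ?\<Gamma>' = {?m}" by (simp add: contract_def)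
  then have "Lf ?m \<in> admissible_trees ?\<Gamma>'" by (simp add: admissible_trees_def tube_singleton)
  then have cyc: "cyclic_sum ?\<Gamma>' [?m] = (basis_vec (Lf ?m) :: _ \<Rightarrow>\<^sub>0 'k)"
    unfolding cyclic_sum_singleton
    by (intro poly_mapping_eqI) (auto simp: lookup_linear_sum leaf_list_singleton lookup_single when_def)
  have "block_of {set x} ?m = set x" unfolding block_of_def by (rule the_equality) auto
  then have "substitute {set x} (cell_paths [x]) [?m] = x"
    using cell_paths_set[OF assms, of x] by (simp add: substitute_def)
  then show ?thesis using True
    by (simp add: cell_vec_def cyc koszul_aug_def cycham_act_def rotations_singleton Let_def)
next
  case False
  then have "x \<notin> closed_ham_paths \<Gamma>" by (auto simp: closed_ham_paths_def ham_paths_def)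
  then show ?thesis using False by (simp add: cell_vec_def koszul_aug_def lin_ext.zero)
qed

lemma koszul_aug_cell_zero:
  assumes "length L \<ge> 2"
  shows "koszul_aug \<Gamma> (cell_vec \<Gamma> L) = (0 :: _ \<Rightarrow>\<^sub>0 'k::field)"
proof (cases "\<forall>l\<in>set L. path_word \<Gamma> l")
  case True
  let ?z = "cyclic_sum (contract \<Gamma> (cell_blocks L)) (cell_word L) :: _ \<Rightarrow>\<^sub>0 'k"
  let ?f = "\<lambda>t. case t of Lf v \<Rightarrow> cycham_act \<Gamma> (cell_blocks L) (rotations [v]) (cell_paths L)
    | Br l r \<Rightarrow> (0 :: _ \<Rightarrow>\<^sub>0 'k)"
  have "koszul_aug \<Gamma> (cell_vec \<Gamma> L) = lin_ext ?f ?z"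
    using True by (simp add: cell_vec_def koszul_aug_def lin_ext_lin_ext)
  also have "\<dots> = lin_ext (\<lambda>_. 0) ?z"
  proof (rule lin_ext_cong)
    fix t assume "t \<in> Poly_Mapping.keys ?z"
    then have "length (leaf_list t) = length L"
      using keys_cyclic_sum rotations_length by fastforce
    then show "?f t = 0" using assms by (cases t) auto
  qed
  finally show ?thesis by simp
next
  case False
  then have "cell_vec \<Gamma> L = (0 :: _ \<Rightarrow>\<^sub>0 'k)" unfolding cell_vec_def by metis
  then show ?thesis by (simp add: koszul_aug_def lin_ext.zero)
qed

text \<open>Boundaries of cells with at least three words have at least two words in each term and
  are killed. For two words the terms \<open>a @ b\<close> and \<open>b @ a\<close> are rotations of
  each other and give the same cycle, in agreement with the relation of
  \<open>CycHam\<close>.\<close>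

lemma koszul_aug_diff_cell:
  assumes conn: "connected_graph \<Gamma>" and L: "cell \<Gamma> L"
  shows "koszul_aug \<Gamma> (koszul_diff \<Gamma> (cell_vec \<Gamma> L)) = (0 :: _ \<Rightarrow>\<^sub>0 'k::field)"
proof -
  have \<Gamma>: "simple_graph \<Gamma>" using conn by (simp add: connected_graph_def)
  interpret h: Vector_Spaces.linear smul smul "koszul_aug \<Gamma> :: (_ \<Rightarrow>\<^sub>0 'k) \<Rightarrow> _"
    by (rule linear_koszul_aug)
  have "verts \<Gamma> \<noteq> {}" using conn by (simp add: connected_graph_def tube_def)
  then have "length L \<noteq> 0" using L by (auto simp: cell_def)
  then consider x where "L = [x]" | "length L = 2" | "length L \<ge> 3"
    by (cases L; cases "tl L"; cases "tl (tl L)") auto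
  then show ?thesis
  proof cases
    case 1
    then show ?thesis using koszul_diff_single_cell[OF _ \<Gamma>, of x, where 'k = 'k] L
      by (simp add: h.zero)
  next
    case 2
    then obtain a b where ab: "L = [a, b]" by (auto simp: numeral_2_eq_2 length_Suc_conv)
    have c: "cell \<Gamma> [a @ b]" "cell \<Gamma> [b @ a]" using L by (auto simp: ab cell_def)
    have "a @ b \<in> closed_ham_paths \<Gamma> \<longleftrightarrow> b @ a \<in> closed_ham_paths \<Gamma>"
      using closed_ham_paths_rotation[OF \<Gamma>] rotations_append by blast
    moreover have "rotations (a @ b) = rotations (b @ a)"
      by (rule rotations_eq[OF rotations_append])
    moreover have "koszul_diff \<Gamma> (cell_vec \<Gamma> L) = (cell_vec \<Gamma> [a @ b] - cell_vec \<Gamma> [b @ a] :: _ \<Rightarrow>\<^sub>0 'k)"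
      using koszul_diff_cell[OF conn L, where 'k = 'k] 2
      by (simp add: ab cyclic_bd_def wrap_def append_last_def)
    ultimately show ?thesis
      by (simp add: h.diff koszul_aug_single_cell[OF c(1)] koszul_aug_single_cell[OF c(2)])
  next
    case 3
    have "free.subspace {x. koszul_aug \<Gamma> x = (0 :: _ \<Rightarrow>\<^sub>0 'k)}"
      by (auto simp: free.subspace_def h.zero h.add h.scale)
    then have "linear_bd (cell_vec \<Gamma>) L \<in> {x. koszul_aug \<Gamma> x = (0 :: _ \<Rightarrow>\<^sub>0 'k)}"
    proof (rule linear_bd_in_subspace)
      fix M assume "M \<in> merges L"
      then show "cell_vec \<Gamma> M \<in> {x. koszul_aug \<Gamma> x = (0 :: _ \<Rightarrow>\<^sub>0 'k)}"
        using merges_length[of M L] 3 by (simp add: koszul_aug_cell_zero)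
    qed
    moreover have "koszul_aug \<Gamma> (cell_vec \<Gamma> (wrap L)) = (0 :: _ \<Rightarrow>\<^sub>0 'k)"
      using wrap_cell(2)[OF _ L] 3 by (intro koszul_aug_cell_zero) simp
    moreover have "koszul_diff \<Gamma> (cell_vec \<Gamma> L) = (cyclic_bd (cell_vec \<Gamma>) L :: _ \<Rightarrow>\<^sub>0 'k)"
      using koszul_diff_cell[OF conn L, where 'k = 'k] 3 by simp
    ultimately show ?thesis by (simp add: cyclic_bd_def h.diff)
  qed
qed

lemma linear_image_span_subset:
  assumes "Vector_Spaces.linear smul smul h" "\<And>x. x \<in> S \<Longrightarrow> h x \<in> T" "free.subspace T"
  shows "h ` free.span S \<subseteq> T"
proof -
  have "h ` free.span S = free.span (h ` S)"
    using assms(1) module_hom.span_image[of smul smul h S]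
    by (simp add: Vector_Spaces.linear_iff_module_hom)
  also have "\<dots> \<subseteq> T" using assms(2,3) by (intro free.span_minimal) auto
  finally show ?thesis .
qed

lemma chain_map_koszul_aug:
  assumes conn: "connected_graph \<Gamma>"
  shows "chain_map (koszul_complex cycham_dual \<Gamma> :: nat \<Rightarrow> (koszul_basis \<Rightarrow>\<^sub>0 'k::field) set)
    (koszul_diff \<Gamma>) (cycham_complex \<Gamma>) (\<lambda>_. 0) (koszul_aug \<Gamma>)"
proof -
  interpret h: Vector_Spaces.linear smul smul "koszul_aug \<Gamma> :: (_ \<Rightarrow>\<^sub>0 'k) \<Rightarrow> _"
    by (rule linear_koszul_aug)
  interpret d: Vector_Spaces.linear smul smul "koszul_diff \<Gamma> :: (_ \<Rightarrow>\<^sub>0 'k) \<Rightarrow> _"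
    unfolding koszul_diff_def by (rule linear_lin_ext)
  let ?K = "koszul_complex cycham_dual \<Gamma> :: nat \<Rightarrow> (koszul_basis \<Rightarrow>\<^sub>0 'k) set"
  have "koszul_aug \<Gamma> ` ?K n \<subseteq> cycham_complex \<Gamma> n" for n
    unfolding koszul_complex_eq[OF conn]
  proof (rule linear_image_span_subset[OF linear_koszul_aug])
    show "free.subspace (cycham_complex \<Gamma> n)"
      by (simp add: cycham_complex_def cycham_def)
    fix x :: "koszul_basis \<Rightarrow>\<^sub>0 'k" assume "x \<in> cell_vec \<Gamma> ` {L. cell \<Gamma> L \<and> length L = Suc n}"
    then obtain L where L: "cell \<Gamma> L" "length L = Suc n" "x = cell_vec \<Gamma> L" by auto
    show "koszul_aug \<Gamma> x \<in> cycham_complex \<Gamma> n"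
    proof (cases n)
      case 0
      then obtain y where y: "L = [y]" using L(2) by (auto simp: length_Suc_conv)
      have "koszul_aug \<Gamma> x \<in> cycham \<Gamma>"
        using koszul_aug_single_cell[of \<Gamma> y, where 'k = 'k] L
        unfolding y cycham_def ham_cycles_def
        by (auto intro: free.span_base free.span_zero)
      then show ?thesis using 0 by (simp add: cycham_complex_def)
    next
      case (Suc m)
      then show ?thesis using koszul_aug_cell_zero[of L \<Gamma>, where 'k = 'k] L
        by (simp add: cycham_complex_def)
    qed
  qed
  moreover have "koszul_aug \<Gamma> (koszul_diff \<Gamma> x) = 0" if "x \<in> ?K n" for x n
  proof -
    have "free.subspace {x. koszul_aug \<Gamma> (koszul_diff \<Gamma> x) = (0 :: _ \<Rightarrow>\<^sub>0 'k)}"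
      by (auto simp: free.subspace_def h.zero h.add h.scale d.zero d.add d.scale)
    then have "?K n \<subseteq> {x. koszul_aug \<Gamma> (koszul_diff \<Gamma> x) = (0 :: _ \<Rightarrow>\<^sub>0 'k)}"
      unfolding koszul_complex_eq[OF conn]
      using koszul_aug_diff_cell[OF conn, where 'k = 'k] by (intro free.span_minimal) auto
    then show ?thesis using that by blast
  qed
  ultimately show ?thesis using linear_koszul_aug by (simp add: chain_map_def)
qed

lemma chain_complex_cycham: "chain_complex (cycham_complex \<Gamma>) (\<lambda>_. 0 :: _ \<Rightarrow>\<^sub>0 'k::field)"
proof -
  have "Vector_Spaces.linear smul smul (\<lambda>_ :: nat list set \<Rightarrow>\<^sub>0 'k. 0 :: nat list set \<Rightarrow>\<^sub>0 'k)"
    by unfold_locales auto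
  then show ?thesis
    by (auto simp: chain_complex_def cycham_complex_def cycham_def free.span_zero)
qed

section \<open>Supported cells\<close>

text \<open>A cell of paths can have the zero vector: in the pentagon 1, 2, 3, 4, 5 with the cyclic
  order 1, 3, 5, 2, 4 of single letters no two neighbours are adjacent, so no admissible tree has a
  cherry. Such cells must be kept out of the pairing.\<close>

definition supported :: "graph \<Rightarrow> nat list list \<Rightarrow> bool"
  where "supported \<Gamma> L \<longleftrightarrow> (\<forall>l\<in>set L. path_word \<Gamma> l) \<and>
    (\<exists>t\<in>admissible_trees (contract \<Gamma> (cell_blocks L)). leaf_list t \<in> rotations (cell_word L))"

lemma cell_vec_not_supported:
  assumes "\<not> supported \<Gamma> L"
  shows "cell_vec \<Gamma> L = (0 :: _ \<Rightarrow>\<^sub>0 'k::field)"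
proof (cases "\<forall>l\<in>set L. path_word \<Gamma> l")
  case True
  let ?z = "cyclic_sum (contract \<Gamma> (cell_blocks L)) (cell_word L) :: _ \<Rightarrow>\<^sub>0 'k"
  have "Poly_Mapping.keys ?z = {}"
    using keys_cyclic_sum assms True unfolding supported_def by blast
  then have "?z = 0" by simp
  then show ?thesis by (simp add: cell_vec_def lin_ext.zero)
next
  case False
  then show ?thesis unfolding cell_vec_def by metis
qed

lemma lookup_cell_vec:
  "Poly_Mapping.lookup (cell_vec \<Gamma> L) (I, t, p) =
    (if (\<forall>l\<in>set L. path_word \<Gamma> l) \<and> cell_blocks L = I \<and> cell_paths L = p
     then Poly_Mapping.lookup (cyclic_sum (contract \<Gamma> (cell_blocks L)) (cell_word L)) t else (0 :: 'k::field))"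
proof -
  have "Poly_Mapping.lookup (lin_ext (\<lambda>t. basis_vec (cell_blocks L, t, cell_paths L)) z) (I, t, p) =
      (if cell_blocks L = I \<and> cell_paths L = p then Poly_Mapping.lookup z t else (0 :: 'k))" for z
  proof (cases "cell_blocks L = I \<and> cell_paths L = p")
    case True
    have "inj (\<lambda>t :: nat ptree. (I, t, p))" by (auto intro: injI)
    then show ?thesis using True lookup_lin_ext_basis_vec[of "\<lambda>t. (I, t, p)" z t] by simp
  next
    case False
    then have "Poly_Mapping.lookup (basis_vec (cell_blocks L, t', cell_paths L)) (I, t, p) = (0 :: 'k)"
      for t' by (intro lookup_single_not_eq) simp
    then show ?thesis unfolding lookup_lin_ext if_not_P[OF False]
      by (intro sum.neutral ballI) (simp only: mult_zero_right)
  qed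
  then have *: "Poly_Mapping.lookup (lin_ext (\<lambda>t. basis_vec (cell_blocks L, t, cell_paths L)) z) (I, t, p) =
      (if cell_blocks L = I \<and> cell_paths L = p then Poly_Mapping.lookup z t else (0 :: 'k))" for z .
  show ?thesis
  proof (cases "\<forall>l\<in>set L. path_word \<Gamma> l")
    case True
    then show ?thesis unfolding cell_vec_def if_P[OF True] * by simp
  next
    case False
    then show ?thesis unfolding cell_vec_def if_not_P[OF False] by auto
  qed
qed

lemma rotations_rotate: "rotations (rotate k w) = rotations w"
  by (rule rotations_eq[OF rotate_in_rotations])

lemma supported_rotate: "supported \<Gamma> (rotate k L) \<longleftrightarrow> supported \<Gamma> L"
  by (simp add: supported_def rotate_map[symmetric] rotations_rotate)

lemma cyclic_neighbours_adjacent: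
  assumes \<Gamma>: "simple_graph \<Gamma>" and L: "cell \<Gamma> (u # v # M)" "\<forall>l\<in>set (u # v # M). path_word \<Gamma> l"
    and e: "(last u, hd v) \<in> edges \<Gamma>"
  shows "(Min (set u), Min (set v)) \<in> edges (contract \<Gamma> (cell_blocks (u # v # M)))"
proof -
  interpret graph_partition \<Gamma> "cell_blocks (u # v # M)" by (rule graph_partition_cell[OF \<Gamma> L])
  have "u \<noteq> []" "v \<noteq> []" using L(1) by (auto simp: cell_def)
  then show ?thesis
    using edges_contract_iff[of "set u" "set v"] e cell_merge_blocks(4)[OF \<Gamma> L]
    by (auto intro: last_in_set hd_in_set)
qed

text \<open>Whether a cyclic order can be collapsed to a point by successively merging adjacent arcs does
  not depend on the first merge: this is what makes the cells pair off.\<close>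

lemma supported_merge_first:
  assumes conn: "connected_graph \<Gamma>" and L: "cell \<Gamma> (u # v # M)" "\<forall>l\<in>set (u # v # M). path_word \<Gamma> l"
    and e: "(last u, hd v) \<in> edges \<Gamma>"
  shows "supported \<Gamma> (u # v # M) \<longleftrightarrow> supported \<Gamma> ((u @ v) # M)"
proof -
  have \<Gamma>: "simple_graph \<Gamma>" using conn by (simp add: connected_graph_def)
  let ?L = "u # v # M" and ?L' = "(u @ v) # M"
  let ?I = "cell_blocks ?L" let ?\<Delta> = "contract \<Gamma> ?I"
  let ?mu = "Min (set u)" and ?mv = "Min (set v)"
  let ?G = "{?mu, ?mv}" let ?m = "Min ?G" let ?W = "cell_word M"
  let ?s = "Br (Lf ?mu) (Lf ?mv) :: nat ptree"
  interpret graph_partition \<Gamma> ?I by (rule graph_partition_cell[OF \<Gamma> L])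
  note mb = cell_merge_blocks[OF \<Gamma> L]
  have conn': "connected_graph ?\<Delta>" by (rule connected_contract[OF conn])
  have ne: "u \<noteq> []" "v \<noteq> []" using L(1) by (auto simp: cell_def)
  have e': "(?mu, ?mv) \<in> edges ?\<Delta>" by (rule cyclic_neighbours_adjacent[OF \<Gamma> L e])
  then have tube: "tube ?\<Delta> ?G" using tube_pair_iff[OF simple_contract mb(4)] by blast
  have ct: "contract_tube ?\<Delta> ?G = contract \<Gamma> (cell_blocks ?L')"
    using contract_contract[OF tube] unfolding mb(2) .
  have paths': "\<forall>l\<in>set ?L'. path_word \<Gamma> l"
    using L(2) e ne by (simp add: successively_append_iff)
  have w': "cell_word ?L' = ?m # ?W" using mb(3) by simp
  have w: "cell_word ?L = [?mu, ?mv] @ ?W" by simp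
  have d: "distinct ([?mu, ?mv] @ ?W)" "distinct ([] @ ?m # ?W)"
    using distinct_cell_word[OF L(1)] distinct_cell_word[OF cell_merge[OF L(1)]]
    unfolding w w' by simp_all
  show ?thesis
  proof
    assume "supported \<Gamma> ?L"
    then obtain t where t: "t \<in> admissible_trees ?\<Delta>" "leaf_list t \<in> rotations (cell_word ?L)"
      by (auto simp only: supported_def)
    have rot: "?mu # ?mv # ?W \<in> rotations (leaf_list t)" using rotations_sym[OF t(2)] by simp
    have "inner t > 0" using rotations_length[OF t(2)] length_leaf_list[of t] by simp
    then obtain a b where "Br (Lf a) (Lf b) \<in> subtrees t" using cherry_exists by blast
    \<comment> \<open>A supporting tree in which the pair to be merged is a cherry; contracting this
      cherry gives a tree for the merged cell.\<close>
    then obtain t' where t': "t' \<in> admissible_trees ?\<Delta>" "leaf_list t' \<in> rotations (leaf_list t)"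
        "?s \<in> subtrees t'"
      using cherry_move[OF conn' t(1) rot e'] by blast
    obtain t0 where t0: "t' = graft ?m ?s t0" "graftable ?s t0" "t0 \<in> admissible_trees (contract_tube ?\<Delta> ?G)"
      using admissible_subtree[OF simple_contract t'(1,3)] unfolding set_small_trees by metis
    obtain p q where pq: "leaf_list t0 = p @ ?m # q" "leaf_list t' = p @ [?mu, ?mv] @ q"
      using graftable_cherry_leaf_list[OF t0(2)] t0(1) by metis
    have "[?mu, ?mv] @ q @ p \<in> rotations (leaf_list t')"
      unfolding pq(2) using rotations_append[of "[?mu, ?mv] @ q" p] by simp
    then have r: "[?mu, ?mv] @ q @ p \<in> rotations ([?mu, ?mv] @ ?W)"
      using t'(2) t(2) rotations_trans unfolding w by metis
    have qp: "q @ p = ?W"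
    proof (cases "?W = []")
      case True
      then show ?thesis using rotations_length[OF r] by simp
    next
      case False
      show ?thesis using rotation_block[OF d(1) False refl _ r] by simp
    qed
    have "leaf_list t0 \<in> rotations (cell_word ?L')"
      unfolding w' pq(1) qp[symmetric] using rotations_append[of p "?m # q"] by (simp add: rotations_append rotations_sym)
    then show "supported \<Gamma> ?L'"
      using t0(3) paths' unfolding supported_def ct by blast
  next
    assume "supported \<Gamma> ?L'"
    then obtain t0 where t0: "t0 \<in> admissible_trees (contract_tube ?\<Delta> ?G)"
        "leaf_list t0 \<in> rotations (?m # ?W)"
      unfolding supported_def ct w' by blast
    have s: "?s \<in> admissible_trees (restr ?\<Delta> ?G)"
      using mb(4) tube_restr_iff[OF simple_contract tube_subset[OF tube]] tube tube_subset[OF tube]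
        tube_singleton[of ?mu ?\<Delta>] tube_singleton[of ?mv ?\<Delta>]
      by (auto simp: admissible_trees_def insert_commute)
    have g: "graftable ?s t0" by (rule graftableI_admissible(1)[OF t0(1) s])
    have t: "graft ?m ?s t0 \<in> admissible_trees ?\<Delta>"
      using graft_admissible_iff[OF simple_contract _ g] tube t0(1) s unfolding set_small_trees by blast
    obtain p q where pq: "leaf_list t0 = p @ ?m # q" "leaf_list (graft ?m ?s t0) = p @ [?mu, ?mv] @ q"
      using graftable_cherry_leaf_list[OF g] by metis
    have "q @ p = ?W @ []"
      by (rule rotation_block_swap[OF d(2)]) (use t0(2) pq(1) in simp)
    then have "leaf_list (graft ?m ?s t0) \<in> rotations (cell_word ?L)"
      unfolding pq(2) w using rotations_block_rotations[of q p ?W "[]" "[?mu, ?mv]"] by simp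
    then show "supported \<Gamma> ?L" using t L(2) unfolding supported_def by blast
  qed
qed

lemma supported_wrap_iff:
  assumes conn: "connected_graph \<Gamma>" and L: "cell \<Gamma> (v # M @ [u])" "\<forall>l\<in>set (v # M @ [u]). path_word \<Gamma> l"
    and e: "(last u, hd v) \<in> edges \<Gamma>"
  shows "supported \<Gamma> (v # M @ [u]) \<longleftrightarrow> supported \<Gamma> (M @ [u @ v])"
proof -
  have 1: "rotate (Suc (length M)) (v # M @ [u]) = u # v # M"
    using rotate_append[of "v # M" "[u]"] by simp
  have 2: "rotate (length M) (M @ [u @ v]) = (u @ v) # M"
    using rotate_append[of M "[u @ v]"] by simp
  have c: "cell \<Gamma> (u # v # M)" using L(1) cell_rotate[of \<Gamma> "Suc (length M)"] unfolding 1[symmetric] by blast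
  have "supported \<Gamma> (u # v # M) \<longleftrightarrow> supported \<Gamma> ((u @ v) # M)"
    using L(2) by (intro supported_merge_first[OF conn c _ e]) auto
  then show ?thesis
    using supported_rotate[of \<Gamma> "Suc (length M)" "v # M @ [u]"]
      supported_rotate[of \<Gamma> "length M" "M @ [u @ v]"] unfolding 1 2 by blast
qed

text \<open>If some word has two letters, its consecutive letters are adjacent. If all words are
  single letters, the contraction has the edges of \<Gamma>, and a cherry of a supporting tree
  consists of two adjacent cyclic neighbours.\<close>

lemma supported_good_gap:
  assumes conn: "connected_graph \<Gamma>" and M: "cell \<Gamma> M" "supported \<Gamma> M" and n: "length (concat M) \<ge> 2"
  shows "\<exists>z\<in>rotations (concat M). (last z, hd z) \<in> edges \<Gamma>"
proof (cases "\<exists>l\<in>set M. length l \<ge> 2")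
  case True
  then obtain l where l: "l \<in> set M" "length l \<ge> 2" by blast
  then obtain x y l' where xy: "l = x # y # l'" by (cases l rule: remdups_adj.cases) auto
  have e: "(x, y) \<in> edges \<Gamma>" using M(2) l(1) xy by (auto simp: supported_def)
  obtain P Q where "M = P @ l # Q" using l(1) by (meson split_list)
  then have "concat M = (concat P @ [x]) @ (y # l' @ concat Q)" by (simp add: xy)
  then have "(y # l' @ concat Q) @ (concat P @ [x]) \<in> rotations (concat M)"
    using rotations_append by metis
  then show ?thesis using e by (intro bexI) auto
next
  case False
  have single: "\<exists>x. l = [x]" if "l \<in> set M" for l
  proof -
    have "l \<noteq> []" "\<not> length l \<ge> 2" using that M(1) False by (auto simp: cell_def)
    then show ?thesis by (cases l rule: remdups_adj.cases) auto
  qed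
  have \<Gamma>: "simple_graph \<Gamma>" using conn by (simp add: connected_graph_def)
  have paths: "\<forall>l\<in>set M. path_word \<Gamma> l" using M(2) by (simp add: supported_def)
  interpret graph_partition \<Gamma> "cell_blocks M" by (rule graph_partition_cell[OF \<Gamma> M(1) paths])
  have word: "cell_word M = concat M"
    using single by (induction M) (auto, metis List.finite_set Min_singleton append_Cons append_Nil empty_set list.simps(15))
  obtain t where t: "t \<in> admissible_trees (contract \<Gamma> (cell_blocks M))" "leaf_list t \<in> rotations (concat M)"
    using M(2) unfolding supported_def word by blast
  have "inner t > 0" using rotations_length[OF t(2)] length_leaf_list[of t] n by simp
  then obtain a b where ab: "Br (Lf a) (Lf b) \<in> subtrees t" using cherry_exists by blast
  have "a \<noteq> b" using distinct_subtree[OF ab admissibleD(1)[OF t(1)]] by simp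
  then have e: "(a, b) \<in> edges (contract \<Gamma> (cell_blocks M))"
    using admissibleD(3)[OF t(1) ab] tube_pair_iff[OF simple_contract, of a b]
    unfolding set_small_trees by blast
  have "(a, b) \<in> edges \<Gamma>"
  proof -
    obtain A B where AB: "A \<in> cell_blocks M" "B \<in> cell_blocks M" "a = Min A" "b = Min B"
        "\<exists>u\<in>A. \<exists>v\<in>B. (u, v) \<in> edges \<Gamma>"
      using e by (auto simp: contract_def)
    obtain x y where "A = {x}" "B = {y}" using AB(1,2) single by fastforce
    then show ?thesis using AB(3-5) by simp
  qed
  moreover have "\<exists>z\<in>rotations (concat M). last z = a \<and> hd z = b"
  proof -
    obtain t0 where "t = graft (Min {a, b}) (Br (Lf a) (Lf b)) t0" "graftable (Br (Lf a) (Lf b)) t0"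
      using admissible_subtree[OF simple_contract t(1) ab] unfolding set_small_trees by metis
    then obtain p q where "leaf_list t = p @ [a, b] @ q"
      using graftable_cherry_leaf_list by metis
    then have "leaf_list t = (p @ [a]) @ (b # q)" by simp
    then have "(b # q) @ (p @ [a]) \<in> rotations (leaf_list t)" using rotations_append by metis
    then have "(b # q) @ (p @ [a]) \<in> rotations (concat M)" using t(2) rotations_trans by blast
    then show ?thesis by (intro bexI) auto
  qed
  ultimately show ?thesis by blast
qed

section \<open>Pairing off the cells\<close>

text \<open>The gap in question lies between the last letter and the first. On a single vertex no
  edge closes it, but the loop [1] counts as a cycle.\<close>

definition good_word :: "graph \<Rightarrow> nat list \<Rightarrow> bool"
  where "good_word \<Gamma> x \<longleftrightarrow> length x = 1 \<or> (last x, hd x) \<in> edges \<Gamma>"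

text \<open>The choice depends on x only through \<open>rotations x\<close>, so a cyclic order with
  a good gap has exactly one canonical word, which starts right after the chosen gap.\<close>

definition canonical :: "graph \<Rightarrow> nat list \<Rightarrow> bool"
  where "canonical \<Gamma> x \<longleftrightarrow> good_word \<Gamma> x \<and> x = (SOME y. y \<in> rotations x \<and> good_word \<Gamma> y)"

lemma canonical_exists:
  assumes "z \<in> rotations y" "good_word \<Gamma> z"
  shows "\<exists>x\<in>rotations y. canonical \<Gamma> x"
proof -
  let ?x = "SOME x. x \<in> rotations y \<and> good_word \<Gamma> x"
  have x: "?x \<in> rotations y \<and> good_word \<Gamma> ?x" by (rule someI) (use assms in blast)
  then have "rotations ?x = rotations y" using rotations_eq by blast
  then have "canonical \<Gamma> ?x" using x by (simp add: canonical_def)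
  then show ?thesis using x by blast
qed

lemma canonical_unique:
  assumes "canonical \<Gamma> x" "canonical \<Gamma> y" "y \<in> rotations x"
  shows "x = y"
  using assms rotations_eq[OF assms(3)] unfolding canonical_def by metis

text \<open>The cells whose cyclic order is cut at the chosen good gap of the underlying cyclic order of
  the vertices; every other cell is \<open>wrap L\<close> for exactly one such \<open>L\<close>.\<close>

definition base_cells :: "graph \<Rightarrow> nat \<Rightarrow> nat list list set"
  where "base_cells \<Gamma> n =
    {L. cell \<Gamma> L \<and> length L = Suc n \<and> canonical \<Gamma> (concat L) \<and> supported \<Gamma> L}"

lemma base_cell_decompose:
  assumes "L \<in> base_cells \<Gamma> (Suc n)"
  obtains v M u where "L = v # M @ [u]" "(last u, hd v) \<in> edges \<Gamma>" "wrap L = M @ [u @ v]"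
    "cell \<Gamma> L" "length M = n" "canonical \<Gamma> (concat L)" "\<forall>l\<in>set L. path_word \<Gamma> l" "u \<noteq> []" "v \<noteq> []"
    "supported \<Gamma> L"
proof -
  have L: "cell \<Gamma> L" "length L = Suc (Suc n)" "canonical \<Gamma> (concat L)" "supported \<Gamma> L"
    using assms by (simp_all add: base_cells_def)
  obtain v M u where vMu: "L = v # M @ [u]"
    using L(2) by (cases L; cases "tl L" rule: rev_cases) auto
  have ne: "u \<noteq> []" "v \<noteq> []" using L(1) by (auto simp: vMu cell_def)
  then have "length (concat L) \<noteq> 1" by (cases u; cases v) (simp_all add: vMu)
  then have "(last u, hd v) \<in> edges \<Gamma>" using L(3) ne by (auto simp: canonical_def good_word_def vMu)
  then show ?thesis
    using L ne vMu by (intro that[of v M u]) (simp_all add: wrap_def append_last_def supported_def)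
qed

lemma supported_wrap:
  assumes "connected_graph \<Gamma>" "L \<in> base_cells \<Gamma> (Suc n)"
  shows "supported \<Gamma> (wrap L)"
  using assms(2)
proof (rule base_cell_decompose)
  fix v M u
  assume *: "L = v # M @ [u]" "(last u, hd v) \<in> edges \<Gamma>" "wrap L = M @ [u @ v]"
    "cell \<Gamma> L" "\<forall>l\<in>set L. path_word \<Gamma> l" "supported \<Gamma> L"
  then show ?thesis using supported_wrap_iff[OF assms(1), of v M u] by simp
qed

text \<open>The two alternatives separate the cells that are cut at the chosen gap from those in
  which it lies inside a word.\<close>

lemma concat_split:
  "concat M = p @ q \<Longrightarrow> (\<exists>M1 M2. M = M1 @ M2 \<and> concat M1 = p \<and> concat M2 = q) \<or>
    (\<exists>M1 u v M2. M = M1 @ [u @ v] @ M2 \<and> u \<noteq> [] \<and> v \<noteq> [] \<and> p = concat M1 @ u \<and> q = v @ concat M2)"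
proof (induction M arbitrary: p)
  case (Cons l M)
  then have "l @ concat M = p @ q" by simp
  then consider us where "p = l @ us" "concat M = us @ q" | us where "us \<noteq> []" "l = p @ us" "us @ concat M = q"
  proof -
    assume "l @ concat M = p @ q"
    then obtain us where "l = p @ us \<and> us @ concat M = q \<or> l @ us = p \<and> concat M = us @ q"
      unfolding append_eq_append_conv2 by blast
    then show ?thesis using that by (cases "us = []") auto
  qed
  then show ?case
  proof cases
    case 1
    from Cons.IH[OF 1(2)] show ?thesis
    proof (elim disjE exE conjE)
      fix M1 M2 assume "M = M1 @ M2" "concat M1 = us" "concat M2 = q"
      then show ?thesis using 1 by (intro disjI1 exI[of _ "l # M1"] exI[of _ M2]) simp
    next
      fix M1 u v M2
      assume "M = M1 @ [u @ v] @ M2" "u \<noteq> []" "v \<noteq> []" "us = concat M1 @ u" "q = v @ concat M2"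
      then show ?thesis using 1
        by (intro disjI2 exI[of _ "l # M1"] exI[of _ u] exI[of _ v] exI[of _ M2]) simp
    qed
  next
    case 2
    show ?thesis
    proof (cases "p = []")
      case True
      then show ?thesis using 2 by (intro disjI1 exI[of _ "[]"] exI[of _ "l # M"]) simp
    next
      case False
      then show ?thesis using 2
        by (intro disjI2 exI[of _ "[]"] exI[of _ p] exI[of _ us] exI[of _ M]) simp
    qed
  qed
qed simp

lemma cell_vec_base_span:
  assumes "cell \<Gamma> M" "length M = Suc n" "canonical \<Gamma> (concat M)"
  shows "cell_vec \<Gamma> M \<in> (free.span (cell_vec \<Gamma> ` base_cells \<Gamma> n) :: (_ \<Rightarrow>\<^sub>0 'k::field) set)"
proof (cases "supported \<Gamma> M")
  case True
  then show ?thesis using assms by (intro free.span_base imageI) (simp add: base_cells_def)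
next
  case False
  then show ?thesis by (simp add: cell_vec_not_supported free.span_zero)
qed

text \<open>The merges in the linear part leave the concatenation unchanged; only
  \<open>wrap\<close> merges across the chosen gap.\<close>

lemma linear_bd_base_span:
  assumes "cell \<Gamma> L" "length L = Suc (Suc n)" "canonical \<Gamma> (concat L)"
  shows "linear_bd (cell_vec \<Gamma>) L \<in> (free.span (cell_vec \<Gamma> ` base_cells \<Gamma> n) :: (_ \<Rightarrow>\<^sub>0 'k::field) set)"
proof (rule linear_bd_in_subspace)
  fix M assume "M \<in> merges L"
  then show "cell_vec \<Gamma> M \<in> (free.span (cell_vec \<Gamma> ` base_cells \<Gamma> n) :: (_ \<Rightarrow>\<^sub>0 'k) set)"
    using merges_cell[of M L \<Gamma>] merges_length[of M L] merges_concat[of M L] assms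
    by (intro cell_vec_base_span) simp_all
qed simp

text \<open>If M is cut at the chosen gap, it is a base cell up to rotation. Otherwise the word
  across the gap is split there. The resulting base cell has M as its \<open>wrap\<close> up to
  rotation, and the rest of its boundary lies in the span of base cells, so this boundary expresses
  M by base cells modulo boundaries.\<close>

lemma cell_vec_decompose:
  assumes conn: "connected_graph \<Gamma>" and M: "cell \<Gamma> M" "length M = Suc n"
  shows "\<exists>y\<in>free.span (cell_vec \<Gamma> ` base_cells \<Gamma> n). \<exists>z\<in>free.span (cell_vec \<Gamma> ` base_cells \<Gamma> (Suc n)).
    cell_vec \<Gamma> M = y + (koszul_diff \<Gamma> z :: _ \<Rightarrow>\<^sub>0 'k::field)"
proof (cases "supported \<Gamma> M")
  case False
  interpret d: Vector_Spaces.linear smul smul "koszul_diff \<Gamma> :: (_ \<Rightarrow>\<^sub>0 'k) \<Rightarrow> _"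
    unfolding koszul_diff_def by (rule linear_lin_ext)
  show ?thesis using False
    by (intro bexI[of _ 0]) (simp_all add: cell_vec_not_supported free.span_zero d.zero)
next
  case True
  interpret d: Vector_Spaces.linear smul smul "koszul_diff \<Gamma> :: (_ \<Rightarrow>\<^sub>0 'k) \<Rightarrow> _"
    unfolding koszul_diff_def by (rule linear_lin_ext)
  let ?B = "\<lambda>n. free.span (cell_vec \<Gamma> ` base_cells \<Gamma> n) :: (_ \<Rightarrow>\<^sub>0 'k) set"
  have paths: "\<forall>l\<in>set M. path_word \<Gamma> l" using True by (simp add: supported_def)
  have "\<exists>z\<in>rotations (concat M). good_word \<Gamma> z"
  proof (cases "length (concat M) \<ge> 2")
    case gap: True
    show ?thesis using supported_good_gap[OF conn M(1) True gap] by (auto simp: good_word_def)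
  next
    case False
    moreover have "concat M \<noteq> []" using M by (cases M) (auto simp: cell_def)
    then have "length (concat M) \<noteq> 0" by simp
    ultimately have "length (concat M) = 1" by linarith
    then show ?thesis by (intro bexI[of _ "concat M"]) (simp_all add: good_word_def)
  qed
  then obtain x where x: "x \<in> rotations (concat M)" "canonical \<Gamma> x"
    using canonical_exists by blast
  then obtain p q where pq: "concat M = p @ q" "x = q @ p" by (auto simp: mem_rotations_iff)
  have sign: "cell_vec \<Gamma> M = smul ((-1) ^ (k * (length M - 1))) (cell_vec \<Gamma> (rotate k M) :: _ \<Rightarrow>\<^sub>0 'k)" for k
    by (simp add: cell_vec_rotate[OF M(1)] flip: power_add)
  from concat_split[OF pq(1)] show ?thesis
  proof (elim disjE exE conjE)
    fix M1 M2 assume M12: "M = M1 @ M2" "concat M1 = p" "concat M2 = q"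
    have r: "rotate (length M1) M = M2 @ M1" by (simp add: M12 rotate_append)
    have "cell_vec \<Gamma> (rotate (length M1) M) \<in> ?B n"
      using M x(2) cell_rotate[of \<Gamma> "length M1" M] M12 pq(2) unfolding r
      by (intro cell_vec_base_span) (simp_all add: M12(1))
    then have "cell_vec \<Gamma> M \<in> ?B n" unfolding sign[of "length M1"] by (rule free.span_scale)
    then show ?thesis by (intro bexI[of _ "cell_vec \<Gamma> M"] bexI[of _ 0]) (simp_all add: d.zero free.span_zero)
  next
    fix M1 u v M2
    assume M12: "M = M1 @ [u @ v] @ M2" "u \<noteq> []" "v \<noteq> []" "p = concat M1 @ u" "q = v @ concat M2"
    \<comment> \<open>M rotated and with the word \<open>u @ v\<close> cut open, so that the
      concatenation becomes the canonical word x.\<close>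
    let ?L = "v # (M2 @ M1) @ [u]"
    have r: "rotate (length (M1 @ [u @ v])) M = M2 @ M1 @ [u @ v]"
      using rotate_append[of "M1 @ [u @ v]" M2] by (simp add: M12)
    have w: "wrap ?L = M2 @ M1 @ [u @ v]" by (simp add: wrap_def append_last_def butlast_append)
    have cx: "concat ?L = x" by (simp add: pq(2) M12)
    have cell: "cell \<Gamma> ?L"
      using M(1) M12(1-3) by (auto simp: cell_def)
    have uv: "path_word \<Gamma> (u @ v)" using paths M12(1) by simp
    have pL: "\<forall>l\<in>set ?L. path_word \<Gamma> l"
      using paths uv M12(1) by (auto simp: successively_append_iff)
    have e: "(last u, hd v) \<in> edges \<Gamma>" using uv M12(2,3) by (simp add: successively_append_iff)
    have len: "length ?L = Suc (Suc n)" using M(2) M12(1) by simp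
    have "supported \<Gamma> (wrap ?L)"
      using True supported_rotate[of \<Gamma> "length (M1 @ [u @ v])" M] unfolding w r by blast
    then have "supported \<Gamma> ?L"
      using supported_wrap_iff[OF conn cell pL e] unfolding w by simp
    then have L: "?L \<in> base_cells \<Gamma> (Suc n)"
      using cell len x(2) cx by (simp add: base_cells_def)
    have y: "linear_bd (cell_vec \<Gamma>) ?L \<in> ?B n"
      using x(2) cx by (intro linear_bd_base_span[OF cell len]) simp
    have z: "cell_vec \<Gamma> ?L \<in> ?B (Suc n)" using L by (intro free.span_base imageI)
    have "koszul_diff \<Gamma> (cell_vec \<Gamma> ?L) = (cyclic_bd (cell_vec \<Gamma>) ?L :: _ \<Rightarrow>\<^sub>0 'k)"
      using koszul_diff_cell[OF conn cell, where 'k = 'k] len by simp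
    then have wr: "cell_vec \<Gamma> (wrap ?L) = linear_bd (cell_vec \<Gamma>) ?L - (koszul_diff \<Gamma> (cell_vec \<Gamma> ?L) :: _ \<Rightarrow>\<^sub>0 'k)"
      by (simp add: cyclic_bd_def)
    let ?c = "(-1 :: 'k) ^ (length (M1 @ [u @ v]) * (length M - 1))"
    have "cell_vec \<Gamma> M = smul ?c (cell_vec \<Gamma> (wrap ?L))"
      using sign[of "length (M1 @ [u @ v])"] unfolding r w .
    also have "\<dots> = smul ?c (linear_bd (cell_vec \<Gamma>) ?L) + koszul_diff \<Gamma> (smul (- ?c) (cell_vec \<Gamma> ?L))"
      unfolding wr by (simp add: d.scale d.neg free.scale_right_diff_distrib)
    finally show ?thesis using free.span_scale[OF y] free.span_scale[OF z] by blast
  qed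
qed

lemma koszul_complex_decompose:
  assumes conn: "connected_graph \<Gamma>"
    and x: "x \<in> (koszul_complex cycham_dual \<Gamma> n :: (koszul_basis \<Rightarrow>\<^sub>0 'k::field) set)"
  shows "\<exists>y\<in>free.span (cell_vec \<Gamma> ` base_cells \<Gamma> n). \<exists>z\<in>free.span (cell_vec \<Gamma> ` base_cells \<Gamma> (Suc n)).
    x = y + koszul_diff \<Gamma> z"
proof -
  interpret d: Vector_Spaces.linear smul smul "koszul_diff \<Gamma> :: (_ \<Rightarrow>\<^sub>0 'k) \<Rightarrow> _"
    unfolding koszul_diff_def by (rule linear_lin_ext)
  let ?B = "\<lambda>n. free.span (cell_vec \<Gamma> ` base_cells \<Gamma> n) :: (_ \<Rightarrow>\<^sub>0 'k) set"
  let ?T = "{x. \<exists>y\<in>?B n. \<exists>z\<in>?B (Suc n). x = y + koszul_diff \<Gamma> z}"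
  have "free.subspace ?T"
    unfolding free.subspace_def
  proof (intro conjI ballI allI)
    show "0 \<in> ?T" using free.span_zero d.zero by (intro CollectI bexI[of _ 0]) simp_all
    fix a b c assume "a \<in> ?T"
    then obtain y z where a: "y \<in> ?B n" "z \<in> ?B (Suc n)" "a = y + koszul_diff \<Gamma> z" by blast
    have "smul c a = smul c y + koszul_diff \<Gamma> (smul c z)"
      by (simp add: a(3) d.scale free.scale_right_distrib)
    then show "smul c a \<in> ?T" using free.span_scale[OF a(1)] free.span_scale[OF a(2)] by blast
    assume "b \<in> ?T"
    then obtain y' z' where b: "y' \<in> ?B n" "z' \<in> ?B (Suc n)" "b = y' + koszul_diff \<Gamma> z'" by blast
    have "a + b = (y + y') + koszul_diff \<Gamma> (z + z')"
      by (simp add: a(3) b(3) d.add)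
    then show "a + b \<in> ?T" using free.span_add[OF a(1) b(1)] free.span_add[OF a(2) b(2)] by blast
  qed
  then have "koszul_complex cycham_dual \<Gamma> n \<subseteq> ?T"
    unfolding koszul_complex_eq[OF conn]
    using cell_vec_decompose[OF conn, where 'k = 'k] by (intro free.span_minimal) auto
  then show ?thesis using x by blast
qed

lemma base_span_subset:
  assumes conn: "connected_graph \<Gamma>"
  shows "free.span (cell_vec \<Gamma> ` base_cells \<Gamma> n) \<subseteq>
    (koszul_complex cycham_dual \<Gamma> n :: (koszul_basis \<Rightarrow>\<^sub>0 'k::field) set)"
  unfolding koszul_complex_eq[OF conn]
  by (intro free.span_mono) (auto simp: base_cells_def)

section \<open>Independence of the boundaries and of the images of the base cells\<close>

lemma concat_rotate_rotations: "concat (rotate k M) \<in> rotations (concat M)"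
proof -
  obtain p q where "M = p @ q" "rotate k M = q @ p"
    using rotate_drop_take[of k M] append_take_drop_id by metis
  then show ?thesis using rotations_append by simp
qed

text \<open>Blocks and paths determine the set of words, and the leaf word of t determines their
  cyclic order.\<close>

lemma cell_vec_lookup_rotate:
  assumes W: "cell \<Gamma> W" and M: "cell \<Gamma> M" and t: "leaf_list t \<in> rotations (cell_word W)"
    and nz: "Poly_Mapping.lookup (cell_vec \<Gamma> M) (cell_blocks W, t, cell_paths W) \<noteq> (0 :: 'k::field)"
  shows "\<exists>k. M = rotate k W"
proof -
  have *: "cell_blocks M = cell_blocks W" "cell_paths M = cell_paths W"
    "Poly_Mapping.lookup (cyclic_sum (contract \<Gamma> (cell_blocks M)) (cell_word M)) t \<noteq> (0 :: 'k)"
    using nz unfolding lookup_cell_vec by (auto split: if_splits)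
  have image: "set N = cell_paths N ` cell_blocks N" if "cell \<Gamma> N" for N
    unfolding image_image using cell_paths_set[OF that] by auto
  have sets: "set M = set W" using image[OF W] image[OF M] *(1,2) by simp
  have "leaf_list t \<in> rotations (cell_word M)"
    using *(3) keys_cyclic_sum by (metis in_keys_iff)
  then have "cell_word M \<in> rotations (cell_word W)"
    using t rotations_sym rotations_trans by blast
  then obtain k where "cell_word M = rotate k (cell_word W)" by (auto simp: rotations_def)
  then have "cell_word M = cell_word (rotate k W)" by (simp add: rotate_map)
  moreover have "inj_on (\<lambda>l. Min (set l)) (set M \<union> set (rotate k W))"
    using cell_Min_inj[OF M] sets by (intro inj_onI) auto
  ultimately show ?thesis using map_inj_on by blast
qed

lemma rotation_same_last:
  assumes "distinct (N @ [c])" "N @ [c] = p @ q" "M @ [c] = q @ p"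
  shows "M = N"
proof -
  have "p = [] \<or> q = []"
  proof (rule ccontr)
    assume "\<not> (p = [] \<or> q = [])"
    then have "last p = c" "last q = c" "p \<noteq> []" "q \<noteq> []"
      using arg_cong[OF assms(2), of last] arg_cong[OF assms(3), of last] by auto
    then have "c \<in> set p" "c \<in> set q" by (metis last_in_set)+
    then show False using assms(1) unfolding assms(2) by auto
  qed
  then show ?thesis using assms(2,3) by auto
qed

lemma distinct_split_at_hd:
  assumes "u @ v = u' @ v'" "distinct (u @ v)" "v \<noteq> []" "v' \<noteq> []" "hd v = hd v'"
  shows "u = u' \<and> v = v'"
proof -
  obtain c w w' where c: "v = c # w" "v' = c # w'" using assms(3-5) by (metis list.collapse)
  have "distinct (u' @ v')" using assms(1,2) by metis
  then have "c \<notin> set u" "c \<notin> set w" "c \<notin> set u'" "c \<notin> set w'"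
    using assms(2) unfolding c by auto
  then show ?thesis using assms(1) unfolding c by (simp add: append_Cons_eq_iff)
qed

text \<open>A cell with canonical concatenation has a word that starts at the chosen gap, whereas in
  \<open>wrap L0\<close> this gap lies inside \<open>u @ v\<close>, behind the nonempty u.\<close>

lemma base_not_rotated_wrap:
  assumes L0: "L0 \<in> base_cells \<Gamma> (Suc n)" and M: "cell \<Gamma> M" "canonical \<Gamma> (concat M)"
  shows "M \<noteq> rotate k (wrap L0)"
proof
  assume rot: "M = rotate k (wrap L0)"
  obtain v N u where d: "L0 = v # N @ [u]" "wrap L0 = N @ [u @ v]" "cell \<Gamma> L0" "canonical \<Gamma> (concat L0)"
    "u \<noteq> []" "v \<noteq> []" using L0 by (rule base_cell_decompose)
  have "concat (wrap L0) \<in> rotations (concat L0)"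
    unfolding d(2) unfolding d(1) using rotations_append[of "concat N @ u" v] by simp
  then have "concat M \<in> rotations (concat L0)"
    using concat_rotate_rotations[of k "wrap L0"] rotations_trans unfolding rot by blast
  then have eq: "concat L0 = concat M" using canonical_unique[OF d(4) M(2)] by blast
  have "M \<noteq> []" using rot d(2) by auto
  then obtain l M' where l: "M = l # M'" by (cases M) auto
  have "l \<noteq> []" using M(1) by (auto simp: l cell_def)
  then have hd: "hd l = hd v" using arg_cong[OF eq, of hd] d(6) by (simp add: l d(1))
  have "u @ v \<in> set M" unfolding rot d(2) by simp
  moreover have "hd v \<in> set (u @ v)" "hd v \<in> set l" using d(6) hd \<open>l \<noteq> []\<close> by (auto, metis hd_in_set)
  ultimately have "l = u @ v" using cell_words_eq[OF M(1), of l "u @ v" "hd v"] by (simp add: l)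
  then have "hd u = hd v" using hd d(5) by simp
  then show False using d(3,5,6) unfolding d(1) cell_def by (cases u; cases v) auto
qed

text \<open>The first letter of the canonical word tells where the merged word \<open>u @ v\<close>
  has to be cut, so a base cell can be recovered from its wrap, even up to rotation.\<close>

lemma wrap_inj:
  assumes L0: "L0 \<in> base_cells \<Gamma> (Suc n)" and L: "L \<in> base_cells \<Gamma> (Suc n')" and rot: "wrap L = rotate k (wrap L0)"
  shows "L = L0"
proof -
  obtain v0 N u0 where d0: "L0 = v0 # N @ [u0]" "wrap L0 = N @ [u0 @ v0]" "cell \<Gamma> L0" "canonical \<Gamma> (concat L0)"
    "u0 \<noteq> []" "v0 \<noteq> []" using L0 by (rule base_cell_decompose)
  obtain v M u where d: "L = v # M @ [u]" "wrap L = M @ [u @ v]" "cell \<Gamma> L" "canonical \<Gamma> (concat L)"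
    "u \<noteq> []" "v \<noteq> []" using L by (rule base_cell_decompose)
  have "concat (wrap L0) \<in> rotations (concat L0)"
    unfolding d0(2) unfolding d0(1) using rotations_append[of "concat N @ u0" v0] by simp
  moreover have "concat L \<in> rotations (concat (wrap L))"
    unfolding d(2) unfolding d(1) using rotations_append[of v "concat M @ u"] by simp
  ultimately have "concat L \<in> rotations (concat L0)"
    using concat_rotate_rotations[of k "wrap L0"] rotations_trans unfolding rot by blast
  then have eq: "concat L0 = concat L" using canonical_unique[OF d0(4) d(4)] by blast
  then have hd: "hd v = hd v0" 
  proof -
    have "hd (concat L0) = hd v0" "hd (concat L) = hd v" using d(6) d0(6) by (simp_all add: d(1) d0(1))
    then show ?thesis using eq by simp
  qed
  have cw: "cell \<Gamma> (wrap L0)" using wrap_cell[of L0 \<Gamma>] d0 by simp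
  have "u @ v \<in> set (wrap L0)" using d(2) set_rotate[of k "wrap L0"] unfolding rot[symmetric] by auto
  moreover have "hd v \<in> set (u @ v)" "hd v \<in> set (u0 @ v0)" using d(6) d0(6) hd by (auto, metis hd_in_set)
  ultimately have e: "u @ v = u0 @ v0"
    using cell_words_eq[OF cw, of "u @ v" "u0 @ v0" "hd v"] by (simp add: d0(2))
  have "distinct (u @ v)" using d(3) by (auto simp: d(1) cell_def)
  then have uv: "u = u0 \<and> v = v0" using distinct_split_at_hd[OF e _ d(6) d0(6) hd] by blast
  have "distinct (wrap L0)" by (rule distinct_cell[OF cw])
  moreover obtain p q where pq: "wrap L0 = p @ q" "wrap L = q @ p"
    unfolding rot using rotate_drop_take[of k "wrap L0"] append_take_drop_id by metis
  moreover have "wrap L = M @ [u0 @ v0]" using d(2) uv by simp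
  ultimately have "M = N" using rotation_same_last[of N "u0 @ v0" p q M] unfolding d0(2) by simp
  then show ?thesis using uv by (simp add: d(1) d0(1))
qed

text \<open>The boundary of a base cell consists of its wrap and of cells with canonical
  concatenation. A coordinate of \<open>wrap L0\<close> is met neither by the latter
  (\<open>base_not_rotated_wrap\<close>) nor by the wrap of another base cell
  (\<open>wrap_inj\<close>).\<close>

lemma koszul_diff_base_injective:
  assumes conn: "connected_graph \<Gamma>"
    and y: "y \<in> (free.span (cell_vec \<Gamma> ` base_cells \<Gamma> (Suc n)) :: (_ \<Rightarrow>\<^sub>0 'k::field) set)"
    and 0: "koszul_diff \<Gamma> y = 0"
  shows "y = 0"
proof -
  obtain b where b: "y = lin_ext (cell_vec \<Gamma>) b" "Poly_Mapping.keys b \<subseteq> base_cells \<Gamma> (Suc n)"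
    using y unfolding span_image_eq_lin_ext by blast
  have "lin_ext (\<lambda>L. koszul_diff \<Gamma> (cell_vec \<Gamma> L)) b = (0 :: _ \<Rightarrow>\<^sub>0 'k)"
    using 0 unfolding b(1) koszul_diff_def lin_ext_lin_ext .
  then have "b = 0"
  proof (rule lin_ext_eq_0D)
    fix L0 assume "L0 \<in> Poly_Mapping.keys b"
    then have L0: "L0 \<in> base_cells \<Gamma> (Suc n)" using b(2) by blast
    then have cL0: "cell \<Gamma> L0" "length L0 = Suc (Suc n)" by (simp_all add: base_cells_def)
    let ?W = "wrap L0"
    have W: "cell \<Gamma> ?W" using wrap_cell[of L0 \<Gamma>] cL0 by simp
    have sW: "supported \<Gamma> ?W" by (rule supported_wrap[OF conn L0])
    then obtain t where t: "t \<in> admissible_trees (contract \<Gamma> (cell_blocks ?W))"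
        "leaf_list t \<in> rotations (cell_word ?W)"
      unfolding supported_def by blast
    \<comment> \<open>Any tree that supports the wrap gives such a coordinate; its existence comes
      from \<open>supported_wrap\<close>.\<close>
    let ?\<kappa> = "(cell_blocks ?W, t, cell_paths ?W)"
    have "Poly_Mapping.lookup (cell_vec \<Gamma> ?W) ?\<kappa> =
        rotation_sign (cell_word ?W) (leaf_list t) * (tree_sign t :: 'k)"
      using sW t(1) by (simp add: lookup_cell_vec lookup_cyclic_sum supported_def)
    moreover have "rotation_sign (cell_word ?W) (leaf_list t) \<noteq> (0 :: 'k)"
    proof -
      obtain k where k: "leaf_list t = rotate k (cell_word ?W)" using t(2) by (auto simp: rotations_def)
      have "cell_word ?W \<noteq> []" using rotations_length[OF t(2)] length_leaf_list[of t] by auto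
      then show ?thesis unfolding k using rotation_sign_rotate[OF distinct_cell_word[OF W], where 'k = 'k]
        by simp
    qed
    ultimately have nz: "Poly_Mapping.lookup (cell_vec \<Gamma> ?W) ?\<kappa> \<noteq> (0 :: 'k)" by simp
    have lk: "Poly_Mapping.lookup (koszul_diff \<Gamma> (cell_vec \<Gamma> L)) ?\<kappa> =
        - (Poly_Mapping.lookup (cell_vec \<Gamma> (wrap L)) ?\<kappa> :: 'k)" if L: "L \<in> base_cells \<Gamma> (Suc n)" for L
    proof -
      have cL: "cell \<Gamma> L" "length L = Suc (Suc n)" "canonical \<Gamma> (concat L)"
        using L by (simp_all add: base_cells_def)
      have "free.subspace {x :: _ \<Rightarrow>\<^sub>0 'k. Poly_Mapping.lookup x ?\<kappa> = 0}"
        by (simp add: free.subspace_def lookup_add)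
      then have "linear_bd (cell_vec \<Gamma>) L \<in> {x :: _ \<Rightarrow>\<^sub>0 'k. Poly_Mapping.lookup x ?\<kappa> = 0}"
      proof (rule linear_bd_in_subspace)
        fix M assume "M \<in> merges L"
        then have M: "cell \<Gamma> M" "canonical \<Gamma> (concat M)"
          using merges_cell[OF _ cL(1)] merges_concat[of M L] cL(3) by simp_all
        then show "cell_vec \<Gamma> M \<in> {x :: _ \<Rightarrow>\<^sub>0 'k. Poly_Mapping.lookup x ?\<kappa> = 0}"
          using cell_vec_lookup_rotate[OF W M(1) t(2), where 'k = 'k] base_not_rotated_wrap[OF L0 M] by blast
      qed
      then show ?thesis
        using koszul_diff_cell[OF conn cL(1), where 'k = 'k] cL(2) by (simp add: cyclic_bd_def lookup_minus)
    qed
    have "Poly_Mapping.lookup (koszul_diff \<Gamma> (cell_vec \<Gamma> L)) ?\<kappa> = (0 :: 'k)"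
      if L: "L \<in> Poly_Mapping.keys b" "L \<noteq> L0" for L
    proof -
      have L': "L \<in> base_cells \<Gamma> (Suc n)" using L b(2) by blast
      then have "cell \<Gamma> (wrap L)" using wrap_cell[of L \<Gamma>] by (simp add: base_cells_def)
      then have "Poly_Mapping.lookup (cell_vec \<Gamma> (wrap L)) ?\<kappa> = (0 :: 'k)"
        using cell_vec_lookup_rotate[OF W _ t(2), where 'k = 'k] wrap_inj[OF L0 L'] L(2) by blast
      then show ?thesis using lk[OF L'] by simp
    qed
    then have "\<forall>L\<in>Poly_Mapping.keys b. L \<noteq> L0 \<longrightarrow>
        Poly_Mapping.lookup (koszul_diff \<Gamma> (cell_vec \<Gamma> L)) ?\<kappa> = (0 :: 'k)" by blast
    then show "\<exists>\<kappa>. Poly_Mapping.lookup (koszul_diff \<Gamma> (cell_vec \<Gamma> L0)) \<kappa> \<noteq> (0 :: 'k) \<and>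
      (\<forall>L\<in>Poly_Mapping.keys b. L \<noteq> L0 \<longrightarrow>
        Poly_Mapping.lookup (koszul_diff \<Gamma> (cell_vec \<Gamma> L)) \<kappa> = (0 :: 'k))"
      using lk[OF L0] nz by (intro exI[of _ ?\<kappa>] conjI) simp_all
  qed
  then show ?thesis by (simp add: b(1) lin_ext.zero)
qed

text \<open>In degree zero a base cell is a single canonical word. Its good gap closes the path to a
  Hamiltonian cycle, and different canonical words give different cycles.\<close>

lemma koszul_aug_base_injective:
  assumes y: "y \<in> (free.span (cell_vec \<Gamma> ` base_cells \<Gamma> 0) :: (_ \<Rightarrow>\<^sub>0 'k::field) set)"
    and 0: "koszul_aug \<Gamma> y = 0"
  shows "y = 0"
proof -
  obtain b where b: "y = lin_ext (cell_vec \<Gamma>) b" "Poly_Mapping.keys b \<subseteq> base_cells \<Gamma> 0"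
    using y unfolding span_image_eq_lin_ext by blast
  have base: "\<exists>x. L = [x] \<and> canonical \<Gamma> x \<and> koszul_aug \<Gamma> (cell_vec \<Gamma> L) = (basis_vec (rotations x) :: _ \<Rightarrow>\<^sub>0 'k)"
    if L0: "L \<in> base_cells \<Gamma> 0" for L
  proof -
    obtain x where x: "L = [x]" using L0 by (auto simp: base_cells_def length_Suc_conv)
    have L: "cell \<Gamma> [x]" "canonical \<Gamma> x" "path_word \<Gamma> x"
      using L0 by (simp_all add: base_cells_def x supported_def)
    have "x \<in> closed_ham_paths \<Gamma>"
      using L by (auto simp: closed_ham_paths_def ham_paths_def cell_def canonical_def good_word_def)
    then show ?thesis using L koszul_aug_single_cell[OF L(1), where 'k = 'k] by (simp add: x)
  qed
  have "lin_ext (\<lambda>L. koszul_aug \<Gamma> (cell_vec \<Gamma> L)) b = (0 :: _ \<Rightarrow>\<^sub>0 'k)"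
    using 0 unfolding b(1) koszul_aug_def lin_ext_lin_ext .
  then have "b = 0"
  proof (rule lin_ext_eq_0D)
    fix L0 assume "L0 \<in> Poly_Mapping.keys b"
    then obtain x where x: "L0 = [x]" "canonical \<Gamma> x"
        "koszul_aug \<Gamma> (cell_vec \<Gamma> L0) = (basis_vec (rotations x) :: _ \<Rightarrow>\<^sub>0 'k)"
      using base b(2) by blast
    have "Poly_Mapping.lookup (koszul_aug \<Gamma> (cell_vec \<Gamma> L)) (rotations x) = (0 :: 'k)"
      if L: "L \<in> Poly_Mapping.keys b" "L \<noteq> L0" for L
    proof -
      obtain z where z: "L = [z]" "canonical \<Gamma> z"
          "koszul_aug \<Gamma> (cell_vec \<Gamma> L) = (basis_vec (rotations z) :: _ \<Rightarrow>\<^sub>0 'k)"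
        using base[of L] b(2) L(1) by blast
      have "rotations z \<noteq> rotations x"
      proof
        assume "rotations z = rotations x"
        then have "z \<in> rotations x" using rotations_self[of z] by simp
        then show False using canonical_unique[OF x(2) z(2)] L(2) x(1) z(1) by simp
      qed
      then show ?thesis by (simp add: z(3) lookup_single when_def)
    qed
    then show "\<exists>\<kappa>. Poly_Mapping.lookup (koszul_aug \<Gamma> (cell_vec \<Gamma> L0)) \<kappa> \<noteq> (0 :: 'k) \<and>
      (\<forall>L\<in>Poly_Mapping.keys b. L \<noteq> L0 \<longrightarrow>
        Poly_Mapping.lookup (koszul_aug \<Gamma> (cell_vec \<Gamma> L)) \<kappa> = (0 :: 'k))"
      using x(3) by (intro exI[of _ "rotations x"]) simp
  qed
  then show ?thesis by (simp add: b(1) lin_ext.zero)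
qed

lemma cycham_subset_image:
  assumes conn: "connected_graph \<Gamma>"
  shows "cycham \<Gamma> \<subseteq> koszul_aug \<Gamma> ` (koszul_complex cycham_dual \<Gamma> 0 :: (koszul_basis \<Rightarrow>\<^sub>0 'k::field) set)"
  unfolding cycham_def
proof (rule free.span_minimal)
  let ?K = "koszul_complex cycham_dual \<Gamma> 0 :: (koszul_basis \<Rightarrow>\<^sub>0 'k) set"
  show "free.subspace (koszul_aug \<Gamma> ` ?K)"
    unfolding koszul_complex_eq[OF conn] koszul_aug_def span_image_lin_ext by simp
  show "basis_vec ` ham_cycles \<Gamma> \<subseteq> koszul_aug \<Gamma> ` ?K"
  proof
    fix c :: "_ \<Rightarrow>\<^sub>0 'k" assume "c \<in> basis_vec ` ham_cycles \<Gamma>"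
    then obtain x where x: "x \<in> closed_ham_paths \<Gamma>" "c = basis_vec (rotations x)"
      by (auto simp: ham_cycles_def)
    have "verts \<Gamma> \<noteq> {}" using conn by (simp add: connected_graph_def tube_def)
    then have cell: "cell \<Gamma> [x]" using x(1) by (auto simp: cell_def closed_ham_paths_def ham_paths_def)
    then have "cell_vec \<Gamma> [x] \<in> ?K"
      unfolding koszul_complex_eq[OF conn] by (intro free.span_base) auto
    moreover have "koszul_aug \<Gamma> (cell_vec \<Gamma> [x]) = c"
      using koszul_aug_single_cell[OF cell, where 'k = 'k] x by simp
    ultimately show "c \<in> koszul_aug \<Gamma> ` ?K" by blast
  qed
qed

theorem theorem4p4p2:
  fixes \<Gamma> :: graph
  assumes "connected_graph \<Gamma>"
  shows "quasi_iso
    (koszul_complex cycham_dual \<Gamma> :: nat \<Rightarrow> (koszul_basis \<Rightarrow>\<^sub>0 'k::field) set) (koszul_diff \<Gamma>)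
    (cycham_complex \<Gamma>) (\<lambda>_. 0)
    (koszul_aug \<Gamma>)"
proof (rule quasi_isoI_degree_zero)
  let ?K = "koszul_complex cycham_dual \<Gamma> :: nat \<Rightarrow> (koszul_basis \<Rightarrow>\<^sub>0 'k) set"
  interpret d: Vector_Spaces.linear smul smul "koszul_diff \<Gamma> :: (_ \<Rightarrow>\<^sub>0 'k) \<Rightarrow> _"
    unfolding koszul_diff_def by (rule linear_lin_ext)
  interpret a: Vector_Spaces.linear smul smul "koszul_aug \<Gamma> :: (_ \<Rightarrow>\<^sub>0 'k) \<Rightarrow> _"
    by (rule linear_koszul_aug)
  show K: "chain_complex ?K (koszul_diff \<Gamma>)" by (rule chain_complex_koszul_complex[OF assms])
  show "chain_complex (cycham_complex \<Gamma>) (\<lambda>_. 0 :: _ \<Rightarrow>\<^sub>0 'k)" by (rule chain_complex_cycham)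
  show map: "chain_map ?K (koszul_diff \<Gamma>) (cycham_complex \<Gamma>) (\<lambda>_. 0) (koszul_aug \<Gamma>)"
    by (rule chain_map_koszul_aug[OF assms])
  show "cycham_complex \<Gamma> (Suc n) = ({0} :: (_ \<Rightarrow>\<^sub>0 'k) set)" for n by (simp add: cycham_complex_def)
  show "cycham_complex \<Gamma> 0 \<subseteq> koszul_aug \<Gamma> ` ?K 0"
    using cycham_subset_image[OF assms] by (simp add: cycham_complex_def)
  show "x \<in> koszul_diff \<Gamma> ` ?K (Suc (Suc n))" if x: "x \<in> ?K (Suc n)" "koszul_diff \<Gamma> x = 0" for n x
  proof -
    obtain y z where yz: "y \<in> free.span (cell_vec \<Gamma> ` base_cells \<Gamma> (Suc n))"
        "z \<in> free.span (cell_vec \<Gamma> ` base_cells \<Gamma> (Suc (Suc n)))" "x = y + koszul_diff \<Gamma> z"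
      using koszul_complex_decompose[OF assms x(1)] by blast
    have z: "z \<in> ?K (Suc (Suc n))" using yz(2) base_span_subset[OF assms] by blast
    then have "koszul_diff \<Gamma> (koszul_diff \<Gamma> z) = 0" using K unfolding chain_complex_def by blast
    then have "koszul_diff \<Gamma> y = 0" using x(2) by (simp add: yz(3) d.add)
    \<comment> \<open>The base part of a cycle is itself a cycle, hence zero, and only the boundary
      is left.\<close>
    then have "y = 0" by (rule koszul_diff_base_injective[OF assms yz(1)])
    then show ?thesis using z yz(3) by simp
  qed
  show "x \<in> koszul_diff \<Gamma> ` ?K (Suc 0)" if x: "x \<in> ?K 0" "koszul_aug \<Gamma> x = 0" for x
  proof -
    obtain y z where yz: "y \<in> free.span (cell_vec \<Gamma> ` base_cells \<Gamma> 0)"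
        "z \<in> free.span (cell_vec \<Gamma> ` base_cells \<Gamma> (Suc 0))" "x = y + koszul_diff \<Gamma> z"
      using koszul_complex_decompose[OF assms x(1)] by blast
    have z: "z \<in> ?K (Suc 0)" using yz(2) base_span_subset[OF assms] by blast
    then have "koszul_aug \<Gamma> (koszul_diff \<Gamma> z) = 0" using map unfolding chain_map_def by blast
    then have "koszul_aug \<Gamma> y = 0" using x(2) by (simp add: yz(3) a.add)
    then have "y = 0" by (rule koszul_aug_base_injective[OF yz(1)])
    then show ?thesis using z yz(3) by simp
  qed
qed

end
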